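(* Consider the skewed stable linear regression model $Y_j=X_j\cdot\mu_0+\sigma_0\epsilon_j$ with non-random $X_j\in\mathbb{R}^q$, true parameter $\theta_0=(\alpha_0,\beta_0,\sigma_0,\mu_0)\in\Theta$, and $\epsilon_1,\epsilon_2,\dots$ i.i.d. $\sim S^0_{\alpha_0}(\beta_0,1,0)$. Suppose conditions (1)–(5) listed in the context hold, and let $r$ be a given constant with $0<r<\alpha_0/4$. Let $\hat\theta_n^{(0)}:=(\hat\alpha_n^{(0)},\hat\beta_n^{(0)},\hat\sigma_n^{(0)},\hat\mu_n)$, where $\hat\mu_n$ is the Cauchy quasi-maximum likelihood estimator and $(\hat\alpha_n^{(0)},\hat\beta_n^{(0)},\hat\sigma_n^{(0)})$ is the residual-based moment estimator, both defined in the context. Then $$\sqrt{n}\,\big(\hat\theta_n^{(0)}-\theta_0\big)=O_p(1)\qquad(n\to\infty)$$ under $P_{\theta_0}$.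
   Context: Stable law: $S^0_\alpha(\beta,\sigma,\delta)$ is the law with characteristic function $$u\mapsto\exp\Big\{i\delta u-(\sigma|u|)^\alpha\Big(1+i\beta\,\mathrm{sgn}(u)\tan\tfrac{\alpha\pi}{2}\,(|\sigma u|^{1-\alpha}-1)\Big)\Big\},$$ understood for $\alpha=1$ as the limit $\exp\{i\delta u-\sigma|u|(1+i\beta\frac2\pi\mathrm{sgn}(u)\log(\sigma|u|))\}$. Parameter space: $\Theta$ is a bounded convex subset of $(0,2)\times(-1,1)\times(0,\infty)\times\mathbb{R}^q$, $\theta_0\in\Theta$, and the parameter space $\Theta_\mu\ni\mu_0$ of $\mu$ is a bounded convex domain in $\mathbb{R}^q$. $P_{\theta_0},E_{\theta_0}$ are probability and expectation under $\theta_0$. Notation: $\Delta_j\zeta:=\zeta_j-\zeta_{j-1}$ for $\zeta=X,Y,\epsilon$; $A^{\otimes2}:=AA^\top$; $|x|^{\langle r\rangle}:=\mathrm{sgn}(x)|x|^r$. CQMLE: $\hat\mu_n$ is any (measurable) maximizer over the closure of $\Theta_\mu$ of $H_n^{\rm C}(\mu):=\sum_{j=2}^n\log\frac{1}{1+(\Delta_jY-\Delta_jX\cdot\mu)^2}$. Conditions: (1) There is $C_X>0$ with $\sup_j|\Delta_jX|<C_X$. (2) There are a positive definite matrix $C_0$ and $\beta_1\in(0,1/2)$ with $\sup_{n}\big|n^{\beta_1}\big(\frac1n\sum_{j=2}^n(\Delta_jX)^{\otimes2}-C_0\big)\big|<\infty$. (3) There is a matrix $D_0$ with $\lim_{n\to\infty}\frac1{n-2}\sum_{j=2}^{n-1}(\Delta_jX)(\Delta_{j+1}X)^\top=D_0$.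 (4) There are a continuous function $\mathbb{Y}$ on $\Theta_\mu$ and $\beta_2\in[0,1/2)$ such that $\sup_n\sup_{\mu\in\Theta_\mu}|n^{1/2-\beta_2}(\mathbb{Y}_n^\star(\mu)-\mathbb{Y}(\mu))|<\infty$, where $\mathbb{Y}_n^\star(\mu):=-\frac1n\sum_{j=2}^nE_{\theta_0}[\log(1+\{\sigma_0\Delta_2\epsilon-\Delta_jX\cdot(\mu-\mu_0)\}^2)-\log(1+(\sigma_0\Delta_2\epsilon)^2)]$, and there is $\lambda>0$ with $\mathbb{Y}(\mu)=\mathbb{Y}(\mu)-\mathbb{Y}(\mu_0)\le-\lambda|\mu-\mu_0|^2$ for all $\mu\in\Theta_\mu$. (5) $E_{\theta_0}[|\log(1+\epsilon_1^2)|^K]<\infty$ for every $K>0$; the symmetric law of $\sigma_0(\epsilon_2-\epsilon_1)$ has an (even) Lebesgue density $\mathfrak f$ with $\mathfrak f(1)>0$, $\sup_{x\ge1}\mathfrak f(x)\le\mathfrak f(1)\le\inf_{0\le x\le1}\mathfrak f(x)$, and $\inf_{\mathfrak c_1\le x\le\mathfrak c_2}\mathfrak f(x)\ge(1+\mathfrak b)\mathfrak f(1)$ for some $0<\mathfrak c_1<\mathfrak c_2<1$, $\mathfrak b>0$. (This condition holds automatically for the present stable noise.) Residuals: $\hat\epsilon_j:=Y_j-X_j\cdot\hat\mu_n$, $\hat\epsilon_{S,j}:=\hat\epsilon_j-\hat\epsilon_{j-1}$ ($j=2,\dots,n$), $\hat\epsilon_{C,j}:=\hat\epsilon_j+\hat\epsilon_{j-1}-2\hat\epsilon_{j-2}$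 ($j=3,\dots,n$). Moment estimators: for $s>0$ and $\alpha>s$ put $$h_s(\alpha,\sigma):=\sigma^s\,\frac{\Gamma(1-s/\alpha)}{\Gamma(1-s)}\,\frac{2^{s/\alpha}}{\cos(s\pi/2)}$$ (here used with $s=r$ and $s=2r$). $\hat\alpha_n^{(0)}$ is the solution $\alpha\in(2r,2)$ of $$\frac{\big(\frac1{n-1}\sum_{j=2}^n|\hat\epsilon_{S,j}|^r\big)^2}{\frac1{n-1}\sum_{j=2}^n|\hat\epsilon_{S,j}|^{2r}}=\frac{h_r(\alpha,\sigma)^2}{h_{2r}(\alpha,\sigma)}$$ (the right-hand side does not depend on $\sigma$); $\hat\sigma_n^{(0)}$ is the solution $\sigma>0$ of $\frac1{n-1}\sum_{j=2}^n|\hat\epsilon_{S,j}|^r=h_r(\hat\alpha_n^{(0)},\sigma)$; and $$\hat\eta_n:=\frac{\hat\alpha_n^{(0)}}{r}\arctan\Big(\tan\big(\tfrac{r\pi}2\big)\,T_n\Big),\quad T_n:=\frac{\frac1{n-2}\sum_{j=3}^n|\hat\epsilon_{C,j}|^{\langle r\rangle}}{\frac1{n-2}\sum_{j=3}^n|\hat\epsilon_{C,j}|^{r}},\quad \hat\beta_n^{(0)}:=\frac{(2+2^{\hat\alpha_n^{(0)}})\tan\hat\eta_n}{(2-2^{\hat\alpha_n^{(0)}})\tan(\hat\alpha_n^{(0)}\pi/2)},$$ where the denominator $(2-2^{\alpha})\tan(\alpha\pi/2)$ at $\alpha=1$ is interpreted as its limit $\frac4\pi\log2$. On events where these quantities are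 not defined, the estimators are given arbitrary values. *)

theory Defs
  imports "HOL-Probability.Probability"
begin

text \<open>Sequences are indexed by \<open>nat\<close>, but all observations start at index 1;
  the value at index 0 is never used.\<close>

definition stable0_char :: "real \<Rightarrow> real \<Rightarrow> real \<Rightarrow> real \<Rightarrow> real \<Rightarrow> complex" where
  "stable0_char \<alpha> \<beta> \<sigma> \<delta> u =
     (let w = (if \<alpha> = 1 then 2 / pi * ln (\<sigma> * \<bar>u\<bar>)
               else tan (\<alpha> * pi / 2) * (\<bar>\<sigma> * u\<bar> powr (1 - \<alpha>) - 1))
      in exp (\<i> * complex_of_real (\<delta> * u)
              - complex_of_real ((\<sigma> * \<bar>u\<bar>) powr \<alpha>)
                * (1 + \<i> * complex_of_real (\<beta> * sgn u * w))))"

definition has_stable0_law ::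
    "'a measure \<Rightarrow> ('a \<Rightarrow> real) \<Rightarrow> real \<Rightarrow> real \<Rightarrow> real \<Rightarrow> real \<Rightarrow> bool" where
  "has_stable0_law M Z \<alpha> \<beta> \<sigma> \<delta> \<longleftrightarrow>
     Z \<in> borel_measurable M \<and> (\<forall>u. char (distr M borel Z) u = stable0_char \<alpha> \<beta> \<sigma> \<delta> u)"

definition incr :: "(nat \<Rightarrow> 'b::ab_group_add) \<Rightarrow> nat \<Rightarrow> 'b" where
  "incr z j = z j - z (j - 1)"

definition outer :: "real ^ 'q \<Rightarrow> real ^ 'q \<Rightarrow> real ^ 'q ^ 'q" where
  "outer x y = (\<chi> i j. x $ i * y $ j)"

definition pos_def :: "real ^ 'q ^ 'q \<Rightarrow> bool" where
  "pos_def A \<longleftrightarrow> transpose A = A \<and> (\<forall>x. x \<noteq> 0 \<longrightarrow> x \<bullet> (A *v x) > 0)"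

definition signed_powr :: "real \<Rightarrow> real \<Rightarrow> real" where
  "signed_powr x r = sgn x * \<bar>x\<bar> powr r"

text \<open>Measurability is part of the definition, since \<open>measure M\<close> is \<open>0\<close> on non-measurable sets.\<close>

definition bounded_in_prob :: "'a measure \<Rightarrow> (nat \<Rightarrow> 'a \<Rightarrow> 'b::real_normed_vector) \<Rightarrow> bool" where
  "bounded_in_prob M Z \<longleftrightarrow>
     (\<forall>n. Z n \<in> borel_measurable M) \<and>
     (\<forall>\<epsilon>>0. \<exists>K>0. \<forall>\<^sub>F n in sequentially.
        measure M {\<omega> \<in> space M. norm (Z n \<omega>) > K} \<le> \<epsilon>)"

definition cauchy_qlik ::
    "(nat \<Rightarrow> real ^ 'q) \<Rightarrow> (nat \<Rightarrow> real) \<Rightarrow> nat \<Rightarrow> real ^ 'q \<Rightarrow> real" where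
  "cauchy_qlik X y n \<mu> = (\<Sum>j=2..n. ln (1 / (1 + (incr y j - incr X j \<bullet> \<mu>)\<^sup>2)))"

definition Y_star ::
    "'a measure \<Rightarrow> (nat \<Rightarrow> 'a \<Rightarrow> real) \<Rightarrow> (nat \<Rightarrow> real ^ 'q) \<Rightarrow> real \<Rightarrow> real ^ 'q
      \<Rightarrow> nat \<Rightarrow> real ^ 'q \<Rightarrow> real" where
  "Y_star M eps X \<sigma>0 \<mu>0 n \<mu> =
     - (1 / real n) * (\<Sum>j=2..n. \<integral>\<omega>.
          (ln (1 + (\<sigma>0 * incr (\<lambda>k. eps k \<omega>) 2 - incr X j \<bullet> (\<mu> - \<mu>0))\<^sup>2)
           - ln (1 + (\<sigma>0 * incr (\<lambda>k. eps k \<omega>) 2)\<^sup>2)) \<partial>M)"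

definition resid :: "(nat \<Rightarrow> real ^ 'q) \<Rightarrow> (nat \<Rightarrow> real) \<Rightarrow> real ^ 'q \<Rightarrow> nat \<Rightarrow> real" where
  "resid X y m j = y j - X j \<bullet> m"

definition resid_S :: "(nat \<Rightarrow> real) \<Rightarrow> nat \<Rightarrow> real" where
  "resid_S e j = e j - e (j - 1)"

definition resid_C :: "(nat \<Rightarrow> real) \<Rightarrow> nat \<Rightarrow> real" where
  "resid_C e j = e j + e (j - 1) - 2 * e (j - 2)"

definition moment_S :: "(nat \<Rightarrow> real) \<Rightarrow> nat \<Rightarrow> real \<Rightarrow> real" where
  "moment_S e n s = 1 / (real n - 1) * (\<Sum>j=2..n. \<bar>resid_S e j\<bar> powr s)"

definition h_mom :: "real \<Rightarrow> real \<Rightarrow> real \<Rightarrow> real" where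
  "h_mom s \<alpha> \<sigma> =
     \<sigma> powr s * (Gamma (1 - s / \<alpha>) / Gamma (1 - s)) * (2 powr (s / \<alpha>) / cos (s * pi / 2))"

text \<open>The right-hand side of the equation for \<open>\<alpha>\<close> does not depend on \<open>\<sigma>\<close>.\<close>

definition solves_alpha :: "real \<Rightarrow> (nat \<Rightarrow> real) \<Rightarrow> nat \<Rightarrow> real \<Rightarrow> bool" where
  "solves_alpha r e n \<alpha> \<longleftrightarrow> 2 * r < \<alpha> \<and> \<alpha> < 2 \<and>
     (\<forall>\<sigma>>0. (moment_S e n r)\<^sup>2 / moment_S e n (2 * r) = (h_mom r \<alpha> \<sigma>)\<^sup>2 / h_mom (2 * r) \<alpha> \<sigma>)"

definition solves_sigma :: "real \<Rightarrow> (nat \<Rightarrow> real) \<Rightarrow> nat \<Rightarrow> real \<Rightarrow> real \<Rightarrow> bool" where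
  "solves_sigma r e n \<alpha> \<sigma> \<longleftrightarrow> \<sigma> > 0 \<and> moment_S e n r = h_mom r \<alpha> \<sigma>"

definition moment_C :: "(nat \<Rightarrow> real) \<Rightarrow> nat \<Rightarrow> real \<Rightarrow> real" where
  "moment_C e n r = 1 / (real n - 2) * (\<Sum>j=3..n. \<bar>resid_C e j\<bar> powr r)"

definition signed_moment_C :: "(nat \<Rightarrow> real) \<Rightarrow> nat \<Rightarrow> real \<Rightarrow> real" where
  "signed_moment_C e n r = 1 / (real n - 2) * (\<Sum>j=3..n. signed_powr (resid_C e j) r)"

definition eta_hat :: "real \<Rightarrow> (nat \<Rightarrow> real) \<Rightarrow> nat \<Rightarrow> real \<Rightarrow> real" where
  "eta_hat r e n \<alpha> =
     \<alpha> / r * arctan (tan (r * pi / 2) * (signed_moment_C e n r / moment_C e n r))"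

text \<open>The value at \<open>\<alpha> = 1\<close> is the limit of the general expression.\<close>

definition beta_denom :: "real \<Rightarrow> real" where
  "beta_denom \<alpha> = (if \<alpha> = 1 then 4 / pi * ln 2 else (2 - 2 powr \<alpha>) * tan (\<alpha> * pi / 2))"

definition beta_formula :: "real \<Rightarrow> (nat \<Rightarrow> real) \<Rightarrow> nat \<Rightarrow> real \<Rightarrow> real" where
  "beta_formula r e n \<alpha> = (2 + 2 powr \<alpha>) * tan (eta_hat r e n \<alpha>) / beta_denom \<alpha>"

text \<open>\<open>(a, b, s)\<close> is an admissible value of the moment estimator of \<open>(\<alpha>, \<beta>, \<sigma>)\<close> computed from
  the residuals \<open>e\<close>. Each component is constrained only where it is defined: \<open>a\<close> where
  the equation for \<open>\<alpha>\<close> is solvable; \<open>s\<close> and \<open>b\<close> where moreover, respectively, the equation for \<open>\<sigma>\<close>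
  is solvable and neither the ratio of moments nor \<open>tan\<close> is evaluated at a singularity.
  No case distinction is needed for \<open>moment_S e n (2 * r) = 0\<close>: the quotient is then \<open>0\<close>, while
  the right-hand side of the equation for \<open>\<alpha>\<close> is positive when \<open>0 < r < 1/2\<close>.\<close>

definition moment_estimate ::
    "real \<Rightarrow> (nat \<Rightarrow> real) \<Rightarrow> nat \<Rightarrow> real \<Rightarrow> real \<Rightarrow> real \<Rightarrow> bool" where
  "moment_estimate r e n a b s \<longleftrightarrow>
     ((\<exists>\<alpha>. solves_alpha r e n \<alpha>) \<longrightarrow>
        solves_alpha r e n a \<and>
        ((\<exists>\<sigma>. solves_sigma r e n a \<sigma>) \<longrightarrow> solves_sigma r e n a s) \<and>
        (moment_C e n r \<noteq> 0 \<and> cos (eta_hat r e n a) \<noteq> 0 \<longrightarrow> b = beta_formula r e n a))"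

end

theory Submission
  imports Defs
begin

text \<open>The observations enter only through two contrasts of the noise,
\<open>Z j = \<sigma>0 (eps j - eps (j-1))\<close> and \<open>W j = \<sigma>0 (eps j + eps (j-1) - 2 eps (j-2))\<close>. The residual contrasts
are \<open>Z j\<close> and \<open>W j\<close> shifted by bounded multiples of the error \<open>h = \<mu>h - \<mu>0\<close> of the location estimate, so
the argument has three layers: a rate for \<open>h\<close>, a rate for the residual moments, and the inversion of the
moment equations.

\<^emph>\<open>Location.\<close> The loss \<open>ln (1 + x\<^sup>2)\<close> is Lipschitz, so Chebyshev's inequality on a finite net gives
consistency as soon as the limiting contrast grows quadratically. Near \<open>\<mu>0\<close> a third-order Taylor
expansion of the loss shows that a minimiser satisfies \<open>c n |h|\<^sup>2 \<le> |h| |S|\<close> with the score sum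
\<open>S\<close>, and \<open>S\<close> has order \<open>sqrt n\<close> because the law of \<open>Z\<close> is symmetric (\<open>cauchy_qmle_root_n\<close>). The
constant \<open>c\<close> is positive since the contrast at distance \<open>t\<close> is the mean curvature times \<open>t\<^sup>2\<close> up to
\<open>O(t\<^sup>3)\<close>, so the quadratic lower bound on the limiting contrast forces the mean curvature to be
positive (\<open>mean_curv_pos\<close>).

\<^emph>\<open>Residual moments.\<close> Only boundedness in probability is wanted, not a limit law, so the power
\<open>|x|\<^sup>s\<close> with its cusp at \<open>0\<close> need not be linearised: \<open>||z-t|\<^sup>s - |z|\<^sup>s| \<le> |t| |z|\<^bsup>s-1\<^esup>\<close> bounds the effect of
replacing noise by residuals by \<open>|h|\<close> times the sum of \<open>|Z j|\<^bsup>s-1\<^esup>\<close>, and stable laws have finite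
moments of every order in \<open>(-1, 0)\<close>. The remaining centred sum has variance of order \<open>n\<close>, because the
contrasts are two-dependent and \<open>4 r < \<alpha>0\<close> makes the powers square integrable
(\<open>residual_average_root_n\<close>).

\<^emph>\<open>Exact moments.\<close> The weights of both contrasts sum to \<open>0\<close>, which cancels the term of the exponent that is
linear in \<open>u\<close>; the contrasts are therefore strictly stable, with characteristic function
\<open>exp (-\<zeta> u\<^sup>\<alpha>)\<close> for \<open>u > 0\<close> and a complex \<open>\<zeta>\<close> whose argument encodes the skewness. The single Mellin
integral of \<open>1 - exp (-\<zeta> v)\<close> against \<open>v\<^bsup>-p-1\<^esup>\<close>, which equals \<open>\<zeta>\<^sup>p \<Gamma>(1-p)/p\<close> on the closed right
half-plane (\<open>mellin_kernel_eq\<close>), is used twice: at \<open>\<zeta> = -ix\<close> it represents \<open>|x|\<^sup>s\<close> and \<open>|x|\<^bsup>\<langle>s\<rangle>\<^esup>\<close> by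
trigonometric functions, and at the \<open>\<zeta>\<close> of the law it evaluates the resulting expectations.

\<^emph>\<open>Inversion.\<close> Each formula that turns moments into parameters is Lipschitz at the true value. The
only implicit one, the equation for \<open>\<alpha>\<close>, has a solution near \<open>\<alpha>0\<close> and no other, since
\<open>2 ln \<Gamma>(1-r/\<alpha>) - ln \<Gamma>(1-2r/\<alpha>)\<close> has a positive derivative. Hence moments within \<open>d\<close> of their
population values give parameters within \<open>C d\<close> of the true ones, for any small \<open>d\<close> and for any
choice of the estimator that the definition admits (\<open>moment_estimate_calm\<close>). The theorem is the case
\<open>d = K / sqrt n\<close>.\<close>

section \<open>Mellin integrals of the complex exponential\<close>

text \<open>The dominating function of most improper integrals below: the factor \<open>min 1 (u powr b)\<close> repairs the
singularity at \<open>0\<close> and is harmless at infinity.\<close>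

lemma set_integrable_min_powr:
  fixes s b :: real
  assumes "0 < s" "s < b"
  shows "set_integrable lborel {0<..} (\<lambda>u. min 1 (u powr b) * u powr (- s - 1))"
proof -
  have A: "(\<lambda>u. u powr (b - s - 1)) absolutely_integrable_on {0..1}"
    using has_integral_powr_from_0[of "b - s - 1" 1] assms
    by (intro nonnegative_absolutely_integrable_1) (auto simp: integrable_on_def)
  have B: "(\<lambda>u. u powr (- s - 1)) absolutely_integrable_on {1..}"
    using has_integral_powr_to_inf[of "- s - 1" 1] assms
    by (intro nonnegative_absolutely_integrable_1) (auto simp: integrable_on_def)
  have A': "(\<lambda>u. min 1 (u powr b) * u powr (- s - 1)) absolutely_integrable_on {0<..1}"
  proof -
    have "(\<lambda>u. u powr (b - s - 1)) absolutely_integrable_on {0<..1}"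
      by (rule set_integrable_subset[OF A]) auto
    moreover have "min 1 (u powr b) * u powr (- s - 1) = u powr (b - s - 1)" if "u \<in> {0<..1}" for u
    proof -
      have "u powr b \<le> 1"
        using that assms by (intro powr_le1) auto
      then show ?thesis using that by (simp add: min_def powr_add[symmetric] algebra_simps)
    qed
    ultimately show ?thesis
      by (subst set_integrable_cong) auto
  qed
  have B': "(\<lambda>u. min 1 (u powr b) * u powr (- s - 1)) absolutely_integrable_on {1..}"
  proof -
    have "min 1 (u powr b) * u powr (- s - 1) = u powr (- s - 1)" if "u \<in> {1..}" for u
      using that assms ge_one_powr_ge_zero[of u b] by (simp add: min_def)
    then show ?thesis using B
      by (subst set_integrable_cong) auto
  qed
  have "(\<lambda>u. min 1 (u powr b) * u powr (- s - 1)) absolutely_integrable_on ({0<..1} \<union> {1..})"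
    by (rule set_integrable_Un[OF A' B']) auto
  moreover have "{0<..1} \<union> {1..} = {0::real<..}" by auto
  ultimately have "integrable lebesgue (\<lambda>u. indicator {0<..} u *\<^sub>R (min 1 (u powr b) * u powr (- s - 1)))"
    by (simp add: set_integrable_def)
  then show ?thesis
    unfolding set_integrable_def by (subst (asm) integrable_completion) auto
qed

text \<open>The exponential is 1-Lipschitz on the closed half-plane, where its derivative has norm at most 1.\<close>

lemma norm_one_minus_exp_le:
  fixes w :: complex
  assumes "0 \<le> Re w"
  shows "norm (1 - exp (- w)) \<le> norm w"
proof -
  have "norm (exp (- w) - exp (- 0)) \<le> 1 * norm (w - 0)"
  proof (rule field_differentiable_bound[where S = "{z. 0 \<le> Re z}" and f' = "\<lambda>z. - exp (- z)"])
    show "convex {z. 0 \<le> Re z}" by (rule convex_halfspace_Re_ge)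
    show "((\<lambda>z. exp (- z)) has_field_derivative - exp (- z)) (at z within {z. 0 \<le> Re z})" for z :: complex
      by (auto intro!: derivative_eq_intros)
  qed (use assms in auto)
  then show ?thesis by (simp add: norm_minus_commute)
qed

lemma norm_one_minus_exp_le_min:
  fixes w :: complex
  assumes "0 \<le> Re w"
  shows "norm (1 - exp (- w)) \<le> 2 * min 1 (norm w)"
proof -
  have "norm (1 - exp (- w)) \<le> 1 + norm (exp (- w))" using norm_triangle_ineq4[of 1 "exp (- w)"] by simp
  also have "\<dots> \<le> 2" using assms by simp
  finally have "norm (1 - exp (- w)) \<le> 2" .
  then show ?thesis using norm_one_minus_exp_le[OF assms] norm_ge_zero[of w]
    unfolding min_def by (cases "1 \<le> norm w") (simp, simp del: norm_ge_zero)
qed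

lemma min_one_mult_le:
  fixes c x :: real
  assumes "0 \<le> x"
  shows "min 1 (c * x) \<le> max 1 c * min 1 x"
proof (cases "x \<le> 1")
  case True
  then have "c * x \<le> max 1 c * x" using assms by (intro mult_right_mono) auto
  with True show ?thesis by (simp add: min_def max_def)
next
  case False
  then have "min 1 x = 1" by simp
  then show ?thesis by simp
qed

lemma set_integrable_one_minus_exp_powr:
  fixes \<zeta> :: complex and s a :: real
  assumes "0 < s" "s < a" "0 \<le> Re \<zeta>"
  shows "set_integrable lborel {0<..}
    (\<lambda>u. (1 - exp (- \<zeta> * of_real (u powr a))) * of_real (u powr (- s - 1)))"
proof (rule set_integrable_bound[OF set_integrable_mult_right[OF set_integrable_min_powr[OF assms(1,2)]]])
  show "set_borel_measurable lborel {0<..}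
    (\<lambda>u. (1 - exp (- \<zeta> * of_real (u powr a))) * of_real (u powr (- s - 1)))"
    unfolding set_borel_measurable_def by measurable
  have "norm ((1 - exp (- \<zeta> * of_real (u powr a))) * of_real (u powr (- s - 1)))
      \<le> norm ((2 * max 1 (norm \<zeta>)) * (min 1 (u powr a) * u powr (- s - 1)))" for u
  proof -
    have "norm (1 - exp (- (\<zeta> * of_real (u powr a)))) \<le> 2 * min 1 (norm (\<zeta> * of_real (u powr a)))"
      using assms by (intro norm_one_minus_exp_le_min) simp
    also have "norm (\<zeta> * of_real (u powr a)) = norm \<zeta> * u powr a" by (simp add: norm_mult)
    also have "min 1 (norm \<zeta> * u powr a) \<le> max 1 (norm \<zeta>) * min 1 (u powr a)"
      by (rule min_one_mult_le) simp
    finally show ?thesis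
      using mult_right_mono[of _ _ "u powr (- s - 1)"] by (fastforce simp: norm_mult abs_mult mult.assoc)
  qed
  then show "AE u in lborel. u \<in> {0<..} \<longrightarrow>
      norm ((1 - exp (- \<zeta> * of_real (u powr a))) * of_real (u powr (- s - 1)))
      \<le> norm ((2 * max 1 (norm \<zeta>)) * (min 1 (u powr a) * u powr (- s - 1)))" by auto
qed

lemma set_integrable_exp_powr:
  fixes c k :: real
  assumes "0 < c" "- 1 < k"
  shows "set_integrable lborel {0<..} (\<lambda>v. exp (- c * v) * v powr k)"
proof -
  have "integrable lebesgue (\<lambda>t. norm (indicator {0<..} t *\<^sub>R
      (complex_of_real t powr (complex_of_real (k + 1) - 1) / of_real (exp (c * t)))))"
    using absolutely_integrable_Gamma_integral[of "of_real (k + 1)" c] assms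
    unfolding set_integrable_def by (intro integrable_norm) auto
  also have "(\<lambda>t. norm (indicator {0<..} t *\<^sub>R
      (complex_of_real t powr (complex_of_real (k + 1) - 1) / of_real (exp (c * t)))))
    = (\<lambda>t. indicator {0<..} t *\<^sub>R (exp (- c * t) * t powr k))"
    by (auto simp: fun_eq_iff indicator_def norm_divide norm_powr_real_powr exp_minus field_simps)
  finally show ?thesis
    unfolding set_integrable_def by (subst (asm) integrable_completion) auto
qed


lemma norm_exp_minus_one_minus_le:
  fixes w :: complex
  shows "norm (exp w - 1 - w) \<le> (norm w)\<^sup>2 * exp (norm w)"
proof -
  have A: "norm (exp z - 1) \<le> norm z * exp (norm z)" for z :: complex
  proof -
    have "norm (exp z - exp 0) \<le> exp (norm z) * norm (z - 0)"
    proof (rule field_differentiable_bound[where S = "cball 0 (norm z)" and f' = exp])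
      show "norm (exp x) \<le> exp (norm z)" if "x \<in> cball 0 (norm z)" for x :: complex
        using norm_exp[of x] that by (force intro: order_trans)
    qed (auto intro!: derivative_eq_intros)
    then show ?thesis by (simp add: mult.commute)
  qed
  have "norm ((exp w - 1 - w) - (exp 0 - 1 - 0)) \<le> (norm w * exp (norm w)) * norm (w - 0)"
  proof (rule field_differentiable_bound[where S = "cball 0 (norm w)" and f' = "\<lambda>z. exp z - 1"])
    show "norm (exp x - 1) \<le> norm w * exp (norm w)" if "x \<in> cball 0 (norm w)" for x :: complex
    proof -
      have "norm x \<le> norm w" using that by simp
      then have "norm x * exp (norm x) \<le> norm w * exp (norm w)" by (intro mult_mono) auto
      with A[of x] show ?thesis by linarith
    qed
  qed (auto intro!: derivative_eq_intros)
  then show ?thesis by (simp add: power2_eq_square mult_ac)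
qed

definition mellin_kernel :: "real \<Rightarrow> complex \<Rightarrow> complex" where
  "mellin_kernel p \<zeta> = (LINT v:{0<..}|lborel. (1 - exp (- \<zeta> * of_real v)) * of_real (v powr (- p - 1)))"

definition laplace_powr :: "real \<Rightarrow> complex \<Rightarrow> complex" where
  "laplace_powr p \<zeta> = (LINT v:{0<..}|lborel. exp (- \<zeta> * of_real v) * of_real (v powr (- p)))"

lemma set_integrable_mellin_kernel:
  assumes "0 < p" "p < 1" "0 \<le> Re \<zeta>"
  shows "set_integrable lborel {0<..} (\<lambda>v. (1 - exp (- \<zeta> * of_real v)) * of_real (v powr (- p - 1)))"
proof -
  have "set_integrable lborel {0<..}
    (\<lambda>v. (1 - exp (- \<zeta> * of_real (v powr 1))) * of_real (v powr (- p - 1)))"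
    using assms by (intro set_integrable_one_minus_exp_powr) auto
  then show ?thesis by (subst (asm) set_integrable_cong) auto
qed

lemma set_integrable_complex_exp_powr:
  assumes "- 1 < k" "0 < Re \<zeta>"
  shows "set_integrable lborel {0<..} (\<lambda>v. exp (- \<zeta> * of_real v) * of_real (v powr k))"
  by (rule set_integrable_bound[OF set_integrable_exp_powr[OF assms(2,1)]])
     (auto simp: set_borel_measurable_def norm_mult)

text \<open>Integration by parts; the boundary terms vanish because the bracket is \<open>O(v)\<close> at \<open>0\<close> and
bounded at infinity, and \<open>0 < p < 1\<close>.\<close>

lemma mellin_kernel_by_parts:
  assumes "0 < p" "p < 1" "0 < Re \<zeta>"
  shows "of_real p * mellin_kernel p \<zeta> = \<zeta> * laplace_powr p \<zeta>"
proof -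
  define F where "F v = - ((1 - exp (- \<zeta> * of_real v)) * of_real (v powr (- p)))" for v
  define f where "f v = of_real p * ((1 - exp (- \<zeta> * of_real v)) * of_real (v powr (- p - 1)))
      - \<zeta> * (exp (- \<zeta> * of_real v) * of_real (v powr (- p)))" for v
  have i1: "set_integrable lborel {0<..} (\<lambda>v. of_real p * ((1 - exp (- \<zeta> * of_real v)) * of_real (v powr (- p - 1))))"
    using assms set_integrable_mellin_kernel by (intro set_integrable_mult_right) auto
  have i2: "set_integrable lborel {0<..} (\<lambda>v. \<zeta> * (exp (- \<zeta> * of_real v) * of_real (v powr (- p))))"
    using assms set_integrable_complex_exp_powr by (intro set_integrable_mult_right) auto
  have "(LBINT v=0..\<infinity>. f v) = 0 - 0"
  proof (rule interval_integral_FTC_integrable)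
    show "(F has_vector_derivative f x) (at x)" if "0 < ereal x" "ereal x < \<infinity>" for x
    proof -
      have x: "x > 0" using that by simp
      have "((\<lambda>v. v powr (- p)) has_real_derivative - p * x powr (- p - 1)) (at x)"
        using x by (auto intro!: derivative_eq_intros)
      then have d: "((\<lambda>v. of_real (v powr (- p)) :: complex) has_vector_derivative of_real (- p * x powr (- p - 1))) (at x)"
        by (intro has_vector_derivative_of_real) (simp add: has_real_derivative_iff_has_vector_derivative)
      have e: "((\<lambda>v. 1 - exp (- \<zeta> * of_real v)) has_vector_derivative \<zeta> * exp (- \<zeta> * of_real x)) (at x)"
        by (rule has_vector_derivative_real_field) (auto intro!: derivative_eq_intros)
      show ?thesis unfolding F_def f_def
        using has_vector_derivative_minus[OF has_vector_derivative_mult[OF e d]]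
        by (simp add: algebra_simps)
    qed
    show "isCont f x" if "0 < ereal x" "ereal x < \<infinity>" for x
      using that unfolding f_def by (auto intro!: continuous_intros)
    show "set_integrable lborel (einterval 0 \<infinity>) f"
      using set_integral_diff(1)[OF i1 i2] by (simp add: f_def[abs_def] zero_ereal_def)
    have "(F \<longlongrightarrow> 0) (at_right 0)"
    proof (rule Lim_null_comparison)
      show "\<forall>\<^sub>F v in at_right 0. norm (F v) \<le> norm \<zeta> * v powr (1 - p)"
        using eventually_at_right_less[of 0]
      proof eventually_elim
        case (elim v)
        have "norm (1 - exp (- (\<zeta> * of_real v))) \<le> norm (\<zeta> * of_real v)"
          using assms elim by (intro norm_one_minus_exp_le) simp
        then have "norm (F v) \<le> (norm \<zeta> * v) * v powr (- p)"
          unfolding F_def using elim by (auto simp: norm_mult intro!: mult_right_mono)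
        then show ?case using elim by (simp add: powr_diff powr_minus field_simps)
      qed
      show "((\<lambda>v. norm \<zeta> * v powr (1 - p)) \<longlongrightarrow> 0) (at_right 0)"
        using assms by (auto intro!: tendsto_mult_right_zero tendsto_eq_intros simp: eventually_at_filter)
    qed
    then show "((F \<circ> real_of_ereal) \<longlongrightarrow> 0) (at_right 0)"
      by (simp add: zero_ereal_def ereal_tendsto_simps)
    have "(F \<longlongrightarrow> 0) at_top"
    proof (rule Lim_null_comparison)
      show "\<forall>\<^sub>F v in at_top. norm (F v) \<le> 2 * v powr (- p)"
        using eventually_gt_at_top[of 0]
      proof eventually_elim
        case (elim v)
        have "norm (1 - exp (- (\<zeta> * of_real v))) \<le> 2 * min 1 (norm (\<zeta> * of_real v))"
          using assms elim by (intro norm_one_minus_exp_le_min) simp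
        then have "norm (1 - exp (- (\<zeta> * of_real v))) \<le> 2" by linarith
        then show ?case
          unfolding F_def using elim by (auto simp: norm_mult intro!: mult_right_mono)
      qed
      show "((\<lambda>v. 2 * v powr (- p)) \<longlongrightarrow> 0) at_top"
        using assms by (intro tendsto_mult_right_zero tendsto_neg_powr filterlim_ident) auto
    qed
    then show "((F \<circ> real_of_ereal) \<longlongrightarrow> 0) (at_left \<infinity>)"
      by (simp add: ereal_tendsto_simps)
  qed simp
  then show ?thesis
    using set_integral_diff(2)[OF i1 i2]
    by (simp add: interval_lebesgue_integral_0_infty f_def[abs_def] mellin_kernel_def laplace_powr_def)
qed

text \<open>Differentiation under the integral, done quantitatively: the second-order remainder of the
exponential leaves an integral that is \<open>O(|h|\<^sup>2)\<close>, uniformly for \<open>|h|\<close> below half the distance to the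
imaginary axis.\<close>

lemma mellin_kernel_has_derivative:
  assumes p: "0 < p" "p < 1" and \<zeta>: "0 < Re \<zeta>"
  shows "(mellin_kernel p has_field_derivative laplace_powr p \<zeta>) (at \<zeta>)"
proof -
  define \<rho> where "\<rho> = Re \<zeta>"
  define C where "C = (LINT v:{0<..}|lborel. exp (- (\<rho> / 2) * v) * v powr (1 - p))"
  have iC: "set_integrable lborel {0<..} (\<lambda>v. exp (- (\<rho> / 2) * v) * v powr (1 - p))"
    using p \<zeta> by (intro set_integrable_exp_powr) (auto simp: \<rho>_def)
  have bound: "norm (mellin_kernel p (\<zeta> + h) - mellin_kernel p \<zeta> - h * laplace_powr p \<zeta>) \<le> C * (norm h)\<^sup>2"
    if h: "norm h < \<rho> / 2" for h
  proof -
    have "\<bar>Re h\<bar> \<le> norm h" by (rule abs_Re_le_cmod)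
    then have Re: "Re (\<zeta> + h) > 0" using h \<zeta> by (simp add: \<rho>_def)
    define g where "g v = exp (- \<zeta> * of_real v) * (1 - h * of_real v - exp (- h * of_real v)) * of_real (v powr (- p - 1))" for v
    note i1 = set_integrable_mellin_kernel[OF p less_imp_le[OF Re]]
      and i2 = set_integrable_mellin_kernel[OF p less_imp_le[OF \<zeta>]]
    have "set_integrable lborel {0<..} (\<lambda>v. exp (- \<zeta> * of_real v) * of_real (v powr (- p)))"
      using p \<zeta> by (intro set_integrable_complex_exp_powr) auto
    then have i3: "set_integrable lborel {0<..} (\<lambda>v. h * (exp (- \<zeta> * of_real v) * of_real (v powr (- p))))"
      by (rule set_integrable_mult_right)
    note i12 = set_integral_diff[OF i1 i2]
    note i123 = set_integral_diff[OF i12(1) i3]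
    have eq: "(1 - exp (- (\<zeta> + h) * of_real v)) * of_real (v powr (- p - 1))
        - (1 - exp (- \<zeta> * of_real v)) * of_real (v powr (- p - 1))
        - h * (exp (- \<zeta> * of_real v) * of_real (v powr (- p))) = g v" if "v \<in> {0<..}" for v
    proof -
      have "v powr (- p) = v * v powr (- p - 1)"
        using that powr_mult_base[of v "- p - 1"] by simp
      then have a: "complex_of_real (v powr (- p)) = of_real v * of_real (v powr (- p - 1))"
        by (metis of_real_mult)
      have b: "exp (- (\<zeta> + h) * of_real v) = exp (- \<zeta> * of_real v) * exp (- h * of_real v)"
        by (simp flip: exp_add add: algebra_simps)
      have "(1 - E * D) * w - (1 - E) * w - h * (E * (v * w)) = E * (1 - h * v - D) * w"
        for E D v w :: complex by (simp add: algebra_simps)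
      then show ?thesis unfolding g_def a b .
    qed
    have ig: "set_integrable lborel {0<..} g"
      using i123(1) by (subst set_integrable_cong[OF refl refl eq[symmetric]]) auto
    have "mellin_kernel p (\<zeta> + h) - mellin_kernel p \<zeta> - h * laplace_powr p \<zeta> = (LINT v:{0<..}|lborel. g v)"
    proof -
      have "(LINT v:{0<..}|lborel. g v) = (LINT v:{0<..}|lborel.
          (1 - exp (- (\<zeta> + h) * of_real v)) * of_real (v powr (- p - 1))
        - (1 - exp (- \<zeta> * of_real v)) * of_real (v powr (- p - 1))
        - h * (exp (- \<zeta> * of_real v) * of_real (v powr (- p))))"
        by (rule set_lebesgue_integral_cong) (use eq in auto)
      then show ?thesis
        unfolding i123(2) i12(2) mellin_kernel_def laplace_powr_def set_integral_mult_right by simp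
    qed
    also have "norm \<dots> \<le> (LINT v:{0<..}|lborel. norm (g v))"
      by (rule set_integral_norm_bound[OF ig])
    also have "\<dots> \<le> (LINT v:{0<..}|lborel. (norm h)\<^sup>2 * (exp (- (\<rho> / 2) * v) * v powr (1 - p)))"
    proof (rule set_integral_mono)
      show "set_integrable lborel {0<..} (\<lambda>v. norm (g v))" using ig by (rule set_integrable_norm)
      show "set_integrable lborel {0<..} (\<lambda>v. (norm h)\<^sup>2 * (exp (- (\<rho> / 2) * v) * v powr (1 - p)))"
        using iC by (rule set_integrable_mult_right)
      fix v :: real assume "v \<in> {0<..}"
      then have v: "v > 0" by simp
      have "norm (1 - h * of_real v - exp (- h * of_real v)) \<le> (norm h * v)\<^sup>2 * exp (norm h * v)"
        using norm_exp_minus_one_minus_le[of "- h * of_real v"] v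
        by (subst norm_minus_commute) (simp add: norm_mult algebra_simps)
      also have "\<dots> \<le> (norm h * v)\<^sup>2 * exp (\<rho> / 2 * v)"
        using h v by (intro mult_left_mono) auto
      finally have "norm (g v) \<le> exp (- \<rho> * v) * ((norm h * v)\<^sup>2 * exp (\<rho> / 2 * v)) * v powr (- p - 1)"
        unfolding g_def norm_mult using v by (auto simp: \<rho>_def intro!: mult_right_mono mult_left_mono)
      also have "\<dots> = (norm h)\<^sup>2 * ((exp (- \<rho> * v) * exp (\<rho> / 2 * v)) * (v\<^sup>2 * v powr (- p - 1)))"
        by (simp add: power_mult_distrib mult_ac)
      also have "exp (- \<rho> * v) * exp (\<rho> / 2 * v) = exp (- (\<rho> / 2) * v)"
        by (simp flip: exp_add)
      also have "v\<^sup>2 * v powr (- p - 1) = v powr (1 - p)"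
        using v by (simp add: powr_diff powr_minus power2_eq_square field_simps)
      finally show "norm (g v) \<le> (norm h)\<^sup>2 * (exp (- (\<rho> / 2) * v) * v powr (1 - p))" .
    qed
    also have "\<dots> = C * (norm h)\<^sup>2" by (simp add: C_def)
    finally show ?thesis .
  qed
  show ?thesis
    unfolding DERIV_def
  proof (rule LIM_zero_cancel, rule Lim_null_comparison)
    show "\<forall>\<^sub>F h in at 0. norm ((mellin_kernel p (\<zeta> + h) - mellin_kernel p \<zeta>) / h - laplace_powr p \<zeta>) \<le> C * norm h"
    proof -
      have "\<forall>\<^sub>F h in at (0::complex). norm h < \<rho> / 2"
        using \<zeta> by (auto simp: eventually_at \<rho>_def intro!: exI[of _ "Re \<zeta> / 2"])
      moreover have "\<forall>\<^sub>F h in at (0::complex). h \<noteq> 0" by (simp add: eventually_at_filter)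
      ultimately show ?thesis
      proof eventually_elim
        case (elim h)
        have "(mellin_kernel p (\<zeta> + h) - mellin_kernel p \<zeta>) / h - laplace_powr p \<zeta>
            = (mellin_kernel p (\<zeta> + h) - mellin_kernel p \<zeta> - h * laplace_powr p \<zeta>) / h"
          using elim by (simp add: field_simps)
        also have "norm \<dots> \<le> C * (norm h)\<^sup>2 / norm h"
          unfolding norm_divide using elim bound by (intro divide_right_mono) auto
        finally show ?case using elim by (simp add: power2_eq_square)
      qed
    qed
    show "((\<lambda>h. C * norm h) \<longlongrightarrow> 0) (at (0::complex))"
      by (auto intro!: tendsto_eq_intros)
  qed
qed

lemma laplace_powr_one:
  assumes "0 < p" "p < 1"
  shows "laplace_powr p 1 = of_real (Gamma (1 - p))"
proof -
  define f :: "real \<Rightarrow> complex" where "f v = exp (- 1 * of_real v) * of_real (v powr (- p))" for v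
  have i: "set_integrable lborel {0<..} f"
    unfolding f_def using assms by (intro set_integrable_complex_exp_powr) auto
  have "((\<lambda>t. of_real t powr (of_real (1 - p) - 1) / of_real (exp t)) has_integral Gamma (of_real (1 - p) :: complex)) {0<..}"
    using assms by (intro Gamma_integral_complex') auto
  then have "(f has_integral Gamma (of_real (1 - p))) {0<..}"
  proof (rule has_integral_eq[rotated])
    fix t :: real assume t: "t \<in> {0<..}"
    have "complex_of_real t powr (of_real (1 - p) - 1) = of_real (t powr (- p))"
      using t by (simp flip: powr_of_real)
    then show "of_real t powr (of_real (1 - p) - 1) / of_real (exp t) = f t"
      by (simp add: f_def exp_minus exp_of_real field_simps)
  qed
  then have "(f has_integral of_real (Gamma (1 - p))) {0<..}"
    unfolding Gamma_complex_of_real .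
  then show ?thesis
    using set_borel_integral_eq_integral(2)[OF i]
    by (simp add: laplace_powr_def f_def[abs_def] integral_unique)
qed

text \<open>The derivative of the Mellin integral \<open>K\<close> is the Laplace integral \<open>J\<close>, and \<open>p K = \<zeta> J\<close>
by parts. So \<open>\<zeta> K' = p K\<close>, which makes \<open>\<zeta>\<^bsup>-p\<^esup> K\<close> constant on the half-plane; its value at \<open>1\<close> is a
Gamma integral.\<close>

lemma mellin_kernel_eq_right_half_plane:
  assumes p: "0 < p" "p < 1" and \<zeta>: "0 < Re \<zeta>"
  shows "mellin_kernel p \<zeta> = \<zeta> powr of_real p * of_real (Gamma (1 - p) / p)"
proof -
  define g where "g z = z powr (- of_real p) * mellin_kernel p z" for z
  have d: "(g has_field_derivative 0) (at z within {z. 0 < Re z})" if "z \<in> {z. 0 < Re z}" for z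
  proof -
    have z: "0 < Re z" using that by simp
    have nz: "z \<noteq> 0" using z by auto
    have nn: "z \<notin> \<real>\<^sub>\<le>\<^sub>0" using z by (auto simp: complex_nonpos_Reals_iff)
    have "(g has_field_derivative (- of_real p * z powr (- of_real p - 1) * mellin_kernel p z
        + laplace_powr p z * z powr (- of_real p))) (at z)"
      unfolding g_def
      by (intro DERIV_mult has_field_derivative_powr mellin_kernel_has_derivative p z nn)
    moreover have "- of_real p * z powr (- of_real p - 1) * mellin_kernel p z
        + laplace_powr p z * z powr (- of_real p)
        = - (z powr (- of_real p - 1)) * (of_real p * mellin_kernel p z - z * laplace_powr p z)"
    proof -
      have a: "z powr (- of_real p) = z powr (- of_real p - 1) * z"
        using nz by (simp add: powr_diff)
      show ?thesis unfolding a by (simp add: algebra_simps)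
    qed
    moreover have "of_real p * mellin_kernel p z - z * laplace_powr p z = 0"
      using mellin_kernel_by_parts[OF p z] by simp
    ultimately have "(g has_field_derivative 0) (at z)" by simp
    then show ?thesis by (rule has_field_derivative_at_within)
  qed
  have "\<exists>c. \<forall>z\<in>{z. 0 < Re z}. g z = c"
    by (rule has_field_derivative_zero_constant[OF convex_halfspace_Re_gt[of 0]]) (use d in auto)
  then have "g \<zeta> = g 1" using \<zeta> by auto
  also have "g 1 = of_real (Gamma (1 - p) / p)"
    using mellin_kernel_by_parts[OF p, of 1] laplace_powr_one[OF p] p
    by (simp add: g_def field_simps)
  finally have "\<zeta> powr of_real p * (\<zeta> powr (- of_real p) * mellin_kernel p \<zeta>)
      = \<zeta> powr of_real p * of_real (Gamma (1 - p) / p)" by (simp add: g_def)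
  moreover have "\<zeta> powr of_real p * \<zeta> powr (- of_real p) = 1"
    using \<zeta> by (subst powr_add[symmetric]) auto
  ultimately show ?thesis by (metis mult.assoc mult_1)
qed

text \<open>Both sides are continuous up to the imaginary axis, the left one by dominated convergence. The
boundary values are the ones that represent powers of \<open>|x|\<close> by sines and cosines.\<close>

theorem mellin_kernel_eq:
  assumes p: "0 < p" "p < 1" and \<zeta>: "0 \<le> Re \<zeta>" "\<zeta> \<noteq> 0"
  shows "mellin_kernel p \<zeta> = \<zeta> powr of_real p * of_real (Gamma (1 - p) / p)"
proof (cases "Re \<zeta> = 0")
  case False
  then show ?thesis using mellin_kernel_eq_right_half_plane p \<zeta> by auto
next
  case True
  \<comment> \<open>Approach the boundary point from inside the half-plane.\<close>
  define z where "z k = \<zeta> + of_real (inverse (real (Suc k)))" for k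
  have z_lim: "z \<longlonglongrightarrow> \<zeta>"
    unfolding z_def using tendsto_add[OF tendsto_const tendsto_of_real[OF LIMSEQ_inverse_real_of_nat], of \<zeta>]
    by simp
  have z_Re: "Re (z k) > 0" for k by (simp add: z_def True)
  have z_norm: "norm (z k) \<le> norm \<zeta> + 1" for k
  proof -
    have "norm (z k) \<le> norm \<zeta> + norm (complex_of_real (inverse (real (Suc k))))"
      unfolding z_def by (rule norm_triangle_ineq)
    also have "norm (complex_of_real (inverse (real (Suc k)))) \<le> 1"
      by (simp add: norm_inverse inverse_le_1_iff del: of_nat_Suc of_real_inverse)
    finally show ?thesis by simp
  qed
  define B where "B = 2 * max 1 (norm \<zeta> + 1)"
  have "(\<lambda>k. mellin_kernel p (z k)) \<longlonglongrightarrow> mellin_kernel p \<zeta>"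
    unfolding mellin_kernel_def set_lebesgue_integral_def
  proof (rule integral_dominated_convergence[where
        w = "\<lambda>v. indicator {0<..} v *\<^sub>R (B * (min 1 (v powr 1) * v powr (- p - 1)))"])
    show "integrable lborel (\<lambda>v. indicator {0<..} v *\<^sub>R (B * (min 1 (v powr 1) * v powr (- p - 1))))"
      using set_integrable_mult_right[OF set_integrable_min_powr[of p 1], of B] p
      by (simp add: set_integrable_def)
    show "AE v in lborel. (\<lambda>k. indicat_real {0<..} v *\<^sub>R ((1 - exp (- z k * of_real v)) * of_real (v powr (- p - 1))))
       \<longlonglongrightarrow> indicat_real {0<..} v *\<^sub>R ((1 - exp (- \<zeta> * of_real v)) * of_real (v powr (- p - 1)))"
      by (intro AE_I2 tendsto_intros z_lim)
    show "AE v in lborel. norm (indicat_real {0<..} v *\<^sub>R ((1 - exp (- z k * of_real v)) * of_real (v powr (- p - 1))))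
       \<le> indicator {0<..} v *\<^sub>R (B * (min 1 (v powr 1) * v powr (- p - 1)))" for k
    proof (rule AE_I2)
      fix v :: real
      show "norm (indicat_real {0<..} v *\<^sub>R ((1 - exp (- z k * of_real v)) * of_real (v powr (- p - 1))))
       \<le> indicator {0<..} v *\<^sub>R (B * (min 1 (v powr 1) * v powr (- p - 1)))"
      proof (cases "v > 0")
        case True
        have "norm (1 - exp (- (z k * of_real v))) \<le> 2 * min 1 (norm (z k * of_real v))"
          using z_Re[of k] True by (intro norm_one_minus_exp_le_min) simp
        also have "norm (z k * of_real v) = norm (z k) * v" using True by (simp add: norm_mult)
        also have "min 1 (norm (z k) * v) \<le> min 1 ((norm \<zeta> + 1) * v)"
          using z_norm[of k] True by (intro min.mono mult_right_mono) auto
        also have "min 1 ((norm \<zeta> + 1) * v) \<le> max 1 (norm \<zeta> + 1) * min 1 v"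
          using True by (intro min_one_mult_le) simp
        finally have "norm (1 - exp (- (z k * of_real v))) \<le> B * min 1 v"
          by (simp only: B_def mult.assoc)
        then have "norm (1 - exp (- (z k * of_real v))) * v powr (- p - 1) \<le> B * min 1 v * v powr (- p - 1)"
          by (rule mult_right_mono) simp
        then show ?thesis using True by (simp add: norm_mult mult.assoc)
      qed auto
    qed
  qed measurable
  moreover have "(\<lambda>k. mellin_kernel p (z k)) \<longlonglongrightarrow> \<zeta> powr of_real p * of_real (Gamma (1 - p) / p)"
  proof -
    have "\<zeta> \<notin> \<real>\<^sub>\<le>\<^sub>0" using \<zeta> True by (auto simp: complex_nonpos_Reals_iff complex_eq_iff)
    then have "(\<lambda>k. z k powr of_real p * of_real (Gamma (1 - p) / p))
        \<longlonglongrightarrow> \<zeta> powr of_real p * of_real (Gamma (1 - p) / p)"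
      by (intro tendsto_intros z_lim) auto
    then show ?thesis
      using mellin_kernel_eq_right_half_plane[OF p z_Re] by simp
  qed
  ultimately show ?thesis by (rule LIMSEQ_unique)
qed

lemma integral_one_minus_exp_powr:
  fixes s a :: real
  assumes s: "0 < s" "s < a" and \<zeta>: "0 \<le> Re \<zeta>" "\<zeta> \<noteq> 0"
  shows "(LINT u:{0<..}|lborel. (1 - exp (- \<zeta> * of_real (u powr a))) * of_real (u powr (- s - 1)))
    = \<zeta> powr of_real (s / a) * of_real (Gamma (1 - s / a) / s)"
proof -
  define p where "p = s / a"
  have p: "0 < p" "p < 1" using s by (auto simp: p_def)
  have a: "a > 0" using s by simp
  define f where "f v = (1 - exp (- \<zeta> * of_real v)) * of_real (v powr (- p - 1))" for v
  define w where "w u = (1 - exp (- \<zeta> * of_real (u powr a))) * of_real (u powr (- s - 1))" for u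
  have eq: "(a * u powr (a - 1)) *\<^sub>R f (u powr a) = of_real a * w u" if "u > 0" for u
  proof -
    have "u powr (a - 1) * (u powr a) powr (- p - 1) = u powr (- s - 1)"
      using that a by (simp add: powr_powr powr_add[symmetric] p_def field_simps)
    then have "complex_of_real (u powr (a - 1)) * of_real ((u powr a) powr (- p - 1)) = of_real (u powr (- s - 1))"
      by (metis of_real_mult)
    then show ?thesis unfolding f_def w_def by (simp add: scaleR_conv_of_real mult_ac)
  qed
  have iw: "set_integrable lborel {0<..} (\<lambda>u. of_real a * w u)"
    unfolding w_def using s \<zeta> by (intro set_integrable_mult_right set_integrable_one_minus_exp_powr) auto
  have "(LBINT v=0..\<infinity>. f v) = (LBINT u=0..\<infinity>. (a * u powr (a - 1)) *\<^sub>R f (u powr a))"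
  proof (rule interval_integral_substitution_integrable)
    show "((\<lambda>x. x powr a) has_real_derivative a * x powr (a - 1)) (at x)" if "0 < ereal x" "ereal x < \<infinity>" for x
      using that by (auto intro!: derivative_eq_intros)
    show "isCont f (x powr a)" if "0 < ereal x" "ereal x < \<infinity>" for x
      using that unfolding f_def by (intro continuous_intros) auto
    show "isCont (\<lambda>x. a * x powr (a - 1)) x" if "0 < ereal x" "ereal x < \<infinity>" for x
      using that by (intro continuous_intros) auto
    show "0 \<le> a * x powr (a - 1)" for x using a by simp
    have "((\<lambda>x. x powr a) \<longlongrightarrow> 0) (at_right 0)"
      using a by (auto intro!: tendsto_eq_intros simp: eventually_at_filter)
    then show "((ereal \<circ> (\<lambda>x. x powr a) \<circ> real_of_ereal) \<longlongrightarrow> 0) (at_right 0)"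
      by (simp add: zero_ereal_def ereal_tendsto_simps)
    have "filterlim (\<lambda>x. exp (a * ln x)) at_top at_top"
      using a by (intro filterlim_compose[OF exp_at_top] filterlim_tendsto_pos_mult_at_top[OF tendsto_const] ln_at_top)
    moreover have "\<forall>\<^sub>F x in at_top. exp (a * ln x) = x powr a"
      using eventually_gt_at_top[of 0] by eventually_elim (simp add: powr_def)
    ultimately have "filterlim (\<lambda>x. x powr a) at_top at_top"
      by (simp cong: filterlim_cong)
    then show "((ereal \<circ> (\<lambda>x. x powr a) \<circ> real_of_ereal) \<longlongrightarrow> \<infinity>) (at_left \<infinity>)"
      by (simp add: ereal_tendsto_simps)
    show "set_integrable lborel (einterval 0 \<infinity>) (\<lambda>x. (a * x powr (a - 1)) *\<^sub>R f (x powr a))"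
      using iw by (subst set_integrable_cong[OF refl _ eq]) (auto simp: zero_ereal_def)
    show "set_integrable lborel (einterval 0 \<infinity>) f"
      using set_integrable_mellin_kernel[OF p \<zeta>(1)] by (simp add: f_def[abs_def] zero_ereal_def)
  qed simp
  then have "mellin_kernel p \<zeta> = (LINT u:{0<..}|lborel. of_real a * w u)"
    using set_lebesgue_integral_cong[of "{0<..}" lborel "\<lambda>u. (a * u powr (a - 1)) *\<^sub>R f (u powr a)" "\<lambda>u. of_real a * w u"] eq
    by (simp add: interval_lebesgue_integral_0_infty mellin_kernel_def f_def[abs_def])
  also have "\<dots> = of_real a * (LINT u:{0<..}|lborel. w u)" by (rule set_integral_mult_right)
  finally have "of_real a * (LINT u:{0<..}|lborel. w u) = \<zeta> powr of_real p * of_real (Gamma (1 - p) / p)"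
    using mellin_kernel_eq[OF p \<zeta>] by simp
  then show ?thesis using a s by (simp add: w_def[abs_def] p_def field_simps)
qed

section \<open>Moments of strictly stable laws\<close>

text \<open>By scaling, the integral on the right is a multiple of \<open>|x|\<^sup>s\<close>. A lower bound suffices for
integrability and needs only \<open>u\<close> with \<open>1 \<le> u |x| \<le> 2\<close>; unlike the exact Mellin formula it is
available for exponents above \<open>1\<close>.\<close>

lemma abs_powr_le_nn_integral_one_minus_cos:
  fixes s x :: real
  assumes s: "0 < s"
  shows "ennreal (\<bar>x\<bar> powr s) \<le> ennreal (2 powr (s + 1) / (1 - cos 1)) *
    (\<integral>\<^sup>+u. ennreal (indicator {0<..} u * ((1 - cos (u * x)) * u powr (- s - 1))) \<partial>lborel)"
proof (cases "x = 0")
  case False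
  define y where "y = \<bar>x\<bar>"
  have y: "y > 0" using False by (simp add: y_def)
  have c1: "1 - cos 1 > (0::real)"
    using cos_monotone_0_pi[of 0 1] pi_ge_two by simp
  have "ennreal ((1 - cos 1) * (2 / y) powr (- s - 1) * (1 / y))
      = (\<integral>\<^sup>+u. ennreal ((1 - cos 1) * (2 / y) powr (- s - 1)) * indicator {1/y..2/y} u \<partial>lborel)"
    using y c1 by (subst nn_integral_cmult_indicator)
      (auto simp: ennreal_mult[symmetric] divide_right_mono diff_divide_distrib[symmetric])
  also have "\<dots> \<le> (\<integral>\<^sup>+u. ennreal (indicator {0<..} u * ((1 - cos (u * x)) * u powr (- s - 1))) \<partial>lborel)"
  proof (rule nn_integral_mono)
    fix u :: real
    show "ennreal ((1 - cos 1) * (2 / y) powr (- s - 1)) * indicator {1/y..2/y} u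
      \<le> ennreal (indicator {0<..} u * ((1 - cos (u * x)) * u powr (- s - 1)))"
    proof (cases "u \<in> {1/y..2/y}")
      case True
      then have u: "u > 0" using y by (auto intro: less_le_trans[of 0 "1/y"])
      have uy: "1 \<le> u * y" "u * y \<le> 2" using True y by (auto simp: field_simps)
      have "cos (u * x) = cos (u * y)" by (cases "x \<ge> 0") (auto simp: y_def)
      also have "\<dots> \<le> cos 1"
        using uy pi_ge_two by (intro cos_monotone_0_pi_le) auto
      finally have "1 - cos 1 \<le> 1 - cos (u * x)" by simp
      moreover have "(2 / y) powr (- s - 1) \<le> u powr (- s - 1)"
        using u True s by (intro powr_mono2') auto
      ultimately have "(1 - cos 1) * (2 / y) powr (- s - 1) \<le> (1 - cos (u * x)) * u powr (- s - 1)"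
        using c1 by (intro mult_mono) auto
      then show ?thesis using True u by (auto intro: ennreal_leI)
    qed simp
  qed
  finally have *: "ennreal ((1 - cos 1) * (2 / y) powr (- s - 1) * (1 / y))
    \<le> (\<integral>\<^sup>+u. ennreal (indicator {0<..} u * ((1 - cos (u * x)) * u powr (- s - 1))) \<partial>lborel)" .
  have "(2 / y) powr (- s - 1) * (1 / y) = y powr s / 2 powr (s + 1)"
    using y by (simp add: powr_divide powr_minus powr_diff powr_add field_simps)
  then have "ennreal (y powr s) = ennreal (2 powr (s + 1) / (1 - cos 1)) *
      ennreal ((1 - cos 1) * (2 / y) powr (- s - 1) * (1 / y))"
    using c1 y by (subst ennreal_mult[symmetric]) (auto simp: field_simps)
  with mult_left_mono[OF *, of "ennreal (2 powr (s + 1) / (1 - cos 1))"] show ?thesis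
    by (simp add: y_def)
qed simp

text \<open>Laws with characteristic function \<open>exp (-\<zeta> u\<^sup>a)\<close> for \<open>u > 0\<close>, which determines it everywhere. A
complex \<open>\<zeta>\<close> covers skewed laws, and for \<open>a = 1\<close> the shifted Cauchy laws.\<close>

locale stable_char = real_distribution N for N :: "real measure" +
  fixes a :: real and \<zeta> :: complex
  assumes index: "0 < a" and Re_nonneg: "0 \<le> Re \<zeta>" and nonzero: "\<zeta> \<noteq> 0"
    and char_eq: "0 < u \<Longrightarrow> char N u = exp (- \<zeta> * of_real (u powr a))"
begin

lemma prob_UNIV [simp]: "prob UNIV = 1"
  using prob_space by simp

text \<open>Integrate the previous bound over the law: \<open>1 - cos (u x)\<close> becomes the real part of
\<open>1 - exp (-\<zeta> u\<^sup>a)\<close>, which is \<open>O(min 1 u\<^sup>a)\<close>.\<close>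

lemma integrable_abs_powr:
  assumes s: "0 < s" "s < a"
  shows "integrable N (\<lambda>x. \<bar>x\<bar> powr s)"
proof -
  interpret P: pair_sigma_finite N lborel ..
  define K where "K = ennreal (2 powr (s + 1) / (1 - cos 1))"
  define B where "B = 2 * max 1 (norm \<zeta>)"
  have inner: "(\<integral>\<^sup>+x. ennreal (indicator {0<..} u * ((1 - cos (u * x)) * u powr (- s - 1))) \<partial>N)
      \<le> ennreal (indicator {0<..} u *\<^sub>R (B * (min 1 (u powr a) * u powr (- s - 1))))" for u :: real
  proof (cases "u > 0")
    case True
    have "integrable N (\<lambda>x. 1 - cos (u * x))"
      by (rule integrable_const_bound[where B = 2]) (auto simp: abs_le_iff intro!: AE_I2 order_trans[OF _ cos_ge_minus_one])
    then have "(\<integral>\<^sup>+x. ennreal (1 - cos (u * x)) \<partial>N) = ennreal (\<integral>x. 1 - cos (u * x) \<partial>N)"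
      by (intro nn_integral_eq_integral) auto
    also have "(\<integral>x. 1 - cos (u * x) \<partial>N) = Re (1 - char N u)"
    proof -
      have "integrable N (\<lambda>x. iexp (u * x))" by (rule integrable_iexp) auto
      then have Re_char: "Re (char N u) = (\<integral>x. Re (iexp (u * x)) \<partial>N)"
        unfolding char_def by (rule integral_Re[symmetric])
      have "integrable N (\<lambda>x. cos (u * x))"
        by (rule integrable_const_bound[where B = 1]) auto
      then show ?thesis
        using Re_char by (simp add: Re_exp)
    qed
    also have "\<dots> \<le> norm (1 - exp (- (\<zeta> * of_real (u powr a))))"
      using complex_Re_le_cmod[of "1 - char N u"] char_eq[OF True] by simp
    also have "\<dots> \<le> 2 * min 1 (norm (\<zeta> * of_real (u powr a)))"
      using Re_nonneg by (intro norm_one_minus_exp_le_min) simp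
    also have "norm (\<zeta> * of_real (u powr a)) = norm \<zeta> * u powr a" by (simp add: norm_mult)
    also have "2 * min 1 (norm \<zeta> * u powr a) \<le> B * min 1 (u powr a)"
      using min_one_mult_le[of "u powr a" "norm \<zeta>"] by (simp only: B_def mult.assoc) simp
    finally have "(\<integral>\<^sup>+x. ennreal (1 - cos (u * x)) \<partial>N) \<le> ennreal (B * min 1 (u powr a))"
      by (auto intro: ennreal_leI)
    then have "(\<integral>\<^sup>+x. ennreal (1 - cos (u * x)) \<partial>N) * ennreal (u powr (- s - 1))
        \<le> ennreal (B * min 1 (u powr a)) * ennreal (u powr (- s - 1))"
      by (rule mult_right_mono) simp
    then show ?thesis
      using True by (simp add: ennreal_mult'' nn_integral_multc mult.assoc)
  qed simp
  have fin: "(\<integral>\<^sup>+u. ennreal (indicator {0<..} u *\<^sub>R (B * (min 1 (u powr a) * u powr (- s - 1)))) \<partial>lborel) < \<infinity>"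
  proof -
    have "set_integrable lborel {0<..} (\<lambda>u. B * (min 1 (u powr a) * u powr (- s - 1)))"
      by (intro set_integrable_mult_right set_integrable_min_powr s)
    then show ?thesis
      unfolding set_integrable_def
      by (subst nn_integral_eq_integral) (auto simp: B_def indicator_def)
  qed
  have "(\<integral>\<^sup>+x. ennreal (\<bar>x\<bar> powr s) \<partial>N) \<le>
      (\<integral>\<^sup>+x. K * (\<integral>\<^sup>+u. ennreal (indicator {0<..} u * ((1 - cos (u * x)) * u powr (- s - 1))) \<partial>lborel) \<partial>N)"
    unfolding K_def by (intro nn_integral_mono abs_powr_le_nn_integral_one_minus_cos s)
  also have "\<dots> = K * (\<integral>\<^sup>+x. (\<integral>\<^sup>+u. ennreal (indicator {0<..} u * ((1 - cos (u * x)) * u powr (- s - 1))) \<partial>lborel) \<partial>N)"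
    by (rule nn_integral_cmult) measurable
  also have "(\<integral>\<^sup>+x. (\<integral>\<^sup>+u. ennreal (indicator {0<..} u * ((1 - cos (u * x)) * u powr (- s - 1))) \<partial>lborel) \<partial>N)
     = (\<integral>\<^sup>+u. (\<integral>\<^sup>+x. ennreal (indicator {0<..} u * ((1 - cos (u * x)) * u powr (- s - 1))) \<partial>N) \<partial>lborel)"
    by (rule P.Fubini'[symmetric]) measurable
  also have "K * \<dots> \<le> K * (\<integral>\<^sup>+u. ennreal (indicator {0<..} u *\<^sub>R (B * (min 1 (u powr a) * u powr (- s - 1)))) \<partial>lborel)"
    by (intro mult_left_mono nn_integral_mono inner) simp
  also have "\<dots> < \<infinity>" using fin by (simp add: K_def ennreal_mult_less_top)
  finally have "(\<integral>\<^sup>+x. ennreal (\<bar>x\<bar> powr s) \<partial>N) < \<infinity>" .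
  then show ?thesis
    by (intro integrableI_nonneg) auto
qed


text \<open>Integrate \<open>(1 - exp (iux)) u\<^bsup>-s-1\<^esup>\<close> over \<open>u > 0\<close> and over the law. In one order the inner integral is
the Mellin kernel at \<open>-ix\<close>, whose real and imaginary parts are multiples of the absolute and of the
signed power; in the other order it is the Mellin integral at \<open>\<zeta>\<close>.\<close>

lemma moments:
  assumes s: "0 < s" "s < a" "s < 1"
  shows "expectation (\<lambda>x. \<bar>x\<bar> powr s) * (cos (s * pi / 2) * Gamma (1 - s))
      = Re (\<zeta> powr of_real (s / a)) * Gamma (1 - s / a)"
    and "expectation (\<lambda>x. sgn x * \<bar>x\<bar> powr s) * (sin (s * pi / 2) * Gamma (1 - s))
      = - Im (\<zeta> powr of_real (s / a)) * Gamma (1 - s / a)"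
proof -
  interpret P: pair_sigma_finite N lborel ..
  define f :: "real \<Rightarrow> real \<Rightarrow> complex" where
    "f x u = indicator {0<..} u *\<^sub>R ((1 - iexp (u * x)) * of_real (u powr (- s - 1)))" for x u
  define G where "G = Gamma (1 - s) / s"
  have f_meas [measurable]: "(\<lambda>(x, u). f x u) \<in> borel_measurable (N \<Otimes>\<^sub>M lborel)"
    unfolding f_def by measurable
  have iabs: "integrable N (\<lambda>x. \<bar>x\<bar> powr s)" using s by (intro integrable_abs_powr) auto
  have isgn: "integrable N (\<lambda>x. sgn x * \<bar>x\<bar> powr s)"
    by (rule Bochner_Integration.integrable_bound[OF iabs]) (auto simp: abs_mult sgn_if)
  define phi where "phi x = complex_of_real (\<bar>x\<bar> powr s * cos (s * pi / 2)) -
      \<i> * of_real (sgn x * \<bar>x\<bar> powr s * sin (s * pi / 2))" for x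
  have kernel: "set_integrable lborel {0<..} (\<lambda>u. (1 - exp (- z * of_real u)) * of_real (u powr (- s - 1)))"
      "z \<noteq> 0 \<Longrightarrow> (LINT u:{0<..}|lborel. (1 - exp (- z * of_real u)) * of_real (u powr (- s - 1)))
        = z powr of_real s * of_real G" if "0 \<le> Re z" for z :: complex
    using set_integrable_mellin_kernel[of s z] mellin_kernel_eq[of s z] that s
    by (auto simp: mellin_kernel_def G_def)
  have inner: "(\<integral>u. f x u \<partial>lborel) = phi x * of_real G" for x
  proof (cases "x = 0")
    case True then show ?thesis by (simp add: f_def phi_def)
  next
    case False
    define z where "z = - \<i> * of_real x"
    have "(\<integral>u. f x u \<partial>lborel) = z powr of_real s * of_real G"
      using kernel(2)[of z] False by (simp add: z_def f_def set_lebesgue_integral_def mult_ac)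
    also have "z powr of_real s = phi x"
    proof -
      have z: "z \<noteq> 0" using False by (simp add: z_def)
      have ln: "Ln z = of_real (ln \<bar>x\<bar>) - \<i> * of_real (sgn x * pi / 2)"
      proof (cases "x > 0")
        case True
        then have "Ln z = ln (of_real x) - \<i> * of_real pi / 2"
          unfolding z_def using Ln_times_of_real[of x "- \<i>"]
          by (simp add: Ln_of_real Ln_minus_ii mult.commute)
        then show ?thesis using True by (simp add: Ln_of_real)
      next
        case neg: False
        then have "z = of_real (- x) * \<i>" by (simp add: z_def)
        moreover have "Ln (of_real (- x) * \<i>) = ln (of_real (- x)) + Ln \<i>"
          using neg False Ln_times_of_real[of "- x" "\<i>"] by (simp add: Ln_of_real)
        moreover have "ln (complex_of_real (- x)) = of_real (ln (- x))"
          using neg False by (intro Ln_of_real) simp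
        ultimately show ?thesis using neg False by (simp add: Ln_ii)
      qed
      have "z powr of_real s = exp (of_real (s * ln \<bar>x\<bar>) - \<i> * of_real (sgn x * (s * pi / 2)))"
        using z unfolding powr_def ln by (simp add: algebra_simps)
      also have "\<dots> = exp (of_real (s * ln \<bar>x\<bar>)) * exp (\<i> * of_real (- (sgn x * (s * pi / 2))))"
        unfolding exp_add[symmetric] by simp
      also have "exp (complex_of_real (s * ln \<bar>x\<bar>)) = of_real (\<bar>x\<bar> powr s)"
        unfolding exp_of_real using False by (simp add: powr_def)
      also have "exp (\<i> * of_real (- (sgn x * (s * pi / 2)))) = of_real (cos (s * pi / 2)) - \<i> * of_real (sgn x * sin (s * pi / 2))"
        unfolding cis_conv_exp[symmetric] using False
        by (cases "x > 0") (auto simp: complex_eq_iff sgn_if)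
      finally show ?thesis by (simp add: phi_def algebra_simps)
    qed
    finally show ?thesis .
  qed
  have int_f: "integrable lborel (\<lambda>u. f x u)" for x
    using kernel(1)[of "- \<i> * of_real x"] by (simp add: set_integrable_def f_def mult_ac)
  have norm_f: "(\<integral>u. norm (f x u) \<partial>lborel) \<le> 4 * (\<bar>x\<bar> powr s * G)" for x
  proof (cases "x = 0")
    case True then show ?thesis by (simp add: f_def)
  next
    case False
    define h where "h u = indicator {0<..} u *\<^sub>R ((1 - exp (- \<bar>x\<bar> * u)) * u powr (- s - 1))" for u
    have eq: "indicator {0<..} u *\<^sub>R ((1 - exp (- complex_of_real \<bar>x\<bar> * of_real u)) * of_real (u powr (- s - 1)))
        = complex_of_real (h u)" for u
      by (simp add: h_def scaleR_conv_of_real exp_of_real[symmetric])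
    have "integrable lborel (\<lambda>u. complex_of_real (h u))"
      using kernel(1)[of "of_real \<bar>x\<bar>"] unfolding set_integrable_def eq by simp
    then have ih: "integrable lborel h" by (simp add: complex_of_real_integrable_eq)
    have "complex_of_real (\<integral>u. h u \<partial>lborel) = complex_of_real \<bar>x\<bar> powr of_real s * of_real G"
      using kernel(2)[of "of_real \<bar>x\<bar>"] False unfolding set_lebesgue_integral_def eq by simp
    also have "\<dots> = complex_of_real (\<bar>x\<bar> powr s * G)" by (simp add: powr_of_real)
    finally have h: "(\<integral>u. h u \<partial>lborel) = \<bar>x\<bar> powr s * G" by (simp only: of_real_eq_iff)
    have "(\<integral>u. norm (f x u) \<partial>lborel) \<le> (\<integral>u. 4 * h u \<partial>lborel)"
    proof (rule integral_mono)
      show "integrable lborel (\<lambda>u. norm (f x u))" using int_f by (rule integrable_norm)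
      show "integrable lborel (\<lambda>u. 4 * h u)" using ih by simp
      show "norm (f x u) \<le> 4 * h u" for u
      proof (cases "u > 0")
        case True
        define y where "y = \<bar>x\<bar> * u"
        have y: "y \<ge> 0" using True by (simp add: y_def)
        have "norm (1 - iexp (u * x)) \<le> 2 * min 1 y"
          using norm_one_minus_exp_le_min[of "- (\<i> * of_real (u * x))"] True
          by (simp add: norm_mult abs_mult y_def mult_ac)
        also have "min 1 y \<le> 2 * (1 - exp (- y))"
        proof -
          have "exp (- y) \<le> 1 / (1 + y)"
            using exp_ge_add_one_self[of y] y by (simp add: exp_minus divide_simps)
          then have "2 * (1 - 1 / (1 + y)) \<le> 2 * (1 - exp (- y))" by simp
          moreover have "min 1 y \<le> 2 * (1 - 1 / (1 + y))"
            using y mult_left_le[of y y] by (auto simp: min_def field_simps)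
          ultimately show ?thesis by (rule order_trans[rotated])
        qed
        finally have "norm (1 - iexp (u * x)) \<le> 4 * (1 - exp (- y))" by simp
        then have "norm (1 - iexp (u * x)) * u powr (- s - 1) \<le> 4 * (1 - exp (- y)) * u powr (- s - 1)"
          by (rule mult_right_mono) simp
        then show ?thesis using True by (simp add: f_def h_def norm_mult y_def)
      qed (simp add: f_def h_def)
    qed
    with h show ?thesis by simp
  qed
  have int_pair: "integrable (N \<Otimes>\<^sub>M lborel) (\<lambda>(x, u). f x u)"
  proof (rule P.Fubini_integrable)
    show "integrable N (\<lambda>x. \<integral>u. norm (case (x, u) of (x, u) \<Rightarrow> f x u) \<partial>lborel)"
    proof (rule Bochner_Integration.integrable_bound[of N "\<lambda>x. 4 * (\<bar>x\<bar> powr s * G)"])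
      show "integrable N (\<lambda>x. 4 * (\<bar>x\<bar> powr s * G))" using iabs by simp
      show "AE x in N. norm (\<integral>u. norm (case (x, u) of (x, u) \<Rightarrow> f x u) \<partial>lborel) \<le> norm (4 * (\<bar>x\<bar> powr s * G))"
      proof (rule AE_I2)
        fix x show "norm (\<integral>u. norm (case (x, u) of (x, u) \<Rightarrow> f x u) \<partial>lborel) \<le> norm (4 * (\<bar>x\<bar> powr s * G))"
          using norm_f[of x] by (simp add: abs_of_nonneg integral_nonneg)
      qed
    qed measurable
    show "AE x in N. integrable lborel (\<lambda>u. case (x, u) of (x, u) \<Rightarrow> f x u)" using int_f by simp
  qed measurable
  have "(\<integral>x. (\<integral>u. f x u \<partial>lborel) \<partial>N) = (\<integral>u. (\<integral>x. f x u \<partial>N) \<partial>lborel)"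
    using P.Fubini_integral[OF int_pair] by simp
  also have "\<dots> = (\<integral>u. indicator {0<..} u *\<^sub>R ((1 - exp (- \<zeta> * of_real (u powr a))) * of_real (u powr (- s - 1))) \<partial>lborel)"
  proof (rule Bochner_Integration.integral_cong[OF refl])
    fix u :: real
    show "(\<integral>x. f x u \<partial>N) = indicator {0<..} u *\<^sub>R ((1 - exp (- \<zeta> * of_real (u powr a))) * of_real (u powr (- s - 1)))"
    proof (cases "u > 0")
      case True
      have "integrable N (\<lambda>x. iexp (u * x))" by (rule integrable_iexp) auto
      then have "(\<integral>x. 1 - iexp (u * x) \<partial>N) = 1 - char N u"
        unfolding char_def by (subst Bochner_Integration.integral_diff) (auto simp: prob_space)
      then show ?thesis using True char_eq[OF True] by (simp add: f_def)
    qed (simp add: f_def)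
  qed
  also have "\<dots> = \<zeta> powr of_real (s / a) * of_real (Gamma (1 - s / a) / s)"
    using integral_one_minus_exp_powr[OF s(1,2) Re_nonneg nonzero] by (simp add: set_lebesgue_integral_def)
  finally have main: "(\<integral>x. phi x \<partial>N) * of_real G = \<zeta> powr of_real (s / a) * of_real (Gamma (1 - s / a) / s)"
    by (simp add: inner)
  have "(\<integral>x. phi x \<partial>N) = of_real (expectation (\<lambda>x. \<bar>x\<bar> powr s) * cos (s * pi / 2)) -
      \<i> * of_real (expectation (\<lambda>x. sgn x * \<bar>x\<bar> powr s) * sin (s * pi / 2))"
    unfolding phi_def using iabs isgn
    by (subst Bochner_Integration.integral_diff) (auto simp flip: of_real_mult)
  with main have eq: "(of_real (expectation (\<lambda>x. \<bar>x\<bar> powr s) * cos (s * pi / 2)) -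
      \<i> * of_real (expectation (\<lambda>x. sgn x * \<bar>x\<bar> powr s) * sin (s * pi / 2))) * of_real G
      = \<zeta> powr of_real (s / a) * of_real (Gamma (1 - s / a) / s)" by simp
  show "expectation (\<lambda>x. \<bar>x\<bar> powr s) * (cos (s * pi / 2) * Gamma (1 - s))
      = Re (\<zeta> powr of_real (s / a)) * Gamma (1 - s / a)"
    using arg_cong[OF eq, of Re] s by (simp add: G_def field_simps)
  show "expectation (\<lambda>x. sgn x * \<bar>x\<bar> powr s) * (sin (s * pi / 2) * Gamma (1 - s))
      = - Im (\<zeta> powr of_real (s / a)) * Gamma (1 - s / a)"
    using arg_cong[OF eq, of Im] s by (simp add: G_def field_simps)
qed

end

lemma laplace_exp:
  assumes "0 < Re \<zeta>"
  shows "set_integrable lborel {0<..} (\<lambda>u. exp (- \<zeta> * complex_of_real u))"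
    and "(LINT u:{0<..}|lborel. exp (- \<zeta> * complex_of_real u)) = 1 / \<zeta>"
proof -
  have "set_integrable lborel {0<..} (\<lambda>u. exp (- \<zeta> * of_real u) * of_real (u powr 0))"
    using assms by (intro set_integrable_complex_exp_powr) auto
  then show i: "set_integrable lborel {0<..} (\<lambda>u. exp (- \<zeta> * complex_of_real u))"
    by (subst (asm) set_integrable_cong) auto
  have nz: "\<zeta> \<noteq> 0" using assms by auto
  define F where "F u = - exp (- \<zeta> * complex_of_real u) / \<zeta>" for u
  have "(LBINT u=0..\<infinity>. exp (- \<zeta> * complex_of_real u)) = 0 - (- 1 / \<zeta>)"
  proof (rule interval_integral_FTC_integrable)
    show "(F has_vector_derivative exp (- \<zeta> * complex_of_real x)) (at x)" for x
      unfolding F_def using nz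
      by (intro has_vector_derivative_real_field) (auto intro!: derivative_eq_intros)
    show "isCont (\<lambda>u. exp (- \<zeta> * complex_of_real u)) x" for x by (intro continuous_intros)
    show "set_integrable lborel (einterval 0 \<infinity>) (\<lambda>u. exp (- \<zeta> * complex_of_real u))"
      using i by (simp add: zero_ereal_def)
    have "(F \<longlongrightarrow> - exp (- \<zeta> * complex_of_real 0) / \<zeta>) (at_right 0)"
      unfolding F_def using nz by (intro tendsto_intros) auto
    then show "((F \<circ> real_of_ereal) \<longlongrightarrow> - 1 / \<zeta>) (at_right 0)"
      by (simp add: zero_ereal_def ereal_tendsto_simps)
    have "(F \<longlongrightarrow> 0) at_top"
    proof (rule Lim_null_comparison)
      show "\<forall>\<^sub>F u in at_top. norm (F u) \<le> exp (- (Re \<zeta> * u)) / norm \<zeta>"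
        by (simp add: F_def norm_divide)
      have "filterlim (\<lambda>u. Re \<zeta> * u) at_top at_top"
        using assms by (intro filterlim_tendsto_pos_mult_at_top[OF tendsto_const] filterlim_ident) auto
      then show "((\<lambda>u. exp (- (Re \<zeta> * u)) / norm \<zeta>) \<longlongrightarrow> 0) at_top"
        by (intro tendsto_divide_zero filterlim_compose[OF exp_at_bot])
           (simp add: filterlim_uminus_at_bot)
    qed
    then show "((F \<circ> real_of_ereal) \<longlongrightarrow> 0) (at_left \<infinity>)"
      by (simp add: ereal_tendsto_simps)
  qed simp
  then show "(LINT u:{0<..}|lborel. exp (- \<zeta> * complex_of_real u)) = 1 / \<zeta>"
    by (simp add: interval_lebesgue_integral_0_infty)
qed

lemma set_integrable_exp_minus_powr:
  fixes a c :: real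
  assumes "0 < a" "0 < c"
  shows "set_integrable lborel {0<..} (\<lambda>u. exp (- c * u powr a))"
proof -
  \<comment> \<open>With \<open>y = c u\<^sup>a\<close> and \<open>a m \<ge> 2\<close>, the bound \<open>exp y \<ge> (1 + y / m)\<^sup>m\<close> gives decay of order \<open>u\<^bsup>-2\<^esup>\<close>.\<close>
  define m where "m = nat \<lceil>2 / a\<rceil>"
  have m: "2 / a \<le> real m" "m > 0" using assms by (auto simp: m_def)
  define K where "K = max 1 ((real m / c) ^ m)"
  have bound: "exp (- c * u powr a) \<le> K * (min 1 (u powr 2) * u powr (- 1 - 1))" if "u > 0" for u
  proof (cases "u \<le> 1")
    case True
    have "u powr 2 \<le> 1" using True that by (intro powr_le1) (auto simp del: powr_numeral)
    then have "min 1 (u powr 2) * u powr (- 1 - 1) = 1"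
      using that unfolding min_absorb2[OF \<open>u powr 2 \<le> 1\<close>] powr_add[symmetric] by simp
    moreover have "exp (- c * u powr a) \<le> 1" using assms by simp
    moreover have "1 \<le> K" by (simp add: K_def)
    ultimately show ?thesis by (simp only: mult_1_right)
  next
    case False
    have "u powr 2 \<ge> 1" using False by (intro ge_one_powr_ge_zero) auto
    have "u powr 2 \<le> u powr (a * real m)"
    proof (rule powr_mono)
      show "2 \<le> a * real m" using m(1) assms(1) by (simp add: pos_divide_le_eq mult.commute)
    qed (use False in simp)
    also have "\<dots> = (u powr a) powr real m" by (simp add: powr_powr)
    also have "\<dots> = (u powr a) ^ m" using that by (intro powr_realpow) simp
    also have "\<dots> = (real m / c) ^ m * (c * u powr a / real m) ^ m"
    proof -
      have "real m / c * (c * u powr a / real m) = u powr a" using m assms by simp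
      then show ?thesis by (simp only: power_mult_distrib[symmetric])
    qed
    also have "\<dots> \<le> K * (1 + c * u powr a / real m) ^ m"
      using assms by (intro mult_mono power_mono) (auto simp: K_def)
    also have "\<dots> \<le> K * exp (c * u powr a)"
    proof (intro mult_left_mono exp_ge_one_plus_x_over_n_power_n)
      have "0 \<le> c * u powr a" using assms by simp
      then show "- real m \<le> c * u powr a" by linarith
    qed (auto simp: K_def m)
    finally have "exp (- c * u powr a) \<le> K / u powr 2"
      using that by (simp add: exp_minus field_simps)
    with \<open>u powr 2 \<ge> 1\<close> that show ?thesis by (simp add: powr_minus divide_simps)
  qed
  have "set_integrable lborel {0<..} (\<lambda>u. K * (min 1 (u powr 2) * u powr (- 1 - 1)))"
    by (intro set_integrable_mult_right set_integrable_min_powr) auto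
  then show ?thesis
  proof (rule set_integrable_bound)
    show "AE u in lborel. u \<in> {0<..} \<longrightarrow> norm (exp (- c * u powr a))
        \<le> norm (K * (min 1 (u powr 2) * u powr (- 1 - 1)))"
    proof (intro AE_I2 impI)
      fix u :: real assume "u \<in> {0<..}"
      then have "exp (- c * u powr a) \<le> K * (min 1 (u powr 2) * u powr (- 1 - 1))"
        using bound by simp
      then show "norm (exp (- c * u powr a)) \<le> norm (K * (min 1 (u powr 2) * u powr (- 1 - 1)))"
        unfolding real_norm_def by (simp only: abs_of_pos[OF exp_gt_zero])
    qed
  qed (simp add: set_borel_measurable_def)
qed

text \<open>By scaling, the integral of the Poisson kernel \<open>d / (d\<^sup>2 + x\<^sup>2)\<close> against \<open>d\<^bsup>-p\<^esup>\<close> is a multiple of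
\<open>|x|\<^bsup>-p\<^esup>\<close>; the range \<open>|x| \<le> d \<le> 2 |x|\<close> already gives a lower bound.\<close>

lemma powr_minus_le_nn_integral:
  fixes x p :: real
  assumes "0 < p"
  shows "ennreal (\<bar>x\<bar> powr (- p)) \<le> ennreal (5 * 2 powr p) *
    (\<integral>\<^sup>+d. ennreal (indicator {0<..} d * (d powr (- p) * (d / (d\<^sup>2 + x\<^sup>2)))) \<partial>lborel)"
proof (cases "x = 0")
  case False
  define y where "y = \<bar>x\<bar>"
  have y: "y > 0" using False by (simp add: y_def)
  have "ennreal ((2 * y) powr (- p) * (1 / (5 * y)) * y)
      = (\<integral>\<^sup>+d. ennreal ((2 * y) powr (- p) * (1 / (5 * y))) * indicator {y..2 * y} d \<partial>lborel)"
    using y by (subst nn_integral_cmult_indicator) (auto simp: ennreal_mult[symmetric])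
  also have "\<dots> \<le> (\<integral>\<^sup>+d. ennreal (indicator {0<..} d * (d powr (- p) * (d / (d\<^sup>2 + x\<^sup>2)))) \<partial>lborel)"
  proof (rule nn_integral_mono)
    fix d :: real
    show "ennreal ((2 * y) powr (- p) * (1 / (5 * y))) * indicator {y..2 * y} d
      \<le> ennreal (indicator {0<..} d * (d powr (- p) * (d / (d\<^sup>2 + x\<^sup>2))))"
    proof (cases "d \<in> {y..2 * y}")
      case True
      have d: "d > 0" using True y by auto
      have "(2 * y) powr (- p) \<le> d powr (- p)" using True assms d by (intro powr_mono2') auto
      moreover have "1 / (5 * y) \<le> d / (d\<^sup>2 + x\<^sup>2)"
      proof -
        have "d\<^sup>2 + x\<^sup>2 \<le> 5 * y * d"
        proof -
          have "d * d \<le> d * (2 * y)" "y * y \<le> y * d" using True d y by (auto intro!: mult_left_mono)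
          moreover have "d\<^sup>2 + x\<^sup>2 = d * d + y * y" by (simp add: y_def power2_eq_square)
          moreover have "0 \<le> y * d" using y d by simp
          ultimately show ?thesis by (simp add: mult_ac)
        qed
        moreover have "d\<^sup>2 + x\<^sup>2 > 0" using d by (simp add: add_pos_nonneg)
        ultimately show ?thesis using y by (simp add: divide_simps mult_ac)
      qed
      ultimately have "(2 * y) powr (- p) * (1 / (5 * y)) \<le> d powr (- p) * (d / (d\<^sup>2 + x\<^sup>2))"
        using y by (intro mult_mono) auto
      then show ?thesis using True d by (auto intro: ennreal_leI)
    qed simp
  qed
  finally have *: "ennreal ((2 * y) powr (- p) * (1 / (5 * y)) * y)
    \<le> (\<integral>\<^sup>+d. ennreal (indicator {0<..} d * (d powr (- p) * (d / (d\<^sup>2 + x\<^sup>2)))) \<partial>lborel)" .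
  have "ennreal (y powr (- p)) = ennreal (5 * 2 powr p) * ennreal ((2 * y) powr (- p) * (1 / (5 * y)) * y)"
    using y by (subst ennreal_mult[symmetric]) (auto simp: powr_mult powr_minus field_simps)
  with mult_left_mono[OF *, of "ennreal (5 * 2 powr p)"] show ?thesis by (simp add: y_def)
qed simp

context stable_char
begin

text \<open>The Poisson kernel is the Laplace transform in \<open>u\<close> of \<open>cos (u x)\<close>, so its expectation is at most
the integral of the modulus of the characteristic function, for every \<open>d\<close>. This plays the role of a
bounded density.\<close>

lemma poisson_kernel_bound:
  assumes Re_pos: "0 < Re \<zeta>" and d: "0 < d"
  shows "expectation (\<lambda>x. d / (d\<^sup>2 + x\<^sup>2)) \<le> (LINT u:{0<..}|lborel. exp (- Re \<zeta> * u powr a))"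
    and "integrable N (\<lambda>x. d / (d\<^sup>2 + x\<^sup>2))"
proof -
  interpret P: pair_sigma_finite N lborel ..
  define z where "z x = of_real d - \<i> * of_real x" for x :: real
  have Re_z: "Re (z x) = d" for x by (simp add: z_def)
  define f where "f x u = indicator {0<..} u *\<^sub>R exp (- z x * complex_of_real u)" for x u :: real
  have f_eq: "f x u = indicator {0<..} u *\<^sub>R (of_real (exp (- d * u)) * iexp (u * x))" for x u
    unfolding f_def z_def by (simp add: exp_of_real[symmetric] exp_add[symmetric] algebra_simps)
  have meas [measurable]: "(\<lambda>(x, u). f x u) \<in> borel_measurable (N \<Otimes>\<^sub>M lborel)"
    unfolding f_eq by measurable
  have inner: "integrable lborel (f x)" "(\<integral>u. f x u \<partial>lborel) = 1 / z x" for x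
    using laplace_exp[of "z x"] d unfolding f_def[abs_def] set_integrable_def set_lebesgue_integral_def
    by (auto simp: Re_z)
  have norm_f: "norm (f x u) = indicator {0<..} u * exp (- d * u)" for x u
    by (simp add: f_eq norm_mult)
  have int_pair: "integrable (N \<Otimes>\<^sub>M lborel) (\<lambda>(x, u). f x u)"
    by (rule P.Fubini_integrable) (auto simp: norm_f inner)
  have Re_kernel: "Re (1 / z x) = d / (d\<^sup>2 + x\<^sup>2)" for x
    unfolding z_def by (simp add: complex_div_gt_0 Re_divide power2_eq_square)
  have "integrable N (\<lambda>x. \<integral>u. f x u \<partial>lborel)" using P.integrable_fst[OF int_pair] .
  then have i: "integrable N (\<lambda>x. 1 / z x)" by (simp only: inner)
  from integrable_Re[OF this] show "integrable N (\<lambda>x. d / (d\<^sup>2 + x\<^sup>2))" by (simp only: Re_kernel)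
  have "expectation (\<lambda>x. d / (d\<^sup>2 + x\<^sup>2)) = Re (\<integral>x. 1 / z x \<partial>N)"
    using integral_Re[OF i] by (simp only: Re_kernel)
  also have "(\<integral>x. 1 / z x \<partial>N) = (\<integral>u. (\<integral>x. f x u \<partial>N) \<partial>lborel)"
    using P.Fubini_integral[OF int_pair] by (simp add: inner)
  also have "Re \<dots> \<le> norm \<dots>" by (rule complex_Re_le_cmod)
  also have "\<dots> \<le> (\<integral>u. norm (\<integral>x. f x u \<partial>N) \<partial>lborel)" by (rule integral_norm_bound)
  also have "\<dots> \<le> (\<integral>u. indicator {0<..} u *\<^sub>R exp (- Re \<zeta> * u powr a) \<partial>lborel)"
  proof (rule integral_mono)
    show "integrable lborel (\<lambda>u. norm (\<integral>x. f x u \<partial>N))"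
      using P.integrable_snd[OF int_pair] by (rule integrable_norm)
    show "integrable lborel (\<lambda>u. indicator {0<..} u *\<^sub>R exp (- Re \<zeta> * u powr a))"
      using set_integrable_exp_minus_powr[OF index Re_pos] by (simp add: set_integrable_def)
    show "norm (\<integral>x. f x u \<partial>N) \<le> indicator {0<..} u *\<^sub>R exp (- Re \<zeta> * u powr a)" for u
    proof (cases "u > 0")
      case True
      have "(\<integral>x. f x u \<partial>N) = of_real (exp (- d * u)) * char N u"
        using True unfolding f_eq char_def by simp
      also have "norm \<dots> = exp (- d * u) * exp (- Re \<zeta> * u powr a)"
        using char_eq[OF True] by (simp add: norm_mult)
      also have "\<dots> \<le> 1 * exp (- Re \<zeta> * u powr a)" using True d by (intro mult_right_mono) auto
      finally show ?thesis using True by simp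
    qed (simp add: f_eq)
  qed
  finally show "expectation (\<lambda>x. d / (d\<^sup>2 + x\<^sup>2)) \<le> (LINT u:{0<..}|lborel. exp (- Re \<zeta> * u powr a))"
    by (simp add: set_lebesgue_integral_def)
qed

text \<open>The Poisson kernel is \<open>1 / d\<close> at the origin, while its expectation stays bounded as \<open>d\<close> tends to \<open>0\<close>.\<close>

lemma AE_nonzero:
  assumes Re_pos: "0 < Re \<zeta>"
  shows "AE x in N. x \<noteq> 0"
proof -
  define B where "B = (LINT u:{0<..}|lborel. exp (- Re \<zeta> * u powr a))"
  have "prob {0} \<le> d * B" if d: "d > 0" for d
  proof -
    have "prob {0} / d = expectation (\<lambda>x. indicator {0} x / d)" by simp
    also have "\<dots> \<le> expectation (\<lambda>x. d / (d\<^sup>2 + x\<^sup>2))"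
    proof (rule integral_mono)
      have "integrable N (indicator {0} :: real \<Rightarrow> real)" by (simp add: emeasure_eq_measure)
      then show "integrable N (\<lambda>x. indicator {0} x / d)" by (rule integrable_divide)
      show "integrable N (\<lambda>x. d / (d\<^sup>2 + x\<^sup>2))" by (rule poisson_kernel_bound(2)[OF Re_pos d])
      show "indicator {0} x / d \<le> d / (d\<^sup>2 + x\<^sup>2)" for x
        using d by (auto simp: indicator_def power2_eq_square)
    qed
    also have "\<dots> \<le> B" unfolding B_def by (rule poisson_kernel_bound(1)[OF Re_pos d])
    finally show ?thesis using d by (simp add: field_simps)
  qed
  then have "\<forall>\<^sub>F d in at_right 0. prob {0} \<le> d * B"
    using eventually_at_right_less[of 0] by (auto elim: eventually_mono)
  moreover have "((\<lambda>d. d * B) \<longlongrightarrow> 0 * B) (at_right 0)" by (intro tendsto_intros)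
  ultimately have "prob {0} \<le> 0 * B"
    by (intro tendsto_lowerbound[of "\<lambda>d. d * B"]) auto
  then have "prob {0} = 0" using measure_nonneg[of N "{0}"] by simp
  then show ?thesis
    by (intro AE_I[of _ _ "{0}"]) (auto simp: emeasure_eq_measure)
qed

text \<open>The expectation of the Poisson kernel is bounded for small \<open>d\<close> and at most \<open>1 / d\<close> for large
\<open>d\<close>; against \<open>d\<^bsup>-p\<^esup>\<close> this is integrable exactly because \<open>0 < p < 1\<close>.\<close>

lemma integrable_abs_powr_minus:
  assumes Re_pos: "0 < Re \<zeta>" and p: "0 < p" "p < 1"
  shows "integrable N (\<lambda>x. \<bar>x\<bar> powr (- p))"
proof -
  interpret P: pair_sigma_finite N lborel ..
  define K where "K = ennreal (5 * 2 powr p)"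
  define B where "B = max 1 (LINT u:{0<..}|lborel. exp (- Re \<zeta> * u powr a))"
  have inner: "(\<integral>\<^sup>+x. ennreal (indicator {0<..} d * (d powr (- p) * (d / (d\<^sup>2 + x\<^sup>2)))) \<partial>N)
      \<le> ennreal (indicator {0<..} d *\<^sub>R (B * (min 1 (d powr 1) * d powr (- p - 1))))" for d :: real
  proof (cases "d > 0")
    case True
    note k = poisson_kernel_bound[OF Re_pos True]
    have "expectation (\<lambda>x. d / (d\<^sup>2 + x\<^sup>2)) \<le> expectation (\<lambda>x. 1 / d)"
    proof (rule integral_mono)
      fix x
      have "d / (d\<^sup>2 + x\<^sup>2) \<le> d / d\<^sup>2"
        using True by (intro divide_left_mono mult_pos_pos add_pos_nonneg) auto
      then show "d / (d\<^sup>2 + x\<^sup>2) \<le> 1 / d" using True by (simp add: power2_eq_square)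
    qed (use k in auto)
    then have "expectation (\<lambda>x. d / (d\<^sup>2 + x\<^sup>2)) \<le> min B (1 / d)"
      using k(1) by (simp add: B_def)
    also have "\<dots> \<le> B * (min 1 d / d)"
    proof (cases "d \<le> 1")
      case False
      then have "1 / d \<le> B / d" by (intro divide_right_mono) (auto simp: B_def)
      then show ?thesis using False by simp
    qed (use True in simp)
    finally have le: "d powr (- p) * expectation (\<lambda>x. d / (d\<^sup>2 + x\<^sup>2)) \<le> d powr (- p) * (B * (min 1 d / d))"
      by (rule mult_left_mono) simp
    have "(\<integral>\<^sup>+x. ennreal (indicator {0<..} d * (d powr (- p) * (d / (d\<^sup>2 + x\<^sup>2)))) \<partial>N)
        = (\<integral>\<^sup>+x. ennreal (d powr (- p) * (d / (d\<^sup>2 + x\<^sup>2))) \<partial>N)" using True by simp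
    also have "\<dots> = ennreal (expectation (\<lambda>x. d powr (- p) * (d / (d\<^sup>2 + x\<^sup>2))))"
      using True by (intro nn_integral_eq_integral integrable_mult_right k(2)) auto
    also have "expectation (\<lambda>x. d powr (- p) * (d / (d\<^sup>2 + x\<^sup>2)))
        = d powr (- p) * expectation (\<lambda>x. d / (d\<^sup>2 + x\<^sup>2))" by (rule integral_mult_right_zero)
    also have "ennreal \<dots> \<le> ennreal (d powr (- p) * (B * (min 1 d / d)))"
      by (rule ennreal_leI[OF le])
    also have "d powr (- p) * (B * (min 1 d / d)) = B * (min 1 (d powr 1) * d powr (- p - 1))"
      using True by (simp add: powr_diff field_simps)
    finally show ?thesis using True by simp
  qed simp
  have fin: "(\<integral>\<^sup>+d. ennreal (indicator {0<..} d *\<^sub>R (B * (min 1 (d powr 1) * d powr (- p - 1)))) \<partial>lborel) < \<infinity>"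
  proof -
    have "set_integrable lborel {0<..} (\<lambda>u. B * (min 1 (u powr 1) * u powr (- p - 1)))"
      by (intro set_integrable_mult_right set_integrable_min_powr p)
    then show ?thesis
      unfolding set_integrable_def
      by (subst nn_integral_eq_integral) (auto simp: B_def indicator_def)
  qed
  have "(\<integral>\<^sup>+x. ennreal (\<bar>x\<bar> powr (- p)) \<partial>N) \<le>
      (\<integral>\<^sup>+x. K * (\<integral>\<^sup>+d. ennreal (indicator {0<..} d * (d powr (- p) * (d / (d\<^sup>2 + x\<^sup>2)))) \<partial>lborel) \<partial>N)"
    unfolding K_def by (intro nn_integral_mono powr_minus_le_nn_integral p)
  also have "\<dots> = K * (\<integral>\<^sup>+x. (\<integral>\<^sup>+d. ennreal (indicator {0<..} d * (d powr (- p) * (d / (d\<^sup>2 + x\<^sup>2)))) \<partial>lborel) \<partial>N)"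
    by (rule nn_integral_cmult) measurable
  also have "(\<integral>\<^sup>+x. (\<integral>\<^sup>+d. ennreal (indicator {0<..} d * (d powr (- p) * (d / (d\<^sup>2 + x\<^sup>2)))) \<partial>lborel) \<partial>N)
     = (\<integral>\<^sup>+d. (\<integral>\<^sup>+x. ennreal (indicator {0<..} d * (d powr (- p) * (d / (d\<^sup>2 + x\<^sup>2)))) \<partial>N) \<partial>lborel)"
    by (rule P.Fubini'[symmetric]) measurable
  also have "K * \<dots> \<le> K * (\<integral>\<^sup>+d. ennreal (indicator {0<..} d *\<^sub>R (B * (min 1 (d powr 1) * d powr (- p - 1)))) \<partial>lborel)"
    by (intro mult_left_mono nn_integral_mono inner) simp
  also have "\<dots> < \<infinity>" using fin by (simp add: K_def ennreal_mult_less_top)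
  finally have "(\<integral>\<^sup>+x. ennreal (\<bar>x\<bar> powr (- p)) \<partial>N) < \<infinity>" .
  then show ?thesis
    by (intro integrableI_nonneg) auto
qed

end

section \<open>Stochastic boundedness and sums over moving windows\<close>

context prob_space
begin

text \<open>The event is required only to contain the complement of a small measurable set, so that no
measurability has to be proved for the statements \<open>P\<close>.\<close>

definition likely :: "real \<Rightarrow> ('a \<Rightarrow> bool) \<Rightarrow> bool" where
  "likely \<epsilon> P \<longleftrightarrow> (\<exists>A\<in>events. prob A \<le> \<epsilon> \<and> (\<forall>\<omega>\<in>space M - A. P \<omega>))"

lemma likely_mono:
  assumes "likely \<epsilon> P" "\<And>\<omega>. \<omega> \<in> space M \<Longrightarrow> P \<omega> \<Longrightarrow> Q \<omega>"
  shows "likely \<epsilon> Q"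
  using assms unfolding likely_def by (meson DiffD1)

lemma likely_conj:
  assumes "likely \<epsilon> P" "likely \<delta> Q"
  shows "likely (\<epsilon> + \<delta>) (\<lambda>\<omega>. P \<omega> \<and> Q \<omega>)"
proof -
  obtain A B where A: "A \<in> events" "prob A \<le> \<epsilon>" "\<forall>\<omega>\<in>space M - A. P \<omega>"
    and B: "B \<in> events" "prob B \<le> \<delta>" "\<forall>\<omega>\<in>space M - B. Q \<omega>"
    using assms unfolding likely_def by auto
  have "prob (A \<union> B) \<le> \<epsilon> + \<delta>"
    using measure_Un_le[OF A(1) B(1)] A(2) B(2) by linarith
  then show ?thesis
    unfolding likely_def using A B by (intro bexI[of _ "A \<union> B"]) auto
qed

lemma likely_AE_mono:
  assumes "likely \<epsilon> P" "AE \<omega> in M. P \<omega> \<longrightarrow> Q \<omega>"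
  shows "likely \<epsilon> Q"
proof -
  obtain S where S: "S \<in> null_sets M" "{\<omega> \<in> space M. \<not> (P \<omega> \<longrightarrow> Q \<omega>)} \<subseteq> S"
    using assms(2) by (auto elim!: AE_E simp: null_sets_def)
  then have "likely 0 (\<lambda>\<omega>. P \<omega> \<longrightarrow> Q \<omega>)"
    unfolding likely_def by (intro bexI[of _ S]) (auto simp: null_sets_def measure_def)
  from likely_conj[OF assms(1) this] have "likely \<epsilon> (\<lambda>\<omega>. P \<omega> \<and> (P \<omega> \<longrightarrow> Q \<omega>))" by simp
  then show ?thesis by (rule likely_mono) auto
qed

lemma likely_ball:
  assumes "finite I" "\<And>i. i \<in> I \<Longrightarrow> likely \<epsilon> (P i)"
  shows "likely (real (card I) * \<epsilon>) (\<lambda>\<omega>. \<forall>i\<in>I. P i \<omega>)"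
  using assms
proof (induction I rule: finite_induct)
  case empty
  then show ?case unfolding likely_def by (intro bexI[of _ "{}"]) auto
next
  case (insert i I)
  then have "likely (\<epsilon> + real (card I) * \<epsilon>) (\<lambda>\<omega>. P i \<omega> \<and> (\<forall>i\<in>I. P i \<omega>))"
    by (intro likely_conj) auto
  then show ?case using insert(1,2) by (simp add: algebra_simps)
qed

text \<open>The outer version of boundedness in probability, for the same reason.\<close>

definition stoch_bounded :: "(nat \<Rightarrow> 'a \<Rightarrow> real) \<Rightarrow> bool" where
  "stoch_bounded Z \<longleftrightarrow> (\<forall>\<epsilon>>0. \<exists>K>0. \<forall>\<^sub>F n in sequentially. likely \<epsilon> (\<lambda>\<omega>. \<bar>Z n \<omega>\<bar> \<le> K))"

lemma stoch_boundedE: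
  assumes "stoch_bounded Z" "0 < \<epsilon>"
  obtains K where "0 < K" "\<forall>\<^sub>F n in sequentially. likely \<epsilon> (\<lambda>\<omega>. \<bar>Z n \<omega>\<bar> \<le> K)"
  using assms unfolding stoch_bounded_def by blast

lemma stoch_bounded_L1:
  assumes "\<forall>\<^sub>F n in sequentially. integrable M (Z n) \<and> expectation (\<lambda>\<omega>. \<bar>Z n \<omega>\<bar>) \<le> C"
  shows "stoch_bounded Z"
  unfolding stoch_bounded_def
proof (intro allI impI)
  fix \<epsilon> :: real assume \<epsilon>: "\<epsilon> > 0"
  define K where "K = max C 1 / \<epsilon>"
  have K: "K > 0" using \<epsilon> by (simp add: K_def)
  have "\<forall>\<^sub>F n in sequentially. likely \<epsilon> (\<lambda>\<omega>. \<bar>Z n \<omega>\<bar> \<le> K)"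
    using assms
  proof eventually_elim
    case (elim n)
    then have i: "integrable M (\<lambda>\<omega>. \<bar>Z n \<omega>\<bar>)" by auto
    have m [measurable]: "Z n \<in> borel_measurable M" using elim by auto
    define A where "A = {\<omega> \<in> space M. \<bar>Z n \<omega>\<bar> \<ge> K}"
    have A: "A \<in> events" unfolding A_def by measurable
    have "prob A \<le> expectation (\<lambda>\<omega>. \<bar>Z n \<omega>\<bar>) / K"
      unfolding A_def by (rule integral_Markov_inequality_measure[OF i, where A = "space M"]) (use K in auto)
    also have "\<dots> \<le> max C 1 / K" using elim K by (intro divide_right_mono) auto
    also have "\<dots> = \<epsilon>" using \<epsilon> by (simp add: K_def)
    finally show ?case unfolding likely_def using A by (intro bexI[of _ A]) (auto simp: A_def)
  qed
  with K show "\<exists>K>0. \<forall>\<^sub>F n in sequentially. likely \<epsilon> (\<lambda>\<omega>. \<bar>Z n \<omega>\<bar> \<le> K)" by blast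
qed

lemma stoch_bounded_mono:
  assumes "stoch_bounded Z"
    and "\<forall>\<^sub>F n in sequentially. AE \<omega> in M. \<bar>W n \<omega>\<bar> \<le> c * \<bar>Z n \<omega>\<bar>"
  shows "stoch_bounded W"
  unfolding stoch_bounded_def
proof (intro allI impI)
  fix \<epsilon> :: real assume "\<epsilon> > 0"
  then obtain K where K: "0 < K" "\<forall>\<^sub>F n in sequentially. likely \<epsilon> (\<lambda>\<omega>. \<bar>Z n \<omega>\<bar> \<le> K)"
    using stoch_boundedE[OF assms(1)] by blast
  have "\<forall>\<^sub>F n in sequentially. likely \<epsilon> (\<lambda>\<omega>. \<bar>W n \<omega>\<bar> \<le> (\<bar>c\<bar> + 1) * K)"
    using K(2) assms(2)
  proof eventually_elim
    case (elim n)
    from elim(2) have "AE \<omega> in M. \<bar>Z n \<omega>\<bar> \<le> K \<longrightarrow> \<bar>W n \<omega>\<bar> \<le> (\<bar>c\<bar> + 1) * K"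
    proof eventually_elim
      case (elim \<omega>)
      show ?case
      proof
        assume "\<bar>Z n \<omega>\<bar> \<le> K"
        then have "(\<bar>c\<bar> + 1) * \<bar>Z n \<omega>\<bar> \<le> (\<bar>c\<bar> + 1) * K" by (intro mult_left_mono) auto
        moreover have "c * \<bar>Z n \<omega>\<bar> \<le> (\<bar>c\<bar> + 1) * \<bar>Z n \<omega>\<bar>" by (intro mult_right_mono) auto
        ultimately show "\<bar>W n \<omega>\<bar> \<le> (\<bar>c\<bar> + 1) * K" using elim by linarith
      qed
    qed
    with elim(1) show ?case by (rule likely_AE_mono)
  qed
  moreover have "(\<bar>c\<bar> + 1) * K > 0" using K by (intro mult_pos_pos) auto
  ultimately show "\<exists>K>0. \<forall>\<^sub>F n in sequentially. likely \<epsilon> (\<lambda>\<omega>. \<bar>W n \<omega>\<bar> \<le> K)" by blast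
qed

lemma stoch_bounded_cong:
  assumes "stoch_bounded Z" "\<And>n \<omega>. \<omega> \<in> space M \<Longrightarrow> W n \<omega> = Z n \<omega>"
  shows "stoch_bounded W"
proof (rule stoch_bounded_mono[OF assms(1), where c = 1], rule always_eventually, rule allI, rule AE_I2)
  fix n \<omega> assume "\<omega> \<in> space M"
  then show "\<bar>W n \<omega>\<bar> \<le> 1 * \<bar>Z n \<omega>\<bar>" using assms(2) by simp
qed

lemma stoch_bounded_add_mult:
  assumes "stoch_bounded Z" "stoch_bounded W"
  shows stoch_bounded_add: "stoch_bounded (\<lambda>n \<omega>. Z n \<omega> + W n \<omega>)"
    and stoch_bounded_mult: "stoch_bounded (\<lambda>n \<omega>. Z n \<omega> * W n \<omega>)"
proof -
  have "\<exists>K>0. \<exists>L>0. \<forall>\<^sub>F n in sequentially. likely \<epsilon> (\<lambda>\<omega>. \<bar>Z n \<omega>\<bar> \<le> K \<and> \<bar>W n \<omega>\<bar> \<le> L)"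
    if \<epsilon>: "\<epsilon> > 0" for \<epsilon>
  proof -
    have \<epsilon>2: "\<epsilon> / 2 > 0" using \<epsilon> by simp
    obtain K where K: "0 < K" "\<forall>\<^sub>F n in sequentially. likely (\<epsilon> / 2) (\<lambda>\<omega>. \<bar>Z n \<omega>\<bar> \<le> K)"
      using assms(1) \<epsilon>2 by (rule stoch_boundedE)
    obtain L where L: "0 < L" "\<forall>\<^sub>F n in sequentially. likely (\<epsilon> / 2) (\<lambda>\<omega>. \<bar>W n \<omega>\<bar> \<le> L)"
      using assms(2) \<epsilon>2 by (rule stoch_boundedE)
    have "\<forall>\<^sub>F n in sequentially. likely \<epsilon> (\<lambda>\<omega>. \<bar>Z n \<omega>\<bar> \<le> K \<and> \<bar>W n \<omega>\<bar> \<le> L)"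
      using K(2) L(2)
    proof eventually_elim
      case (elim n)
      from likely_conj[OF elim] show ?case by simp
    qed
    with K L show ?thesis by blast
  qed
  note * = this
  show "stoch_bounded (\<lambda>n \<omega>. Z n \<omega> + W n \<omega>)"
    unfolding stoch_bounded_def
  proof (intro allI impI)
    fix \<epsilon> :: real assume "\<epsilon> > 0"
    from *[OF this] obtain K L where KL: "K > 0" "L > 0"
        "\<forall>\<^sub>F n in sequentially. likely \<epsilon> (\<lambda>\<omega>. \<bar>Z n \<omega>\<bar> \<le> K \<and> \<bar>W n \<omega>\<bar> \<le> L)" by blast
    from KL(3) have "\<forall>\<^sub>F n in sequentially. likely \<epsilon> (\<lambda>\<omega>. \<bar>Z n \<omega> + W n \<omega>\<bar> \<le> K + L)"
      by eventually_elim (erule likely_mono, auto)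
    with KL show "\<exists>K>0. \<forall>\<^sub>F n in sequentially. likely \<epsilon> (\<lambda>\<omega>. \<bar>Z n \<omega> + W n \<omega>\<bar> \<le> K)"
      by (intro exI[of _ "K + L"]) auto
  qed
  show "stoch_bounded (\<lambda>n \<omega>. Z n \<omega> * W n \<omega>)"
    unfolding stoch_bounded_def
  proof (intro allI impI)
    fix \<epsilon> :: real assume "\<epsilon> > 0"
    from *[OF this] obtain K L where KL: "K > 0" "L > 0"
        "\<forall>\<^sub>F n in sequentially. likely \<epsilon> (\<lambda>\<omega>. \<bar>Z n \<omega>\<bar> \<le> K \<and> \<bar>W n \<omega>\<bar> \<le> L)" by blast
    from KL(3) have "\<forall>\<^sub>F n in sequentially. likely \<epsilon> (\<lambda>\<omega>. \<bar>Z n \<omega> * W n \<omega>\<bar> \<le> K * L)"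
      by eventually_elim (erule likely_mono, auto simp: abs_mult intro!: mult_mono)
    with KL show "\<exists>K>0. \<forall>\<^sub>F n in sequentially. likely \<epsilon> (\<lambda>\<omega>. \<bar>Z n \<omega> * W n \<omega>\<bar> \<le> K)"
      by (intro exI[of _ "K * L"]) auto
  qed
qed

lemma stoch_bounded_sum:
  assumes "finite I" "\<And>i. i \<in> I \<Longrightarrow> stoch_bounded (Z i)"
  shows "stoch_bounded (\<lambda>n \<omega>. \<Sum>i\<in>I. Z i n \<omega>)"
  using assms
proof (induction I rule: finite_induct)
  case empty
  have "stoch_bounded (\<lambda>n \<omega>. 0)"
    by (rule stoch_bounded_L1[where C = 0]) simp
  then show ?case by simp
qed (auto intro!: stoch_bounded_add)

lemma stoch_bounded_abs:
  assumes "stoch_bounded Z" shows "stoch_bounded (\<lambda>n \<omega>. \<bar>Z n \<omega>\<bar>)"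
  using assms by (simp add: stoch_bounded_def)

lemma stoch_bounded_L2:
  assumes "\<And>n. Z n \<in> borel_measurable M"
    and "\<forall>\<^sub>F n in sequentially. integrable M (\<lambda>\<omega>. (Z n \<omega>)\<^sup>2) \<and> expectation (\<lambda>\<omega>. (Z n \<omega>)\<^sup>2) \<le> C"
  shows "stoch_bounded Z"
proof (rule stoch_bounded_L1[where C = "1 + C"])
  show "\<forall>\<^sub>F n in sequentially. integrable M (Z n) \<and> expectation (\<lambda>\<omega>. \<bar>Z n \<omega>\<bar>) \<le> 1 + C"
    using assms(2)
  proof eventually_elim
    case (elim n)
    have i: "integrable M (Z n)" using square_integrable_imp_integrable[OF assms(1)] elim by auto
    have "expectation (\<lambda>\<omega>. \<bar>Z n \<omega>\<bar>) \<le> expectation (\<lambda>\<omega>. 1 + (Z n \<omega>)\<^sup>2)"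
    proof (rule integral_mono)
      show "\<bar>Z n \<omega>\<bar> \<le> 1 + (Z n \<omega>)\<^sup>2" for \<omega>
      proof -
        have "2 * (\<bar>Z n \<omega>\<bar> * 1) \<le> \<bar>Z n \<omega>\<bar>\<^sup>2 + 1\<^sup>2" using sum_squares_bound[of "\<bar>Z n \<omega>\<bar>" 1] by simp
        then show ?thesis by simp
      qed
    qed (use i elim in auto)
    also have "\<dots> \<le> 1 + C" using elim by (simp add: prob_space)
    finally show ?case using i by simp
  qed
qed

text \<open>How a sum of order \<open>sqrt n\<close> is absorbed by a term of order \<open>n\<close>.\<close>

lemma stoch_bounded_imp_likely_small:
  assumes "stoch_bounded Z" "0 < \<epsilon>" "0 < \<delta>" "filterlim g at_top sequentially"
  shows "\<forall>\<^sub>F n in sequentially. likely \<epsilon> (\<lambda>\<omega>. \<bar>Z n \<omega>\<bar> \<le> \<delta> * g n)"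
proof -
  obtain K where K: "0 < K" "\<forall>\<^sub>F n in sequentially. likely \<epsilon> (\<lambda>\<omega>. \<bar>Z n \<omega>\<bar> \<le> K)"
    using assms(1,2) by (rule stoch_boundedE)
  have "\<forall>\<^sub>F n in sequentially. K / \<delta> \<le> g n"
    using assms(4) by (simp add: filterlim_at_top)
  with K(2) show ?thesis
  proof eventually_elim
    case (elim n)
    then have "K \<le> \<delta> * g n" using assms(3) by (simp add: field_simps)
    with elim(1) show ?case by (elim likely_mono) auto
  qed
qed

end

locale iid_noise = prob_space M for M :: "'a measure" +
  fixes eps :: "nat \<Rightarrow> 'a \<Rightarrow> real"
  assumes indep: "indep_vars (\<lambda>_. borel) eps {1..}"
begin

text \<open>Index \<open>0\<close> is excluded since nothing is known about \<open>eps 0\<close>, not even measurability; with truncated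
subtraction \<open>j - 2\<close> this matters for \<open>j = 2\<close>.\<close>

definition window :: "nat \<Rightarrow> nat set" where
  "window j = {j - 2..j} \<inter> {1..}"

definition window_fn :: "nat \<Rightarrow> ('a \<Rightarrow> real) \<Rightarrow> bool" where
  "window_fn j U \<longleftrightarrow> (\<exists>g\<in>borel_measurable (PiM (window j) (\<lambda>_. borel)).
     \<forall>\<omega>\<in>space M. U \<omega> = g (restrict (\<lambda>i. eps i \<omega>) (window j)))"

lemma window_fn_eps:
  assumes "i \<in> window j"
  shows "window_fn j (eps i)"
  unfolding window_fn_def using assms
  by (intro bexI[of _ "\<lambda>x. x i"] measurable_component_singleton) auto

lemma window_fn_compose:
  assumes "window_fn j U" "f \<in> borel_measurable borel"
  shows "window_fn j (\<lambda>\<omega>. f (U \<omega>))"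
proof -
  obtain g where g: "g \<in> borel_measurable (PiM (window j) (\<lambda>_. borel))"
      "\<forall>\<omega>\<in>space M. U \<omega> = g (restrict (\<lambda>i. eps i \<omega>) (window j))"
    using assms(1) by (auto simp: window_fn_def)
  show ?thesis unfolding window_fn_def
    by (rule bexI[of _ "\<lambda>x. f (g x)"]) (use g assms(2) in auto)
qed

lemma window_fn_add:
  assumes "window_fn j U" "window_fn j V"
  shows "window_fn j (\<lambda>\<omega>. U \<omega> + V \<omega>)"
proof -
  obtain g h where g: "g \<in> borel_measurable (PiM (window j) (\<lambda>_. borel))"
      "\<forall>\<omega>\<in>space M. U \<omega> = g (restrict (\<lambda>i. eps i \<omega>) (window j))"
    and h: "h \<in> borel_measurable (PiM (window j) (\<lambda>_. borel))"
      "\<forall>\<omega>\<in>space M. V \<omega> = h (restrict (\<lambda>i. eps i \<omega>) (window j))"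
    using assms by (auto simp: window_fn_def)
  show ?thesis unfolding window_fn_def
    by (rule bexI[of _ "\<lambda>x. g x + h x"]) (use g h in auto)
qed

lemma eps_measurable: "1 \<le> i \<Longrightarrow> eps i \<in> borel_measurable M"
  using indep by (auto simp: indep_vars_def)

lemma window_fn_measurable:
  assumes "window_fn j U"
  shows "U \<in> borel_measurable M"
proof -
  obtain g where g: "g \<in> borel_measurable (PiM (window j) (\<lambda>_. borel))"
      "\<forall>\<omega>\<in>space M. U \<omega> = g (restrict (\<lambda>i. eps i \<omega>) (window j))"
    using assms by (auto simp: window_fn_def)
  have "(\<lambda>\<omega>. restrict (\<lambda>i. eps i \<omega>) (window j)) \<in> measurable M (PiM (window j) (\<lambda>_. borel))"
    by (intro measurable_restrict eps_measurable) (auto simp: window_def)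
  from measurable_compose[OF this g(1)] show ?thesis
    by (rule measurable_cong[THEN iffD1, rotated]) (use g(2) in auto)
qed

text \<open>Windows more than two apart are disjoint, so functions of them are independent.\<close>

lemma window_fn_uncorrelated:
  assumes "i + 2 < j" "window_fn i U" "window_fn j V" "integrable M U" "integrable M V"
  shows "expectation (\<lambda>\<omega>. U \<omega> * V \<omega>) = expectation U * expectation V"
proof -
  obtain g h where g: "g \<in> borel_measurable (PiM (window i) (\<lambda>_. borel))"
      "\<forall>\<omega>\<in>space M. U \<omega> = g (restrict (\<lambda>i. eps i \<omega>) (window i))"
    and h: "h \<in> borel_measurable (PiM (window j) (\<lambda>_. borel))"
      "\<forall>\<omega>\<in>space M. V \<omega> = h (restrict (\<lambda>i. eps i \<omega>) (window j))"
    using assms(2,3) unfolding window_fn_def by blast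
  define F where "F k = (if k = i then g else h)" for k
  define W where "W k \<omega> = F k (restrict (\<lambda>i. eps i \<omega>) (window k))" for k \<omega>
  have "disjoint_family_on window {i, j}"
    using assms(1) by (auto simp: disjoint_family_on_def window_def)
  then have "indep_vars (\<lambda>k. PiM (window k) (\<lambda>_. borel)) (\<lambda>k \<omega>. restrict (\<lambda>i. eps i \<omega>) (window k)) {i, j}"
    by (rule indep_vars_restrict[OF indep, rotated]) (auto simp: window_def)
  then have "indep_vars (\<lambda>k. borel) W {i, j}"
    unfolding W_def by (rule indep_vars_compose2) (use g h in \<open>auto simp: F_def\<close>)
  moreover have WU: "W i \<omega> = U \<omega>" "W j \<omega> = V \<omega>" if "\<omega> \<in> space M" for \<omega>
    using assms(1) g(2) h(2) that by (auto simp: W_def F_def)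
  have "integrable M (W i)" "integrable M (W j)"
    using assms(4,5) WU by (auto cong: Bochner_Integration.integrable_cong)
  ultimately have "expectation (\<lambda>\<omega>. \<Prod>k\<in>{i, j}. W k \<omega>) = (\<Prod>k\<in>{i, j}. expectation (W k))"
    by (intro indep_vars_lebesgue_integral) auto
  moreover have "expectation (W i) = expectation U" "expectation (W j) = expectation V"
    using WU by (auto intro!: Bochner_Integration.integral_cong)
  moreover have "expectation (\<lambda>\<omega>. \<Prod>k\<in>{i, j}. W k \<omega>) = expectation (\<lambda>\<omega>. U \<omega> * V \<omega>)"
    using assms(1) WU by (auto intro!: Bochner_Integration.integral_cong)
  ultimately show ?thesis using assms(1) by simp
qed

text \<open>Expand the square: at most five indices, itself included, are correlated with a given one, and
\<open>2 a b \<le> a\<^sup>2 + b\<^sup>2\<close> bounds each of these terms by \<open>V\<close>.\<close>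

lemma window_sum_second_moment:
  assumes J: "finite J"
    and W: "\<And>j. j \<in> J \<Longrightarrow> window_fn j (U j)"
    and I: "\<And>j. j \<in> J \<Longrightarrow> integrable M (\<lambda>\<omega>. (U j \<omega>)\<^sup>2)"
    and C: "\<And>j. j \<in> J \<Longrightarrow> expectation (U j) = 0"
    and V: "\<And>j. j \<in> J \<Longrightarrow> expectation (\<lambda>\<omega>. (U j \<omega>)\<^sup>2) \<le> V"
  shows "integrable M (\<lambda>\<omega>. (\<Sum>j\<in>J. U j \<omega>)\<^sup>2)"
    and "expectation (\<lambda>\<omega>. (\<Sum>j\<in>J. U j \<omega>)\<^sup>2) \<le> 5 * V * real (card J)"
proof -
  have m: "U j \<in> borel_measurable M" if "j \<in> J" for j using W[OF that] by (rule window_fn_measurable)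
  have iU: "integrable M (U j)" if "j \<in> J" for j
    using square_integrable_imp_integrable[OF m I] that by auto
  have iUU: "integrable M (\<lambda>\<omega>. U i \<omega> * U j \<omega>)" if "i \<in> J" "j \<in> J" for i j
  proof (rule Bochner_Integration.integrable_bound)
    show "integrable M (\<lambda>\<omega>. (U i \<omega>)\<^sup>2 + (U j \<omega>)\<^sup>2)" using I that by auto
    show "AE \<omega> in M. norm (U i \<omega> * U j \<omega>) \<le> norm ((U i \<omega>)\<^sup>2 + (U j \<omega>)\<^sup>2)"
    proof (rule AE_I2)
      fix \<omega>
      have "2 * \<bar>U i \<omega> * U j \<omega>\<bar> \<le> (U i \<omega>)\<^sup>2 + (U j \<omega>)\<^sup>2"
        using sum_squares_bound[of "\<bar>U i \<omega>\<bar>" "\<bar>U j \<omega>\<bar>"] by (simp add: abs_mult)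
      then show "norm (U i \<omega> * U j \<omega>) \<le> norm ((U i \<omega>)\<^sup>2 + (U j \<omega>)\<^sup>2)" by simp
    qed
  qed (use m that in auto)
  have eq: "(\<Sum>j\<in>J. U j \<omega>)\<^sup>2 = (\<Sum>i\<in>J. \<Sum>j\<in>J. U i \<omega> * U j \<omega>)" for \<omega>
    by (simp add: power2_eq_square sum_product)
  show "integrable M (\<lambda>\<omega>. (\<Sum>j\<in>J. U j \<omega>)\<^sup>2)"
    unfolding eq by (intro Bochner_Integration.integrable_sum iUU)
  have cross: "expectation (\<lambda>\<omega>. U i \<omega> * U j \<omega>) \<le> (if j \<in> {i - 2..i + 2} then V else 0)"
    if "i \<in> J" "j \<in> J" for i j
  proof (cases "j \<in> {i - 2..i + 2}")
    case True
    have "expectation (\<lambda>\<omega>. U i \<omega> * U j \<omega>) \<le> expectation (\<lambda>\<omega>. ((U i \<omega>)\<^sup>2 + (U j \<omega>)\<^sup>2) / 2)"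
    proof (rule integral_mono)
      show "U i \<omega> * U j \<omega> \<le> ((U i \<omega>)\<^sup>2 + (U j \<omega>)\<^sup>2) / 2" for \<omega>
        using sum_squares_bound[of "U i \<omega>" "U j \<omega>"] by simp
    qed (use iUU I that in auto)
    also have "\<dots> = (expectation (\<lambda>\<omega>. (U i \<omega>)\<^sup>2) + expectation (\<lambda>\<omega>. (U j \<omega>)\<^sup>2)) / 2"
      using I that by simp
    also have "\<dots> \<le> V" using V[of i] V[of j] that by simp
    finally show ?thesis using True by simp
  next
    case False
    then consider "i + 2 < j" | "j + 2 < i" by force
    then have "expectation (\<lambda>\<omega>. U i \<omega> * U j \<omega>) = 0"
    proof cases
      case 1 then show ?thesis using window_fn_uncorrelated[OF 1 W W iU iU] C that by simp
    next
      case 2 then show ?thesis using window_fn_uncorrelated[OF 2 W W iU iU] C that by (simp add: mult.commute)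
    qed
    with False show ?thesis by (simp only: if_False)
  qed
  have "expectation (\<lambda>\<omega>. (\<Sum>j\<in>J. U j \<omega>)\<^sup>2) = (\<Sum>i\<in>J. \<Sum>j\<in>J. expectation (\<lambda>\<omega>. U i \<omega> * U j \<omega>))"
    unfolding eq using iUU by (simp add: Bochner_Integration.integral_sum Bochner_Integration.integrable_sum)
  also have "\<dots> \<le> (\<Sum>i\<in>J. \<Sum>j\<in>J. if j \<in> {i - 2..i + 2} then V else 0)"
    by (intro sum_mono cross)
  also have "\<dots> = (\<Sum>i\<in>J. real (card (J \<inter> {i - 2..i + 2})) * V)"
  proof (rule sum.cong[OF refl])
    fix i :: nat
    have "{j. j \<in> {i - 2..i + 2}} = {i - 2..i + 2}" by blast
    then show "(\<Sum>j\<in>J. if j \<in> {i - 2..i + 2} then V else 0) = real (card (J \<inter> {i - 2..i + 2})) * V"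
      by (simp only: sum.If_cases[OF J] sum_constant sum.neutral_const add_0_right)
  qed
  also have "\<dots> \<le> (\<Sum>i\<in>J. 5 * V)"
  proof (rule sum_mono)
    fix i assume i: "i \<in> J"
    have "0 \<le> expectation (\<lambda>\<omega>. (U i \<omega>)\<^sup>2)" by (intro Bochner_Integration.integral_nonneg) auto
    then have V0: "0 \<le> V" using V[OF i] by linarith
    have "card (J \<inter> {i - 2..i + 2}) \<le> card {i - 2..i + 2}" by (intro card_mono) auto
    also have "\<dots> \<le> 5" by simp
    finally show "real (card (J \<inter> {i - 2..i + 2})) * V \<le> 5 * V"
      using V0 by (intro mult_right_mono) auto
  qed
  finally show "expectation (\<lambda>\<omega>. (\<Sum>j\<in>J. U j \<omega>)\<^sup>2) \<le> 5 * V * real (card J)"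
    by (simp add: mult_ac)
qed

end

text \<open>The two contrasts of the noise are the instances: identically distributed functions of moving
windows.\<close>

locale stationary_noise = iid_noise +
  fixes Z :: "nat \<Rightarrow> 'a \<Rightarrow> real" and start :: nat and N :: "real measure"
  assumes window_Z: "start \<le> j \<Longrightarrow> window_fn j (Z j)"
    and distr_Z: "start \<le> j \<Longrightarrow> distr M borel (Z j) = N"
begin

lemma Z_measurable: "start \<le> j \<Longrightarrow> Z j \<in> borel_measurable M"
  using window_Z window_fn_measurable by blast

lemma prob_space_N: "prob_space N"
  using prob_space_distr[OF Z_measurable[of start]] distr_Z[of start] by simp

lemma sets_N [measurable_cong, simp]: "sets N = sets borel"
  using distr_Z[of start] by auto

lemma integrable_Z_iff:
  fixes f :: "real \<Rightarrow> real"
  assumes "start \<le> j" "f \<in> borel_measurable borel"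
  shows "integrable M (\<lambda>\<omega>. f (Z j \<omega>)) \<longleftrightarrow> integrable N f"
  using integrable_distr_eq[OF Z_measurable[OF assms(1)] assms(2)] distr_Z[OF assms(1)] by simp

lemma expectation_Z:
  fixes f :: "real \<Rightarrow> real"
  assumes "start \<le> j" "f \<in> borel_measurable borel"
  shows "expectation (\<lambda>\<omega>. f (Z j \<omega>)) = integral\<^sup>L N f"
  using integral_distr[OF Z_measurable[OF assms(1)] assms(2)] distr_Z[OF assms(1)] by simp

text \<open>The functions may vary with \<open>j\<close>, as the contrasts of the loss do through the design.\<close>

lemma centered_sum_stoch_bounded:
  fixes f :: "nat \<Rightarrow> real \<Rightarrow> real"
  assumes f: "\<And>j. start \<le> j \<Longrightarrow> f j \<in> borel_measurable borel"
    and f2: "\<And>j. start \<le> j \<Longrightarrow> integrable N (\<lambda>x. (f j x)\<^sup>2)"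
    and V: "\<And>j. start \<le> j \<Longrightarrow> (\<integral>x. (f j x)\<^sup>2 \<partial>N) \<le> V"
  shows "stoch_bounded (\<lambda>n \<omega>. (\<Sum>j=start..n. f j (Z j \<omega>) - integral\<^sup>L N (f j)) / sqrt (real n))"
proof (rule stoch_bounded_L2)
  interpret N: prob_space N by (rule prob_space_N)
  define m where "m j = integral\<^sup>L N (f j)" for j
  have if1: "integrable N (f j)" if "start \<le> j" for j
    using N.square_integrable_imp_integrable[OF _ f2[OF that]] f[OF that] by simp
  have if2: "integrable N (\<lambda>x. (f j x - m j)\<^sup>2)" if "start \<le> j" for j
    unfolding power2_diff using if1[OF that] f2[OF that] by simp
  define U where "U j \<omega> = f j (Z j \<omega>) - m j" for j \<omega>
  have meas: "(\<lambda>x. f j x - m j) \<in> borel_measurable borel" "(\<lambda>x. (f j x - m j)\<^sup>2) \<in> borel_measurable borel"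
    if "start \<le> j" for j
    using f[OF that] by auto
  have W: "window_fn j (U j)" if "start \<le> j" for j
    unfolding U_def by (rule window_fn_compose[OF window_Z[OF that] meas(1)[OF that]])
  have I: "integrable M (\<lambda>\<omega>. (U j \<omega>)\<^sup>2)" if "start \<le> j" for j
    unfolding U_def using integrable_Z_iff[OF that meas(2)[OF that]] if2[OF that] by simp
  have E: "expectation (U j) = 0" if "start \<le> j" for j
    unfolding U_def using if1[OF that] expectation_Z[OF that meas(1)[OF that]]
    by (simp add: m_def N.prob_space)
  have E2: "expectation (\<lambda>\<omega>. (U j \<omega>)\<^sup>2) \<le> V" if "start \<le> j" for j
  proof -
    have "expectation (\<lambda>\<omega>. (U j \<omega>)\<^sup>2) = (\<integral>x. (f j x - m j)\<^sup>2 \<partial>N)"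
      unfolding U_def by (rule expectation_Z[OF that meas(2)[OF that]])
    also have "\<dots> = (\<integral>x. (f j x)\<^sup>2 \<partial>N) - (m j)\<^sup>2"
      unfolding m_def using N.variance_eq[OF if1[OF that] f2[OF that]] by simp
    also have "\<dots> \<le> V" using V[OF that] by (smt (verit) zero_le_power2)
    finally show ?thesis .
  qed
  have V0: "V \<ge> 0"
  proof -
    have "0 \<le> (\<integral>x. (f start x)\<^sup>2 \<partial>N)" by (intro Bochner_Integration.integral_nonneg) auto
    then show ?thesis using V[of start] by linarith
  qed
  show "(\<lambda>\<omega>. (\<Sum>j=start..n. f j (Z j \<omega>) - integral\<^sup>L N (f j)) / sqrt (real n)) \<in> borel_measurable M" for n
    using W window_fn_measurable unfolding U_def m_def
    by (intro borel_measurable_divide borel_measurable_sum) auto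
  show "\<forall>\<^sub>F n in sequentially. integrable M (\<lambda>\<omega>. ((\<Sum>j=start..n. f j (Z j \<omega>) - integral\<^sup>L N (f j)) / sqrt (real n))\<^sup>2) \<and>
     expectation (\<lambda>\<omega>. ((\<Sum>j=start..n. f j (Z j \<omega>) - integral\<^sup>L N (f j)) / sqrt (real n))\<^sup>2) \<le> 10 * V"
    using eventually_ge_at_top[of "1::nat"]
  proof eventually_elim
    case (elim n)
    have eq: "((\<Sum>j=start..n. f j (Z j \<omega>) - integral\<^sup>L N (f j)) / sqrt (real n))\<^sup>2
      = (\<Sum>j\<in>{start..n}. U j \<omega>)\<^sup>2 / real n" for \<omega>
      using elim by (simp add: U_def m_def power_divide)
    have *: "integrable M (\<lambda>\<omega>. (\<Sum>j\<in>{start..n}. U j \<omega>)\<^sup>2)"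
      "expectation (\<lambda>\<omega>. (\<Sum>j\<in>{start..n}. U j \<omega>)\<^sup>2) \<le> 5 * V * real (card {start..n})"
      using window_sum_second_moment[of "{start..n}" U V] W I E E2 by auto
    have "real (card {start..n}) \<le> 2 * real n" using elim by simp
    then have "5 * V * real (card {start..n}) \<le> 5 * V * (2 * real n)"
      using V0 by (intro mult_left_mono) auto
    with * elim show ?case unfolding eq by (auto simp: field_simps)
  qed
qed

lemma weighted_sum_stoch_bounded:
  fixes f :: "real \<Rightarrow> real"
  assumes f [measurable]: "f \<in> borel_measurable borel"
    and f2: "integrable N (\<lambda>x. (f x)\<^sup>2)"
    and c: "\<And>j. start \<le> j \<Longrightarrow> \<bar>c j\<bar> \<le> C"
  shows "stoch_bounded (\<lambda>n \<omega>. (\<Sum>j=start..n. c j * (f (Z j \<omega>) - integral\<^sup>L N f)) / sqrt (real n))"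
proof -
  have "stoch_bounded (\<lambda>n \<omega>. (\<Sum>j=start..n. c j * f (Z j \<omega>) - integral\<^sup>L N (\<lambda>x. c j * f x)) / sqrt (real n))"
  proof (rule centered_sum_stoch_bounded)
    fix j assume j: "start \<le> j"
    show "integrable N (\<lambda>x. (c j * f x)\<^sup>2)" using f2 by (simp add: power_mult_distrib)
    have "(\<integral>x. (c j * f x)\<^sup>2 \<partial>N) = (c j)\<^sup>2 * (\<integral>x. (f x)\<^sup>2 \<partial>N)" by (simp add: power_mult_distrib)
    also have "(c j)\<^sup>2 \<le> C\<^sup>2" using c[OF j] by (metis abs_ge_zero power2_abs power_mono)
    then have "(c j)\<^sup>2 * (\<integral>x. (f x)\<^sup>2 \<partial>N) \<le> C\<^sup>2 * (\<integral>x. (f x)\<^sup>2 \<partial>N)"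
      by (intro mult_right_mono Bochner_Integration.integral_nonneg) auto
    finally show "(\<integral>x. (c j * f x)\<^sup>2 \<partial>N) \<le> C\<^sup>2 * (\<integral>x. (f x)\<^sup>2 \<partial>N)" .
  qed measurable
  then show ?thesis by (simp add: right_diff_distrib)
qed

lemma average_stoch_bounded:
  fixes g :: "real \<Rightarrow> real"
  assumes "integrable N g" and [measurable]: "g \<in> borel_measurable borel"
  shows "stoch_bounded (\<lambda>n \<omega>. (\<Sum>j=start..n. g (Z j \<omega>)) / real n)"
proof (rule stoch_bounded_L1)
  define C where "C = (\<integral>x. \<bar>g x\<bar> \<partial>N)"
  have C0: "C \<ge> 0" unfolding C_def by (intro Bochner_Integration.integral_nonneg) auto
  show "\<forall>\<^sub>F n in sequentially. integrable M (\<lambda>\<omega>. (\<Sum>j=start..n. g (Z j \<omega>)) / real n) \<and>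
      expectation (\<lambda>\<omega>. \<bar>(\<Sum>j=start..n. g (Z j \<omega>)) / real n\<bar>) \<le> 2 * C"
    using eventually_ge_at_top[of "1::nat"]
  proof eventually_elim
    case (elim n)
    have i: "integrable M (\<lambda>\<omega>. g (Z j \<omega>))" if "start \<le> j" for j
      using assms integrable_Z_iff[OF that, of g] by simp
    have e: "expectation (\<lambda>\<omega>. \<bar>g (Z j \<omega>)\<bar>) = C" if "start \<le> j" for j
      unfolding C_def by (rule expectation_Z[OF that]) measurable
    have iS: "integrable M (\<lambda>\<omega>. (\<Sum>j=start..n. g (Z j \<omega>)) / real n)"
      using i by (intro integrable_divide Bochner_Integration.integrable_sum) auto
    have "expectation (\<lambda>\<omega>. \<bar>(\<Sum>j=start..n. g (Z j \<omega>)) / real n\<bar>)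
        \<le> expectation (\<lambda>\<omega>. (\<Sum>j=start..n. \<bar>g (Z j \<omega>)\<bar>) / real n)"
    proof (rule integral_mono)
      show "integrable M (\<lambda>\<omega>. \<bar>(\<Sum>j=start..n. g (Z j \<omega>)) / real n\<bar>)"
        using iS by (rule integrable_abs)
      show "integrable M (\<lambda>\<omega>. (\<Sum>j=start..n. \<bar>g (Z j \<omega>)\<bar>) / real n)"
        using i by (intro integrable_divide Bochner_Integration.integrable_sum) auto
    qed (auto intro!: divide_right_mono)
    also have "\<dots> = real (card {start..n}) * C / real n"
      using i e by (simp add: Bochner_Integration.integral_sum)
    also have "\<dots> \<le> 2 * real n * C / real n"
      using C0 elim by (intro divide_right_mono mult_right_mono) auto
    finally show ?case using iS elim by simp
  qed
qed

end

section \<open>Averages of powers of residuals\<close>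

lemma abs_powr_minus_one_le:
  fixes u s :: real
  assumes "0 \<le> u" "0 < s" "s \<le> 1"
  shows "\<bar>u powr s - 1\<bar> \<le> \<bar>u - 1\<bar>"
proof (cases "1 \<le> u")
  case True
  have "u powr s \<le> u powr 1" using True assms by (intro powr_mono) auto
  moreover have "1 \<le> u powr s" using True assms by (intro ge_one_powr_ge_zero) auto
  ultimately show ?thesis using True by simp
next
  case False
  show ?thesis
  proof (cases "u = 0")
    case True then show ?thesis by simp
  next
    case u: False
    have "u powr 1 \<le> u powr s" using False u assms by (intro powr_mono') auto
    moreover have "u powr s \<le> 1" using False u assms by (intro powr_le1) auto
    ultimately show ?thesis using False u assms by simp
  qed
qed

text \<open>By homogeneity it is enough to take \<open>z = 1\<close>, where \<open>|u\<^sup>s - 1| \<le> |u - 1|\<close> for \<open>u \<ge> 0\<close>. The bound holds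
for all \<open>t\<close>, across the cusp as well, at the price of the singular factor.\<close>

lemma abs_powr_diff_le:
  fixes s z t :: real
  assumes s: "0 < s" "s \<le> 1" and z: "z \<noteq> 0"
  shows "\<bar>\<bar>z - t\<bar> powr s - \<bar>z\<bar> powr s\<bar> \<le> \<bar>t\<bar> * \<bar>z\<bar> powr (s - 1)"
proof -
  define u where "u = \<bar>z - t\<bar> / \<bar>z\<bar>"
  have u: "u \<ge> 0" by (simp add: u_def)
  have "\<bar>z - t\<bar> powr s = u powr s * \<bar>z\<bar> powr s"
    using z by (simp add: u_def powr_divide)
  then have "\<bar>\<bar>z - t\<bar> powr s - \<bar>z\<bar> powr s\<bar> = \<bar>(u powr s - 1) * \<bar>z\<bar> powr s\<bar>"
    by (simp add: left_diff_distrib)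
  also have "\<dots> = \<bar>u powr s - 1\<bar> * \<bar>z\<bar> powr s" by (simp add: abs_mult)
  also have "\<dots> \<le> \<bar>u - 1\<bar> * \<bar>z\<bar> powr s"
    using abs_powr_minus_one_le[OF u s] by (rule mult_right_mono) simp
  also have "\<bar>u - 1\<bar> * \<bar>z\<bar> powr s = \<bar>\<bar>z - t\<bar> - \<bar>z\<bar>\<bar> * \<bar>z\<bar> powr (s - 1)"
  proof -
    have "u - 1 = (\<bar>z - t\<bar> - \<bar>z\<bar>) / \<bar>z\<bar>" using z by (simp add: u_def diff_divide_distrib)
    then have "\<bar>u - 1\<bar> = \<bar>\<bar>z - t\<bar> - \<bar>z\<bar>\<bar> / \<bar>z\<bar>" by (simp add: abs_divide)
    then show ?thesis using z by (simp add: powr_diff)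
  qed
  also have "\<dots> \<le> \<bar>t\<bar> * \<bar>z\<bar> powr (s - 1)" by (rule mult_right_mono) auto
  finally show ?thesis .
qed

text \<open>If \<open>z\<close> and \<open>z - t\<close> have opposite signs, \<open>|t|\<close> is the sum of their absolute values, and each of the
two powers is bounded by \<open>|t| |z|\<^bsup>s-1\<^esup>\<close>.\<close>

lemma signed_powr_diff_le:
  fixes s z t :: real
  assumes s: "0 < s" "s \<le> 1" and z: "z \<noteq> 0"
  shows "\<bar>signed_powr (z - t) s - signed_powr z s\<bar> \<le> 2 * \<bar>t\<bar> * \<bar>z\<bar> powr (s - 1)"
proof (cases "sgn (z - t) = sgn z \<or> z - t = 0")
  case True
  then have "\<bar>signed_powr (z - t) s - signed_powr z s\<bar> = \<bar>\<bar>z - t\<bar> powr s - \<bar>z\<bar> powr s\<bar>"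
    using z by (auto simp: signed_powr_def sgn_if split: if_splits)
  also have "\<dots> \<le> \<bar>t\<bar> * \<bar>z\<bar> powr (s - 1)" by (rule abs_powr_diff_le[OF s z])
  also have "\<dots> \<le> 2 * \<bar>t\<bar> * \<bar>z\<bar> powr (s - 1)" by (simp add: mult_right_mono)
  finally show ?thesis .
next
  case False
  define a b where "a = \<bar>z - t\<bar>" and "b = \<bar>z\<bar>"
  have ab: "a > 0" "b > 0" "\<bar>t\<bar> = a + b"
    using False z by (auto simp: a_def b_def sgn_if split: if_splits)
  have "\<bar>signed_powr (z - t) s - signed_powr z s\<bar> \<le> a powr s + b powr s"
  proof -
    have "\<bar>signed_powr x s\<bar> \<le> \<bar>x\<bar> powr s" for x
      by (simp add: signed_powr_def abs_mult abs_sgn_eq)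
    from add_mono[OF this[of "z - t"] this[of z]] show ?thesis
      unfolding a_def b_def by (rule order_trans[OF abs_triangle_ineq4])
  qed
  moreover have b_le: "b powr s \<le> (a + b) * b powr (s - 1)"
  proof -
    have "b powr s = b * b powr (s - 1)" using ab powr_mult_base[of b "s - 1"] by simp
    also have "\<dots> \<le> (a + b) * b powr (s - 1)" using ab by (intro mult_right_mono) auto
    finally show ?thesis .
  qed
  moreover have "a powr s \<le> (a + b) * b powr (s - 1)"
  proof (cases "a \<le> b")
    case True
    then have "a powr s \<le> b powr s" using s ab by (intro powr_mono2) auto
    also note b_le
    finally show ?thesis .
  next
    case False
    have "a powr s = a * a powr (s - 1)" using ab powr_mult_base[of a "s - 1"] by simp
    also have "a powr (s - 1) \<le> b powr (s - 1)" using False ab s by (intro powr_mono2') auto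
    also have "a * b powr (s - 1) \<le> (a + b) * b powr (s - 1)" using ab by (intro mult_right_mono) auto
    finally show ?thesis using ab by simp
  qed
  ultimately have "\<bar>signed_powr (z - t) s - signed_powr z s\<bar> \<le> 2 * ((a + b) * b powr (s - 1))"
    by linarith
  then show ?thesis unfolding ab(3)[symmetric] by (simp add: b_def mult.assoc)
qed

context stationary_noise
begin

text \<open>Replacing \<open>Z j\<close> by the residual changes the sum by at most a constant times \<open>|h|\<close> times the sum of
\<open>|Z j|\<^bsup>s-1\<^esup>\<close>, that is by \<open>n\<^bsup>-1/2\<^esup> n\<close>: the same order as the fluctuation of the sum of \<open>f (Z j)\<close>.\<close>

lemma residual_average_root_n:
  fixes f :: "real \<Rightarrow> real" and x :: "nat \<Rightarrow> 'v::real_inner" and h :: "nat \<Rightarrow> 'a \<Rightarrow> 'v"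
  assumes start: "1 \<le> start"
    and f [measurable]: "f \<in> borel_measurable borel"
    and f2: "integrable N (\<lambda>x. (f x)\<^sup>2)"
    and neg: "integrable N (\<lambda>x. \<bar>x\<bar> powr (s - 1))"
    and nz: "AE x in N. x \<noteq> 0"
    and f_diff: "\<And>z t. z \<noteq> 0 \<Longrightarrow> \<bar>f (z - t) - f z\<bar> \<le> 2 * \<bar>t\<bar> * \<bar>z\<bar> powr (s - 1)"
    and x: "\<And>j. start \<le> j \<Longrightarrow> norm (x j) \<le> C"
    and h: "stoch_bounded (\<lambda>n \<omega>. sqrt (real n) * norm (h n \<omega>))"
  shows "stoch_bounded (\<lambda>n \<omega>. sqrt (real n) *
    ((\<Sum>j=start..n. f (Z j \<omega> - x j \<bullet> h n \<omega>)) / (real n - (real start - 1)) - integral\<^sup>L N f))"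
proof -
  have C: "C \<ge> 0" using x[of start] norm_ge_zero[of "x start"] by linarith
  define S where "S n \<omega> = (\<Sum>j=start..n. 1 * (f (Z j \<omega>) - integral\<^sup>L N f)) / sqrt (real n)" for n \<omega>
  define W where "W n \<omega> = (\<Sum>j=start..n. \<bar>Z j \<omega>\<bar> powr (s - 1)) / real n" for n \<omega>
  have S: "stoch_bounded S" unfolding S_def
    by (rule weighted_sum_stoch_bounded[OF f f2, where C = 1]) auto
  have W: "stoch_bounded W" unfolding W_def
    by (rule average_stoch_bounded[OF neg]) measurable
  have main: "stoch_bounded (\<lambda>n \<omega>. \<bar>S n \<omega>\<bar> + (2 * C) * \<bar>(sqrt (real n) * norm (h n \<omega>)) * W n \<omega>\<bar>)"
    by (intro stoch_bounded_add stoch_bounded_abs S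
        stoch_bounded_mono[OF stoch_bounded_mult[OF h W], of _ "2 * C"] always_eventually)
      (auto simp: abs_mult C)
  show ?thesis
  proof (rule stoch_bounded_mono[OF main, where c = 2])
    show "\<forall>\<^sub>F n in sequentially. AE \<omega> in M. \<bar>sqrt (real n) *
        ((\<Sum>j=start..n. f (Z j \<omega> - x j \<bullet> h n \<omega>)) / (real n - (real start - 1)) - integral\<^sup>L N f)\<bar>
        \<le> 2 * \<bar>\<bar>S n \<omega>\<bar> + 2 * C * \<bar>sqrt (real n) * norm (h n \<omega>) * W n \<omega>\<bar>\<bar>"
      using eventually_ge_at_top[of "2 * start"]
    proof eventually_elim
      case (elim n)
      define m where "m = real n - (real start - 1)"
      have m: "m > 0" "real n \<le> 2 * m" using elim start by (auto simp: m_def)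
      have n: "n > 0" using elim start by auto
      have card: "real (card {start..n}) = m" using elim start by (auto simp: m_def of_nat_diff)
      have "AE \<omega> in M. Z j \<omega> \<noteq> 0" if "j \<in> {start..n}" for j
      proof -
        have j: "start \<le> j" using that by simp
        have "AE x in distr M borel (Z j). x \<noteq> 0" unfolding distr_Z[OF j] by (rule nz)
        then show ?thesis
          by (subst (asm) AE_distr_iff) (auto simp: Z_measurable[OF j])
      qed
      then have "AE \<omega> in M. \<forall>j\<in>{start..n}. Z j \<omega> \<noteq> 0" by (intro AE_finite_allI) auto
      then show ?case
      proof eventually_elim
        case (elim \<omega>)
        define D where "D = (\<Sum>j=start..n. f (Z j \<omega> - x j \<bullet> h n \<omega>) - f (Z j \<omega>))"
        have "\<bar>D\<bar> \<le> (\<Sum>j=start..n. \<bar>f (Z j \<omega> - x j \<bullet> h n \<omega>) - f (Z j \<omega>)\<bar>)"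
          unfolding D_def by (rule sum_abs)
        also have "\<dots> \<le> (\<Sum>j=start..n. (2 * (C * norm (h n \<omega>))) * \<bar>Z j \<omega>\<bar> powr (s - 1))"
        proof (rule sum_mono)
          fix j assume j: "j \<in> {start..n}"
          have "\<bar>f (Z j \<omega> - x j \<bullet> h n \<omega>) - f (Z j \<omega>)\<bar> \<le> 2 * \<bar>x j \<bullet> h n \<omega>\<bar> * \<bar>Z j \<omega>\<bar> powr (s - 1)"
            using elim j by (intro f_diff) auto
          also have "\<bar>x j \<bullet> h n \<omega>\<bar> \<le> C * norm (h n \<omega>)"
            using Cauchy_Schwarz_ineq2[of "x j" "h n \<omega>"] x[of j] j
            by (intro order_trans[OF Cauchy_Schwarz_ineq2] mult_right_mono) auto
          finally show "\<bar>f (Z j \<omega> - x j \<bullet> h n \<omega>) - f (Z j \<omega>)\<bar> \<le> 2 * (C * norm (h n \<omega>)) * \<bar>Z j \<omega>\<bar> powr (s - 1)"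
            by (simp add: mult_right_mono mult_left_mono)
        qed
        also have "\<dots> = 2 * (C * norm (h n \<omega>)) * (real n * W n \<omega>)"
          using n by (simp add: W_def sum_distrib_left[symmetric])
        finally have D: "\<bar>D\<bar> \<le> 2 * (C * norm (h n \<omega>)) * (real n * W n \<omega>)" .
        have sq: "sqrt (real n) * sqrt (real n) = real n" by simp
        have W0: "W n \<omega> \<ge> 0" unfolding W_def by (intro divide_nonneg_nonneg sum_nonneg) auto
        have "(\<Sum>j=start..n. f (Z j \<omega> - x j \<bullet> h n \<omega>)) = D + sqrt (real n) * S n \<omega> + m * integral\<^sup>L N f"
          using n card by (simp add: D_def S_def sum_subtractf)
        then have "sqrt (real n) * ((\<Sum>j=start..n. f (Z j \<omega> - x j \<bullet> h n \<omega>)) / m - integral\<^sup>L N f)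
            = sqrt (real n) * (D + sqrt (real n) * S n \<omega>) / m"
          using m by (simp add: field_simps)
        also have "\<bar>\<dots>\<bar> \<le> sqrt (real n) * (2 * (C * norm (h n \<omega>)) * (real n * W n \<omega>) + sqrt (real n) * \<bar>S n \<omega>\<bar>) / m"
        proof -
          have "\<bar>D + sqrt (real n) * S n \<omega>\<bar> \<le> \<bar>D\<bar> + sqrt (real n) * \<bar>S n \<omega>\<bar>"
            using abs_triangle_ineq[of D "sqrt (real n) * S n \<omega>"] by (simp add: abs_mult)
          with D have "\<bar>D + sqrt (real n) * S n \<omega>\<bar>
              \<le> 2 * (C * norm (h n \<omega>)) * (real n * W n \<omega>) + sqrt (real n) * \<bar>S n \<omega>\<bar>" by linarith
          from mult_left_mono[OF this, of "sqrt (real n)"] show ?thesis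
            using m by (auto simp: abs_mult abs_divide intro!: divide_right_mono)
        qed
        also have "\<dots> = (real n / m) * (\<bar>S n \<omega>\<bar> + 2 * C * (sqrt (real n) * norm (h n \<omega>) * W n \<omega>))"
        proof -
          have "sqrt (real n) * (2 * (C * norm (h n \<omega>)) * (real n * W n \<omega>) + sqrt (real n) * \<bar>S n \<omega>\<bar>)
            = real n * (2 * C * (sqrt (real n) * norm (h n \<omega>) * W n \<omega>)) + (sqrt (real n) * sqrt (real n)) * \<bar>S n \<omega>\<bar>"
            by (simp add: algebra_simps del: real_sqrt_mult_self)
          also have "\<dots> = real n * (\<bar>S n \<omega>\<bar> + 2 * C * (sqrt (real n) * norm (h n \<omega>) * W n \<omega>))"
            unfolding sq by (simp add: algebra_simps)
          finally show ?thesis by simp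
        qed
        also have "\<dots> \<le> 2 * (\<bar>S n \<omega>\<bar> + 2 * C * (sqrt (real n) * norm (h n \<omega>) * W n \<omega>))"
          using m C W0 by (intro mult_right_mono add_nonneg_nonneg mult_nonneg_nonneg) (auto simp: divide_simps)
        also have "\<dots> = 2 * \<bar>\<bar>S n \<omega>\<bar> + 2 * C * \<bar>sqrt (real n) * norm (h n \<omega>) * W n \<omega>\<bar>\<bar>"
          using C W0 by (simp add: abs_mult)
        finally show ?case by (simp add: m_def)
      qed
    qed
  qed
qed

end

section \<open>The Cauchy quasi-maximum likelihood estimator\<close>

definition cauchy_loss :: "real \<Rightarrow> real" where
  "cauchy_loss x = ln (1 + x\<^sup>2)"

definition cauchy_score :: "real \<Rightarrow> real" where
  "cauchy_score x = 2 * x / (1 + x\<^sup>2)"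

definition cauchy_curv :: "real \<Rightarrow> real" where
  "cauchy_curv x = (1 - x\<^sup>2) / (1 + x\<^sup>2)\<^sup>2"

lemma one_plus_square_pos: "0 < 1 + (x::real)\<^sup>2"
  by (simp add: add_pos_nonneg)

lemma abs_cauchy_score_le: "\<bar>cauchy_score x\<bar> \<le> 1"
proof -
  have "2 * \<bar>x\<bar> \<le> 1 + x\<^sup>2" using sum_squares_bound[of "\<bar>x\<bar>" 1] by simp
  then show ?thesis using one_plus_square_pos[of x]
    by (simp add: cauchy_score_def abs_mult divide_le_eq_1)
qed

lemma abs_cauchy_curv_le: "\<bar>cauchy_curv x\<bar> \<le> 1"
proof -
  have p: "0 < 1 + x\<^sup>2" by (rule one_plus_square_pos)
  have "\<bar>1 - x\<^sup>2\<bar> \<le> 1 + x\<^sup>2" by (simp add: abs_le_iff)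
  also have "\<dots> \<le> (1 + x\<^sup>2)\<^sup>2" using p by (simp add: power2_eq_square mult_le_cancel_left1)
  finally show ?thesis using p by (simp add: cauchy_curv_def)
qed

lemma cauchy_loss_deriv: "(cauchy_loss has_real_derivative cauchy_score x) (at x)"
  unfolding cauchy_loss_def[abs_def] cauchy_score_def using one_plus_square_pos[of x]
  by (auto intro!: derivative_eq_intros)

lemma cauchy_loss_lipschitz: "\<bar>cauchy_loss x - cauchy_loss y\<bar> \<le> \<bar>x - y\<bar>"
proof -
  have "norm (cauchy_loss x - cauchy_loss y) \<le> 1 * norm (x - y)"
    by (rule field_differentiable_bound[where S = UNIV and f' = cauchy_score])
      (auto intro: has_field_derivative_at_within cauchy_loss_deriv abs_cauchy_score_le)
  then show ?thesis by simp
qed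

text \<open>The third derivative of the loss is bounded, so the remainder is uniform in \<open>z\<close>.\<close>

lemma cauchy_loss_taylor:
  "\<bar>cauchy_loss (z - t) - cauchy_loss z + cauchy_score z * t - cauchy_curv z * t\<^sup>2\<bar> \<le> 2 * \<bar>t\<bar> ^ 3"
proof -
  define D3 where "D3 x = (2 * x ^ 3 - 6 * x) / (1 + x\<^sup>2) ^ 3" for x :: real
  define diff where "diff = (\<lambda>(m::nat) u. if m = 0 then cauchy_loss (z - u) else if m = 1 then - cauchy_score (z - u)
      else if m = 2 then 2 * cauchy_curv (z - u) else - 2 * D3 (z - u))"
  have score_deriv: "(cauchy_score has_real_derivative 2 * cauchy_curv x) (at x)" for x
    unfolding cauchy_score_def[abs_def] cauchy_curv_def using one_plus_square_pos[of x]
    by (auto intro!: derivative_eq_intros simp: power2_eq_square divide_simps)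
  have curv_deriv: "(cauchy_curv has_real_derivative D3 x) (at x)" for x
  proof -
    have p: "1 + x\<^sup>2 \<noteq> 0" using one_plus_square_pos[of x] by simp
    have a: "((\<lambda>x. 1 - x\<^sup>2) has_real_derivative - 2 * x) (at x)"
      by (auto intro!: derivative_eq_intros)
    have b: "((\<lambda>x. (1 + x\<^sup>2)\<^sup>2) has_real_derivative 2 * (1 + x\<^sup>2) * (2 * x)) (at x)"
      by (auto intro!: derivative_eq_intros)
    have "(cauchy_curv has_real_derivative
        ((- 2 * x) * (1 + x\<^sup>2)\<^sup>2 - (1 - x\<^sup>2) * (2 * (1 + x\<^sup>2) * (2 * x))) / ((1 + x\<^sup>2)\<^sup>2 * (1 + x\<^sup>2)\<^sup>2)) (at x)"
      unfolding cauchy_curv_def[abs_def] using p by (intro DERIV_divide a b) simp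
    moreover have "((- 2 * x) * (1 + x\<^sup>2)\<^sup>2 - (1 - x\<^sup>2) * (2 * (1 + x\<^sup>2) * (2 * x))) / ((1 + x\<^sup>2)\<^sup>2 * (1 + x\<^sup>2)\<^sup>2) = D3 x"
    proof -
      have "(- 2 * x) * (1 + x\<^sup>2)\<^sup>2 - (1 - x\<^sup>2) * (2 * (1 + x\<^sup>2) * (2 * x)) = (1 + x\<^sup>2) * (2 * x ^ 3 - 6 * x)"
        by algebra
      moreover have "(1 + x\<^sup>2)\<^sup>2 * (1 + x\<^sup>2)\<^sup>2 = (1 + x\<^sup>2) * (1 + x\<^sup>2) ^ 3" by algebra
      ultimately show ?thesis using p by (simp only: D3_def mult_divide_mult_cancel_left[OF p])
    qed
    ultimately show ?thesis by simp
  qed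
  have sub: "((\<lambda>u. z - u) has_real_derivative - 1) (at u)" for u
    by (auto intro!: derivative_eq_intros)
  have "\<exists>u. \<bar>u\<bar> \<le> \<bar>t\<bar> \<and> cauchy_loss (z - t) = (\<Sum>m<3. diff m 0 / fact m * t ^ m) + diff 3 u / fact 3 * t ^ 3"
  proof (rule Maclaurin_bi_le)
    show "diff 0 = (\<lambda>t. cauchy_loss (z - t))" by (simp add: diff_def)
    show "\<forall>m u. m < 3 \<and> \<bar>u\<bar> \<le> \<bar>t\<bar> \<longrightarrow> (diff m has_real_derivative diff (Suc m) u) (at u)"
    proof (intro allI impI)
      fix m :: nat and u :: real assume "m < 3 \<and> \<bar>u\<bar> \<le> \<bar>t\<bar>"
      then consider "m = 0" | "m = 1" | "m = 2" by linarith
      then show "(diff m has_real_derivative diff (Suc m) u) (at u)"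
      proof cases
        case 1
        then show ?thesis using DERIV_chain2[OF cauchy_loss_deriv sub, of u] by (simp add: diff_def)
      next
        case 2
        then show ?thesis using DERIV_minus[OF DERIV_chain2[OF score_deriv sub, of u]] by (simp add: diff_def)
      next
        case 3
        then show ?thesis using DERIV_cmult[OF DERIV_chain2[OF curv_deriv sub, of u], of 2] by (simp add: diff_def)
      qed
    qed
  qed
  then obtain u where u: "cauchy_loss (z - t) = (\<Sum>m<3. diff m 0 / fact m * t ^ m) + diff 3 u / fact 3 * t ^ 3" by blast
  have "cauchy_loss (z - t) - cauchy_loss z + cauchy_score z * t - cauchy_curv z * t\<^sup>2 = - D3 (z - u) / 3 * t ^ 3"
  proof -
    have sum3: "(\<Sum>m<3. g m) = g 0 + g 1 + g 2" for g :: "nat \<Rightarrow> real"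
      by (simp add: eval_nat_numeral)
    have "fact 2 = (2 :: real)" "fact 3 = (6 :: real)" by (simp_all add: fact_numeral)
    then show ?thesis unfolding u sum3 by (simp add: diff_def)
  qed
  moreover have "\<bar>D3 y\<bar> \<le> 6" for y
  proof -
    have p: "0 < 1 + y\<^sup>2" by (rule one_plus_square_pos)
    have "\<bar>y\<bar> \<le> 1 + y\<^sup>2" using sum_squares_bound[of "\<bar>y\<bar>" 1] by simp
    moreover have "\<bar>2 * y\<^sup>2 - 6\<bar> \<le> 6 * (1 + y\<^sup>2)" by (simp add: abs_le_iff)
    ultimately have "\<bar>y\<bar> * \<bar>2 * y\<^sup>2 - 6\<bar> \<le> (1 + y\<^sup>2) * (6 * (1 + y\<^sup>2))" using p by (intro mult_mono) auto
    also have "\<dots> \<le> (1 + y\<^sup>2) * (6 * (1 + y\<^sup>2)) * (1 + y\<^sup>2)"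
    proof -
      have "0 \<le> (1 + y\<^sup>2) * (6 * (1 + y\<^sup>2))" using p by (intro mult_nonneg_nonneg) auto
      from mult_left_mono[OF _ this, of 1 "1 + y\<^sup>2"] show ?thesis by simp
    qed
    also have "\<dots> = 6 * (1 + y\<^sup>2) ^ 3" by algebra
    also have "\<bar>y\<bar> * \<bar>2 * y\<^sup>2 - 6\<bar> = \<bar>2 * y ^ 3 - 6 * y\<bar>"
    proof -
      have "y * (2 * y\<^sup>2 - 6) = 2 * y ^ 3 - 6 * y" by algebra
      then show ?thesis by (metis abs_mult)
    qed
    finally show ?thesis using p by (simp add: D3_def abs_divide power_abs[symmetric] divide_le_eq)
  qed
  ultimately show ?thesis by (simp add: abs_mult power_abs mult_right_mono)
qed

lemma quad_form_linear: "linear (\<lambda>A::real^'q^'q. h \<bullet> (A *v h))"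
  by (rule linearI) (simp_all add: matrix_vector_mult_add_rdistrib inner_add_right scaleR_matrix_vector_assoc[symmetric])

lemma quad_form_outer: "h \<bullet> (outer u u *v h) = (u \<bullet> h)\<^sup>2" for h u :: "real^'q"
proof -
  have "outer u u *v h = (u \<bullet> h) *\<^sub>R u"
    by (simp add: vec_eq_iff outer_def matrix_vector_mult_def inner_vec_def sum_distrib_left mult_ac)
  then show ?thesis by (simp add: power2_eq_square inner_commute)
qed

lemma quad_form_gram:
  "h \<bullet> (((1 / real n) *\<^sub>R (\<Sum>j\<in>J. outer (x j) (x j))) *v h) = (\<Sum>j\<in>J. (x j \<bullet> h)\<^sup>2) / real n"
  for x :: "nat \<Rightarrow> real^'q"
  using linear_scale[OF quad_form_linear[of h]] linear_sum[OF quad_form_linear[of h], of _ J]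
  by (simp add: quad_form_outer)

lemma abs_quad_form_le:
  "\<bar>h \<bullet> (A *v h)\<bar> \<le> real CARD('q) * real CARD('q) * norm A * (norm h)\<^sup>2" for A :: "real^'q^'q"
proof -
  have "\<bar>h \<bullet> (A *v h)\<bar> \<le> norm h * norm (A *v h)" by (rule Cauchy_Schwarz_ineq2)
  also have "norm (A *v h) \<le> onorm ((*v) A) * norm h"
    by (rule onorm) (rule matrix_vector_mul_bounded_linear)
  also have "onorm ((*v) A) \<le> (\<Sum>i\<in>UNIV. \<Sum>j\<in>UNIV. \<bar>A $ i $ j\<bar>)"
    by (rule onorm_le_matrix_component_sum)
  also have "\<dots> \<le> (\<Sum>i\<in>(UNIV::'q set). \<Sum>j\<in>(UNIV::'q set). norm A)"
  proof (intro sum_mono)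
    fix i j
    have "\<bar>A $ i $ j\<bar> \<le> norm (A $ i)" by (rule component_le_norm_cart)
    also have "\<dots> \<le> norm A" by (rule Finite_Cartesian_Product.norm_nth_le)
    finally show "\<bar>A $ i $ j\<bar> \<le> norm A" .
  qed
  finally show ?thesis by (simp add: power2_eq_square mult_left_mono mult_right_mono algebra_simps)
qed

lemma pos_def_coercive:
  fixes A :: "real^'q^'q"
  assumes "pos_def A"
  obtains c where "0 < c" "\<And>h. c * (norm h)\<^sup>2 \<le> h \<bullet> (A *v h)"
proof -
  have "continuous_on (sphere 0 1) (\<lambda>h::real^'q. h \<bullet> (A *v h))"
    by (intro continuous_intros linear_continuous_on_compose[OF continuous_on_id] matrix_vector_mul_linear)
  moreover have "sphere (0::real^'q) 1 \<noteq> {}" by simp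
  ultimately obtain e where e: "e \<in> sphere 0 1" "\<And>h. h \<in> sphere 0 1 \<Longrightarrow> e \<bullet> (A *v e) \<le> h \<bullet> (A *v h)"
    using continuous_attains_inf[of "sphere (0::real^'q) 1" "\<lambda>h. h \<bullet> (A *v h)"] by auto
  show thesis
  proof (rule that[of "e \<bullet> (A *v e)"])
    have "e \<noteq> 0" using e(1) by auto
    then show "0 < e \<bullet> (A *v e)" using assms by (auto simp: pos_def_def)
    show "e \<bullet> (A *v e) * (norm h)\<^sup>2 \<le> h \<bullet> (A *v h)" for h
    proof (cases "h = 0")
      case False
      define v where "v = h /\<^sub>R norm h"
      have "e \<bullet> (A *v e) \<le> v \<bullet> (A *v v)" using False by (intro e(2)) (simp add: v_def)
      then have "e \<bullet> (A *v e) * (norm h)\<^sup>2 \<le> v \<bullet> (A *v v) * (norm h)\<^sup>2" by (rule mult_right_mono) simp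
      also have "v \<bullet> (A *v v) * (norm h)\<^sup>2 = (norm h *\<^sub>R v) \<bullet> (A *v (norm h *\<^sub>R v))"
        by (simp add: matrix_vector_mult_scaleR power2_eq_square mult_ac)
      also have "norm h *\<^sub>R v = h" using False by (simp add: v_def)
      finally show ?thesis .
    qed simp
  qed
qed

text \<open>The limit is coercive by compactness of the sphere, and convergence of matrices is uniform on the
sphere, so half of the constant survives for large \<open>n\<close>.\<close>

lemma gram_coercive:
  fixes x :: "nat \<Rightarrow> real^'q"
  assumes lim: "(\<lambda>n. (1 / real n) *\<^sub>R (\<Sum>j=k..n. outer (x j) (x j))) \<longlonglongrightarrow> A" and A: "pos_def A"
  obtains c where "0 < c" "\<forall>\<^sub>F n in sequentially. \<forall>h. c * real n * (norm h)\<^sup>2 \<le> (\<Sum>j=k..n. (x j \<bullet> h)\<^sup>2)"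
proof -
  obtain c where c: "0 < c" "\<And>h. c * (norm h)\<^sup>2 \<le> h \<bullet> (A *v h)" using pos_def_coercive[OF A] by blast
  define G where "G n = (1 / real n) *\<^sub>R (\<Sum>j=k..n. outer (x j) (x j))" for n
  define q where "q = real CARD('q) * real CARD('q)"
  have "((\<lambda>n. q * norm (G n - A)) \<longlongrightarrow> q * 0) sequentially"
    using lim unfolding G_def[symmetric] by (intro tendsto_intros tendsto_norm_zero LIM_zero)
  then have "\<forall>\<^sub>F n in sequentially. q * norm (G n - A) < c / 2"
    using c(1) by (intro order_tendstoD) auto
  then have "\<forall>\<^sub>F n in sequentially. \<forall>h. c / 2 * real n * (norm h)\<^sup>2 \<le> (\<Sum>j=k..n. (x j \<bullet> h)\<^sup>2)"
    using eventually_gt_at_top[of 0]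
  proof eventually_elim
    case (elim n)
    show ?case
    proof
      fix h
      have "\<bar>h \<bullet> ((G n - A) *v h)\<bar> \<le> q * norm (G n - A) * (norm h)\<^sup>2"
        unfolding q_def by (rule abs_quad_form_le)
      also have "\<dots> \<le> c / 2 * (norm h)\<^sup>2" using elim by (intro mult_right_mono) auto
      finally have "- (c / 2 * (norm h)\<^sup>2) \<le> h \<bullet> ((G n - A) *v h)" by simp
      also have "h \<bullet> ((G n - A) *v h) = h \<bullet> (G n *v h) - h \<bullet> (A *v h)"
        using linear_diff[OF quad_form_linear[of h]] by simp
      finally have "c / 2 * (norm h)\<^sup>2 \<le> h \<bullet> (G n *v h)" using c(2)[of h] by simp
      then have "c / 2 * (norm h)\<^sup>2 \<le> (\<Sum>j=k..n. (x j \<bullet> h)\<^sup>2) / real n"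
        unfolding G_def quad_form_gram .
      then show "c / 2 * real n * (norm h)\<^sup>2 \<le> (\<Sum>j=k..n. (x j \<bullet> h)\<^sup>2)"
        using elim by (simp add: field_simps)
    qed
  qed
  then show thesis using c(1) that[of "c / 2"] by simp
qed

context stationary_noise
begin

definition mean_contrast :: "real \<Rightarrow> real" where
  "mean_contrast t = (\<integral>z. cauchy_loss (z - t) - cauchy_loss z \<partial>N)"

definition mean_curv :: real where
  "mean_curv = integral\<^sup>L N cauchy_curv"

lemma cauchy_measurable [measurable]:
  "cauchy_loss \<in> borel_measurable borel" "cauchy_score \<in> borel_measurable borel"
  "cauchy_curv \<in> borel_measurable borel"
  unfolding cauchy_loss_def[abs_def] cauchy_score_def[abs_def] cauchy_curv_def[abs_def] by measurable

lemma integrable_contrast: "integrable N (\<lambda>z. cauchy_loss (z - t) - cauchy_loss z)"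
proof -
  interpret N: prob_space N by (rule prob_space_N)
  show ?thesis
    by (rule N.integrable_const_bound[where B = "\<bar>t\<bar>"])
      (use cauchy_loss_lipschitz[of "z - t" z for z] in \<open>auto intro!: AE_I2\<close>)
qed

lemma integrable_score_curv: "integrable N cauchy_score" "integrable N cauchy_curv"
proof -
  interpret N: prob_space N by (rule prob_space_N)
  show "integrable N cauchy_score" "integrable N cauchy_curv"
    by (auto intro!: N.integrable_const_bound[where B = 1] simp: abs_cauchy_score_le abs_cauchy_curv_le)
qed

lemma mean_contrast_taylor:
  assumes score: "integral\<^sup>L N cauchy_score = 0"
  shows "mean_contrast t \<le> mean_curv * t\<^sup>2 + 2 * \<bar>t\<bar> ^ 3"
proof -
  interpret N: prob_space N by (rule prob_space_N)
  note i = integrable_score_curv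
  have "mean_contrast t \<le> (\<integral>z. - cauchy_score z * t + cauchy_curv z * t\<^sup>2 + 2 * \<bar>t\<bar> ^ 3 \<partial>N)"
    unfolding mean_contrast_def
  proof (rule integral_mono[OF integrable_contrast])
    show "integrable N (\<lambda>z. - cauchy_score z * t + cauchy_curv z * t\<^sup>2 + 2 * \<bar>t\<bar> ^ 3)" using i by auto
    show "cauchy_loss (z - t) - cauchy_loss z \<le> - cauchy_score z * t + cauchy_curv z * t\<^sup>2 + 2 * \<bar>t\<bar> ^ 3" for z
      using cauchy_loss_taylor[of z t] by (simp add: abs_le_iff)
  qed
  also have "\<dots> = mean_curv * t\<^sup>2 + 2 * \<bar>t\<bar> ^ 3"
    using i score by (simp add: mean_curv_def N.prob_space)
  finally show ?thesis .
qed

text \<open>In a fixed direction \<open>e\<close>, the limiting contrast at \<open>\<mu>0 + t e\<close> is at least \<open>l t\<^sup>2\<close> by assumption and at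
most \<open>mean_curv q t\<^sup>2 + 2 C\<^sup>3 t\<^sup>3\<close> by Taylor expansion, where \<open>q\<close> is the limit of the design in direction
\<open>e\<close>. Let \<open>t\<close> tend to \<open>0\<close>.\<close>

lemma mean_curv_pos:
  fixes x :: "nat \<Rightarrow> real^'q"
  assumes start: "1 \<le> start"
    and x: "\<And>j. start \<le> j \<Longrightarrow> norm (x j) \<le> C" and C: "0 < C"
    and gram: "(\<lambda>n. (1 / real n) *\<^sub>R (\<Sum>j=start..n. outer (x j) (x j))) \<longlonglongrightarrow> A" "pos_def A"
    and \<Theta>: "open \<Theta>" "\<mu>0 \<in> \<Theta>"
    and contrast: "\<And>\<mu>. \<mu> \<in> \<Theta> \<Longrightarrow> (\<lambda>n. (\<Sum>j=start..n. mean_contrast (x j \<bullet> (\<mu> - \<mu>0))) / real n) \<longlonglongrightarrow> L \<mu>"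
    and L: "0 < l" "\<And>\<mu>. \<mu> \<in> \<Theta> \<Longrightarrow> l * (norm (\<mu> - \<mu>0))\<^sup>2 \<le> L \<mu>"
    and score: "integral\<^sup>L N cauchy_score = 0"
  shows "0 < mean_curv"
proof -
  obtain b :: 'q where True by simp
  define e :: "real^'q" where "e = axis b 1"
  have e: "norm e = 1" by (simp add: e_def)
  define q where "q = e \<bullet> (A *v e)"
  have q: "q > 0" using gram(2) e unfolding q_def pos_def_def by (metis norm_zero zero_neq_one)
  obtain r where r: "r > 0" "ball \<mu>0 r \<subseteq> \<Theta>" using \<Theta> open_contains_ball by blast
  have quad: "(\<lambda>n. (\<Sum>j=start..n. (x j \<bullet> e)\<^sup>2) / real n) \<longlonglongrightarrow> q"
  proof -
    have "bounded_linear (\<lambda>B. e \<bullet> (B *v e))"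
      using quad_form_linear[of e] by (simp add: linear_conv_bounded_linear)
    from bounded_linear.tendsto[OF this gram(1)] show ?thesis
      unfolding quad_form_gram q_def .
  qed
  have bound: "l \<le> mean_curv * q + 2 * C ^ 3 * t" if t: "0 < t" "t < r" for t
  proof -
    define \<mu> where "\<mu> = \<mu>0 + t *\<^sub>R e"
    have \<mu>: "\<mu> \<in> \<Theta>" "norm (\<mu> - \<mu>0) = t"
      using r(2) t e by (auto simp: \<mu>_def dist_norm subset_iff)
    have le: "\<forall>\<^sub>F n in sequentially. (\<Sum>j=start..n. mean_contrast (x j \<bullet> (\<mu> - \<mu>0))) / real n
        \<le> mean_curv * t\<^sup>2 * ((\<Sum>j=start..n. (x j \<bullet> e)\<^sup>2) / real n) + 2 * (C * t) ^ 3"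
      using eventually_ge_at_top[of 1]
    proof eventually_elim
      case (elim n)
      have "(\<Sum>j=start..n. mean_contrast (x j \<bullet> (\<mu> - \<mu>0)))
          \<le> (\<Sum>j=start..n. mean_curv * t\<^sup>2 * (x j \<bullet> e)\<^sup>2 + 2 * (C * t) ^ 3)"
      proof (rule sum_mono)
        fix j assume j: "j \<in> {start..n}"
        have xe: "x j \<bullet> (\<mu> - \<mu>0) = t * (x j \<bullet> e)" by (simp add: \<mu>_def)
        have "\<bar>x j \<bullet> e\<bar> \<le> C"
          using Cauchy_Schwarz_ineq2[of "x j" e] x[of j] j e by simp
        then have "\<bar>t * (x j \<bullet> e)\<bar> ^ 3 \<le> (C * t) ^ 3"
          using t by (intro power_mono) (auto simp: abs_mult)
        then show "mean_contrast (x j \<bullet> (\<mu> - \<mu>0)) \<le> mean_curv * t\<^sup>2 * (x j \<bullet> e)\<^sup>2 + 2 * (C * t) ^ 3"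
          using mean_contrast_taylor[OF score, of "x j \<bullet> (\<mu> - \<mu>0)"] unfolding xe
          by (simp add: power_mult_distrib mult_ac)
      qed
      also have "\<dots> = mean_curv * t\<^sup>2 * (\<Sum>j=start..n. (x j \<bullet> e)\<^sup>2) + real (card {start..n}) * (2 * (C * t) ^ 3)"
        by (simp only: sum.distrib sum_distrib_left[symmetric] sum_constant)
      also have "\<dots> \<le> mean_curv * t\<^sup>2 * (\<Sum>j=start..n. (x j \<bullet> e)\<^sup>2) + real n * (2 * (C * t) ^ 3)"
        using start C t by (intro add_left_mono mult_right_mono) auto
      finally show ?case using elim by (simp add: field_simps)
    qed
    have "L \<mu> \<le> mean_curv * t\<^sup>2 * q + 2 * (C * t) ^ 3"
    proof (rule tendsto_le[OF sequentially_bot _ contrast[OF \<mu>(1)] le])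
      show "(\<lambda>n. mean_curv * t\<^sup>2 * ((\<Sum>j=start..n. (x j \<bullet> e)\<^sup>2) / real n) + 2 * (C * t) ^ 3)
        \<longlonglongrightarrow> mean_curv * t\<^sup>2 * q + 2 * (C * t) ^ 3"
        by (intro tendsto_intros quad)
    qed
    with L(2)[OF \<mu>(1)] have "l * t\<^sup>2 \<le> (mean_curv * q + 2 * C ^ 3 * t) * t\<^sup>2"
      by (simp add: \<mu>(2) power_mult_distrib algebra_simps power2_eq_square power3_eq_cube)
    then show ?thesis using t by (simp add: mult_le_cancel_right)
  qed
  have "((\<lambda>t. mean_curv * q + 2 * C ^ 3 * t) \<longlongrightarrow> mean_curv * q + 2 * C ^ 3 * 0) (at_right 0)"
    by (intro tendsto_intros)
  moreover have "\<forall>\<^sub>F t in at_right 0. l \<le> mean_curv * q + 2 * C ^ 3 * t"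
    unfolding eventually_at_right_field using bound r(1) by blast
  ultimately have "l \<le> mean_curv * q"
    by (intro tendsto_lowerbound[of "\<lambda>t. mean_curv * q + 2 * C ^ 3 * t" _ "at_right 0"]) auto
  then have "0 < mean_curv * q" using L(1) by linarith
  then show ?thesis using q by (simp add: zero_less_mult_iff)
qed

text \<open>Outside the ball of radius \<open>\<rho>\<close> the expected contrast is at least of order \<open>n l \<rho>\<^sup>2\<close>. On a finite net
the fluctuations are \<open>o(n)\<close>, and between the points of the net the Lipschitz loss changes by at most \<open>n C \<delta>\<close>;
so a minimiser cannot lie there.\<close>

lemma cauchy_qmle_consistent:
  fixes x :: "nat \<Rightarrow> real^'q" and \<mu>h :: "nat \<Rightarrow> 'a \<Rightarrow> real^'q"
  assumes start: "1 \<le> start"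
    and x: "\<And>j. start \<le> j \<Longrightarrow> norm (x j) \<le> C" and C: "0 < C"
    and \<Theta>: "bounded \<Theta>"
    and contrast: "\<And>\<mu>. \<mu> \<in> \<Theta> \<Longrightarrow> (\<lambda>n. (\<Sum>j=start..n. mean_contrast (x j \<bullet> (\<mu> - \<mu>0))) / real n) \<longlonglongrightarrow> L \<mu>"
    and L: "0 < l" "\<And>\<mu>. \<mu> \<in> \<Theta> \<Longrightarrow> l * (norm (\<mu> - \<mu>0))\<^sup>2 \<le> L \<mu>"
    and min: "\<forall>\<^sub>F n in sequentially. \<forall>\<omega>\<in>space M. \<mu>h n \<omega> \<in> closure \<Theta> \<and>
      (\<Sum>j=start..n. cauchy_loss (Z j \<omega> - x j \<bullet> (\<mu>h n \<omega> - \<mu>0)) - cauchy_loss (Z j \<omega>)) \<le> 0"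
    and pos: "0 < \<rho>" "0 < \<epsilon>"
  shows "\<forall>\<^sub>F n in sequentially. likely \<epsilon> (\<lambda>\<omega>. norm (\<mu>h n \<omega> - \<mu>0) < \<rho>)"
proof -
  interpret N: prob_space N by (rule prob_space_N)
  \<comment> \<open>The limiting contrast is at least \<open>4 \<gamma>\<close> at distance \<open>\<rho> / 2\<close> from \<open>\<mu>0\<close>; the passage to the net, the fluctuations and the
  convergence of the mean contrast cost \<open>\<gamma>\<close> each.\<close>
  define \<gamma> where "\<gamma> = l * \<rho>\<^sup>2 / 16"
  have \<gamma>: "\<gamma> > 0" using L pos by (simp add: \<gamma>_def)
  define \<delta> where "\<delta> = min (\<rho> / 2) (\<gamma> / C)"
  have \<delta>: "\<delta> > 0" "\<delta> \<le> \<rho> / 2" "C * \<delta> \<le> \<gamma>"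
    using pos \<gamma> C by (auto simp: \<delta>_def min_def field_simps)
  have "compact (closure \<Theta>)" using \<Theta> by simp
  moreover have "closure \<Theta> \<subseteq> (\<Union>m\<in>\<Theta>. ball m \<delta>)"
  proof
    fix y assume "y \<in> closure \<Theta>"
    then obtain m where "m \<in> \<Theta>" "dist m y < \<delta>" using \<delta>(1) by (auto simp: closure_approachable)
    then show "y \<in> (\<Union>m\<in>\<Theta>. ball m \<delta>)" by auto
  qed
  ultimately obtain T where T: "T \<subseteq> \<Theta>" "finite T" "closure \<Theta> \<subseteq> (\<Union>m\<in>T. ball m \<delta>)"
    using compactE_image[of "closure \<Theta>" \<Theta> "\<lambda>m. ball m \<delta>"] by auto
  define \<epsilon>' where "\<epsilon>' = \<epsilon> / (real (card T) + 1)"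
  have \<epsilon>': "\<epsilon>' > 0" "real (card T) * \<epsilon>' \<le> \<epsilon>" using pos by (auto simp: \<epsilon>'_def field_simps)
  define f where "f m j z = cauchy_loss (z - x j \<bullet> (m - \<mu>0)) - cauchy_loss z" for m j z
  define D where "D m n \<omega> = (\<Sum>j=start..n. f m j (Z j \<omega>) - integral\<^sup>L N (f m j)) / sqrt (real n)" for m n \<omega>
  have f_int: "integral\<^sup>L N (f m j) = mean_contrast (x j \<bullet> (m - \<mu>0))" for m j
    by (simp add: f_def[abs_def] mean_contrast_def)
  have D: "stoch_bounded (D m)" for m
    unfolding D_def
  proof (rule centered_sum_stoch_bounded)
    fix j assume j: "start \<le> j"
    show meas: "f m j \<in> borel_measurable borel" unfolding f_def[abs_def] by measurable
    have le: "(f m j z)\<^sup>2 \<le> (C * norm (m - \<mu>0))\<^sup>2" for z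
    proof -
      have "\<bar>f m j z\<bar> \<le> \<bar>x j \<bullet> (m - \<mu>0)\<bar>"
        unfolding f_def using cauchy_loss_lipschitz[of "z - x j \<bullet> (m - \<mu>0)" z] by simp
      also have "\<dots> \<le> norm (x j) * norm (m - \<mu>0)" by (rule Cauchy_Schwarz_ineq2)
      also have "\<dots> \<le> C * norm (m - \<mu>0)" using x[OF j] by (intro mult_right_mono) auto
      finally have "\<bar>f m j z\<bar>\<^sup>2 \<le> (C * norm (m - \<mu>0))\<^sup>2" by (intro power_mono) auto
      then show ?thesis by simp
    qed
    show i: "integrable N (\<lambda>z. (f m j z)\<^sup>2)"
      by (rule N.integrable_const_bound[where B = "(C * norm (m - \<mu>0))\<^sup>2"]) (use le meas in auto)
    have "(\<integral>z. (f m j z)\<^sup>2 \<partial>N) \<le> (\<integral>z. (C * norm (m - \<mu>0))\<^sup>2 \<partial>N)"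
      by (rule integral_mono[OF i]) (use le in auto)
    then show "(\<integral>z. (f m j z)\<^sup>2 \<partial>N) \<le> (C * norm (m - \<mu>0))\<^sup>2" by (simp add: N.prob_space)
  qed
  have dev: "\<forall>\<^sub>F n in sequentially. \<forall>m\<in>T. likely \<epsilon>' (\<lambda>\<omega>. \<bar>D m n \<omega>\<bar> \<le> \<gamma> * sqrt (real n))"
    using T(2) by (intro eventually_ball_finite ballI
        stoch_bounded_imp_likely_small[OF D \<epsilon>'(1) \<gamma>]) (auto intro: filterlim_compose[OF sqrt_at_top filterlim_real_sequentially])
  have det: "\<forall>\<^sub>F n in sequentially. \<forall>m\<in>T. L m - \<gamma> < (\<Sum>j=start..n. mean_contrast (x j \<bullet> (m - \<mu>0))) / real n"
  proof (intro eventually_ball_finite ballI T(2))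
    fix m assume "m \<in> T"
    then have "m \<in> \<Theta>" using T(1) by auto
    from contrast[OF this] show "\<forall>\<^sub>F n in sequentially. L m - \<gamma> < (\<Sum>j=start..n. mean_contrast (x j \<bullet> (m - \<mu>0))) / real n"
      using \<gamma> by (intro order_tendstoD) auto
  qed
  from dev det min eventually_gt_at_top[of 0] show ?thesis
  proof eventually_elim
    case (elim n)
    have n: "real n > 0" using elim by simp
    have "likely (real (card T) * \<epsilon>') (\<lambda>\<omega>. \<forall>m\<in>T. \<bar>D m n \<omega>\<bar> \<le> \<gamma> * sqrt (real n))"
      using elim(1) by (intro likely_ball T(2)) auto
    then have "likely \<epsilon> (\<lambda>\<omega>. \<forall>m\<in>T. \<bar>D m n \<omega>\<bar> \<le> \<gamma> * sqrt (real n))"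
      using \<epsilon>'(2) by (auto simp: likely_def intro: order_trans)
    then show ?case
    proof (rule likely_mono)
      fix \<omega> assume \<omega>: "\<omega> \<in> space M" and dev: "\<forall>m\<in>T. \<bar>D m n \<omega>\<bar> \<le> \<gamma> * sqrt (real n)"
      show "norm (\<mu>h n \<omega> - \<mu>0) < \<rho>"
      proof (rule ccontr)
        assume "\<not> norm (\<mu>h n \<omega> - \<mu>0) < \<rho>"
        then have far: "\<rho> \<le> norm (\<mu>h n \<omega> - \<mu>0)" by simp
        have cl: "\<mu>h n \<omega> \<in> closure \<Theta>" using elim \<omega> by blast
        then obtain m where m: "m \<in> T" "dist m (\<mu>h n \<omega>) < \<delta>" using T(3) by auto
        have near: "norm (\<mu>h n \<omega> - m) \<le> \<delta>" using m(2) by (simp add: dist_norm norm_minus_commute)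
        have "norm (\<mu>h n \<omega> - \<mu>0) \<le> norm (\<mu>h n \<omega> - m) + norm (m - \<mu>0)"
          using norm_triangle_ineq[of "\<mu>h n \<omega> - m" "m - \<mu>0"] by simp
        then have "\<rho> / 2 \<le> norm (m - \<mu>0)" using far near \<delta>(2) by linarith
        then have "(\<rho> / 2)\<^sup>2 \<le> (norm (m - \<mu>0))\<^sup>2" using pos by (intro power_mono) auto
        then have "l * (\<rho> / 2)\<^sup>2 \<le> l * (norm (m - \<mu>0))\<^sup>2" using L(1) by (intro mult_left_mono) auto
        moreover have "m \<in> \<Theta>" using m T by auto
        ultimately have "l * (\<rho> / 2)\<^sup>2 \<le> L m" using L(2)[of m] by linarith
        then have Lm: "4 * \<gamma> \<le> L m" by (simp add: \<gamma>_def power2_eq_square mult_ac)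
        have "\<bar>\<Sum>j=start..n. f m j (Z j \<omega>) - mean_contrast (x j \<bullet> (m - \<mu>0))\<bar> \<le> \<gamma> * sqrt (real n) * sqrt (real n)"
          using dev m(1) n unfolding D_def f_int by (auto simp: abs_divide divide_le_eq)
        then have a: "\<bar>(\<Sum>j=start..n. f m j (Z j \<omega>)) - (\<Sum>j=start..n. mean_contrast (x j \<bullet> (m - \<mu>0)))\<bar> \<le> \<gamma> * real n"
          by (simp add: sum_subtractf mult.assoc)
        have b: "(L m - \<gamma>) * real n \<le> (\<Sum>j=start..n. mean_contrast (x j \<bullet> (m - \<mu>0)))"
          using elim(2) m(1) n by (simp add: pos_less_divide_eq less_imp_le)
        have "(\<Sum>j=start..n. f m j (Z j \<omega>)) - (\<Sum>j=start..n. f (\<mu>h n \<omega>) j (Z j \<omega>)) \<le> (\<Sum>j=start..n. \<gamma>)"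
          unfolding sum_subtractf[symmetric]
        proof (rule sum_mono)
          fix j assume j: "j \<in> {start..n}"
          have "f m j (Z j \<omega>) - f (\<mu>h n \<omega>) j (Z j \<omega>) \<le> \<bar>x j \<bullet> (\<mu>h n \<omega> - m)\<bar>"
            unfolding f_def using cauchy_loss_lipschitz[of "Z j \<omega> - x j \<bullet> (m - \<mu>0)" "Z j \<omega> - x j \<bullet> (\<mu>h n \<omega> - \<mu>0)"]
            by (simp add: inner_diff_right algebra_simps)
          also have "\<dots> \<le> norm (x j) * norm (\<mu>h n \<omega> - m)" by (rule Cauchy_Schwarz_ineq2)
          also have "\<dots> \<le> C * \<delta>" using x[of j] j near C by (intro mult_mono) auto
          finally show "f m j (Z j \<omega>) - f (\<mu>h n \<omega>) j (Z j \<omega>) \<le> \<gamma>" using \<delta>(3) by linarith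
        qed
        also have "\<dots> \<le> \<gamma> * real n" using start \<gamma> by simp
        finally have c: "(\<Sum>j=start..n. f m j (Z j \<omega>)) - (\<Sum>j=start..n. f (\<mu>h n \<omega>) j (Z j \<omega>)) \<le> \<gamma> * real n" .
        have "(\<Sum>j=start..n. f (\<mu>h n \<omega>) j (Z j \<omega>)) \<le> 0"
          using elim(3) \<omega> unfolding f_def by blast
        then have "(L m - \<gamma>) * real n \<le> 2 * (\<gamma> * real n)" using a b c by linarith
        then have "L m - \<gamma> \<le> 2 * \<gamma>" using n by (simp add: mult.assoc[symmetric])
        then show False using Lm \<gamma> by linarith
      qed
    qed
  qed
qed

text \<open>On the ball given by consistency, the expansion of the loss at a minimiser reads
\<open>\<kappa> c n |h|\<^sup>2 \<le> |h| sqrt n S + |h|\<^sup>2 sqrt n B + n 2 C\<^sup>3 \<rho> |h|\<^sup>2\<close>, with score \<open>S\<close> and fluctuation of the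
curvature \<open>B\<close> both bounded in probability. For large \<open>n\<close> and the chosen \<open>\<rho>\<close> the last two terms take at
most half of the left-hand side.\<close>

theorem cauchy_qmle_root_n:
  fixes x :: "nat \<Rightarrow> real^'q" and \<mu>h :: "nat \<Rightarrow> 'a \<Rightarrow> real^'q"
  assumes start: "1 \<le> start"
    and x: "\<And>j. start \<le> j \<Longrightarrow> norm (x j) \<le> C" and C: "0 < C"
    and gram: "(\<lambda>n. (1 / real n) *\<^sub>R (\<Sum>j=start..n. outer (x j) (x j))) \<longlonglongrightarrow> A" "pos_def A"
    and \<Theta>: "bounded \<Theta>" "open \<Theta>" "\<mu>0 \<in> \<Theta>"
    and contrast: "\<And>\<mu>. \<mu> \<in> \<Theta> \<Longrightarrow> (\<lambda>n. (\<Sum>j=start..n. mean_contrast (x j \<bullet> (\<mu> - \<mu>0))) / real n) \<longlonglongrightarrow> L \<mu>"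
    and L: "0 < l" "\<And>\<mu>. \<mu> \<in> \<Theta> \<Longrightarrow> l * (norm (\<mu> - \<mu>0))\<^sup>2 \<le> L \<mu>"
    and score: "integral\<^sup>L N cauchy_score = 0"
    and min: "\<forall>\<^sub>F n in sequentially. \<forall>\<omega>\<in>space M. \<mu>h n \<omega> \<in> closure \<Theta> \<and>
      (\<Sum>j=start..n. cauchy_loss (Z j \<omega> - x j \<bullet> (\<mu>h n \<omega> - \<mu>0)) - cauchy_loss (Z j \<omega>)) \<le> 0"
  shows "stoch_bounded (\<lambda>n \<omega>. sqrt (real n) * norm (\<mu>h n \<omega> - \<mu>0))"
proof -
  interpret N: prob_space N by (rule prob_space_N)
  define \<kappa> where "\<kappa> = mean_curv"
  have \<kappa>: "\<kappa> > 0" unfolding \<kappa>_def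
    by (rule mean_curv_pos[OF start x C gram \<Theta>(2,3) contrast L score])
  obtain c where c: "0 < c" "\<forall>\<^sub>F n in sequentially. \<forall>h. c * real n * (norm h)\<^sup>2 \<le> (\<Sum>j=start..n. (x j \<bullet> h)\<^sup>2)"
    using gram_coercive[OF gram] by blast
  \<comment> \<open>On this ball the cubic remainder is at most a quarter of the quadratic term.\<close>
  define \<rho> where "\<rho> = \<kappa> * c / (8 * C ^ 3)"
  have \<rho>: "\<rho> > 0" using \<kappa> c C by (simp add: \<rho>_def)
  have comp: "\<bar>x j $ a\<bar> \<le> C" if "start \<le> j" for j a
    using component_le_norm_cart[of "x j" a] x[OF that] by linarith
  define S where "S n \<omega> = (\<Sum>a\<in>UNIV. \<bar>(\<Sum>j=start..n. x j $ a * (cauchy_score (Z j \<omega>) - integral\<^sup>L N cauchy_score)) / sqrt (real n)\<bar>)" for n \<omega>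
  define B where "B n \<omega> = (\<Sum>a\<in>UNIV. \<Sum>b\<in>UNIV. \<bar>(\<Sum>j=start..n. (x j $ a * x j $ b) * (cauchy_curv (Z j \<omega>) - integral\<^sup>L N cauchy_curv)) / sqrt (real n)\<bar>)" for n \<omega>
  have sq_int: "integrable N (\<lambda>z. (cauchy_score z)\<^sup>2)" "integrable N (\<lambda>z. (cauchy_curv z)\<^sup>2)"
    using abs_cauchy_score_le abs_cauchy_curv_le
    by (auto intro!: N.integrable_const_bound[where B = 1] simp: abs_square_le_1)
  have S: "stoch_bounded S" unfolding S_def
    by (intro stoch_bounded_sum stoch_bounded_abs weighted_sum_stoch_bounded[where C = C] sq_int)
      (auto intro: comp)
  have B: "stoch_bounded B" unfolding B_def
  proof (intro stoch_bounded_sum stoch_bounded_abs weighted_sum_stoch_bounded[where C = "C * C"] sq_int)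
    show "\<bar>x j $ a * x j $ b\<bar> \<le> C * C" if "start \<le> j" for j a b
      unfolding abs_mult using comp[OF that] C by (intro mult_mono) auto
  qed auto
  show ?thesis
    unfolding stoch_bounded_def
  proof (intro allI impI)
    fix \<epsilon> :: real assume "\<epsilon> > 0"
    then have \<epsilon>: "\<epsilon> / 3 > 0" by simp
    \<comment> \<open>Three events of probability at least \<open>1 - \<epsilon> / 3\<close>: the score is bounded, the curvature is close to its mean,
    and the minimiser lies in the ball.\<close>
    obtain K where K: "0 < K" "\<forall>\<^sub>F n in sequentially. likely (\<epsilon> / 3) (\<lambda>\<omega>. \<bar>S n \<omega>\<bar> \<le> K)"
      using S \<epsilon> by (rule stoch_boundedE)
    have B_small: "\<forall>\<^sub>F n in sequentially. likely (\<epsilon> / 3) (\<lambda>\<omega>. \<bar>B n \<omega>\<bar> \<le> (\<kappa> * c / 4) * sqrt (real n))"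
      by (rule stoch_bounded_imp_likely_small[OF B \<epsilon>])
        (use \<kappa> c in \<open>auto intro: filterlim_compose[OF sqrt_at_top filterlim_real_sequentially]\<close>)
    have near: "\<forall>\<^sub>F n in sequentially. likely (\<epsilon> / 3) (\<lambda>\<omega>. norm (\<mu>h n \<omega> - \<mu>0) < \<rho>)"
      by (rule cauchy_qmle_consistent[OF start x C \<Theta>(1) contrast L min \<rho> \<epsilon>])
    have "\<forall>\<^sub>F n in sequentially. likely \<epsilon> (\<lambda>\<omega>. \<bar>sqrt (real n) * norm (\<mu>h n \<omega> - \<mu>0)\<bar> \<le> 2 * K / (\<kappa> * c))"
      using K(2) B_small near c(2) min eventually_gt_at_top[of 0]
    proof eventually_elim
      case (elim n)
      have n: "real n > 0" using elim by simp
      have "likely \<epsilon> (\<lambda>\<omega>. (\<bar>S n \<omega>\<bar> \<le> K \<and> \<bar>B n \<omega>\<bar> \<le> (\<kappa> * c / 4) * sqrt (real n)) \<and> norm (\<mu>h n \<omega> - \<mu>0) < \<rho>)"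
        using likely_conj[OF likely_conj[OF elim(1,2)] elim(3)] by simp
      then show ?case
      proof (rule likely_mono)
        fix \<omega> assume \<omega>: "\<omega> \<in> space M"
          and ev: "(\<bar>S n \<omega>\<bar> \<le> K \<and> \<bar>B n \<omega>\<bar> \<le> (\<kappa> * c / 4) * sqrt (real n)) \<and> norm (\<mu>h n \<omega> - \<mu>0) < \<rho>"
        define h where "h = \<mu>h n \<omega> - \<mu>0"
        define H where "H = norm h"
        have H: "0 \<le> H" "H \<le> \<rho>" using ev by (auto simp: H_def h_def)
        have S_n: "S n \<omega> \<le> K" "B n \<omega> \<le> (\<kappa> * c / 4) * sqrt (real n)" using ev by auto
        have sqn: "sqrt (real n) * sqrt (real n) = real n" by simp
        have comp_h: "\<bar>h $ a\<bar> \<le> H" for a unfolding H_def by (rule component_le_norm_cart)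
        have lin: "(\<Sum>j=start..n. cauchy_score (Z j \<omega>) * (x j \<bullet> h)) \<le> H * (sqrt (real n) * S n \<omega>)"
        proof -
          define T where "T a = (\<Sum>j=start..n. x j $ a * cauchy_score (Z j \<omega>))" for a
          have "(\<Sum>j=start..n. cauchy_score (Z j \<omega>) * (x j \<bullet> h)) = (\<Sum>a\<in>UNIV. h $ a * T a)"
            unfolding inner_vec_def T_def sum_distrib_left
            by (subst sum.swap) (simp add: mult_ac)
          also have "\<dots> \<le> (\<Sum>a\<in>UNIV. H * \<bar>T a\<bar>)"
          proof (rule sum_mono)
            fix a
            have "h $ a * T a \<le> \<bar>h $ a\<bar> * \<bar>T a\<bar>" by (metis abs_ge_self abs_mult)
            also have "\<dots> \<le> H * \<bar>T a\<bar>" using comp_h by (intro mult_right_mono) auto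
            finally show "h $ a * T a \<le> H * \<bar>T a\<bar>" .
          qed
          also have "\<dots> = H * (sqrt (real n) * S n \<omega>)"
            unfolding S_def score using n by (simp add: T_def sum_distrib_left)
          finally show ?thesis .
        qed
        have quad: "\<kappa> * (\<Sum>j=start..n. (x j \<bullet> h)\<^sup>2) - H\<^sup>2 * (sqrt (real n) * B n \<omega>)
            \<le> (\<Sum>j=start..n. cauchy_curv (Z j \<omega>) * (x j \<bullet> h)\<^sup>2)"
        proof -
          define T where "T a b = (\<Sum>j=start..n. (x j $ a * x j $ b) * (cauchy_curv (Z j \<omega>) - \<kappa>))" for a b
          have "\<kappa> * (\<Sum>j=start..n. (x j \<bullet> h)\<^sup>2) - (\<Sum>j=start..n. cauchy_curv (Z j \<omega>) * (x j \<bullet> h)\<^sup>2)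
              = - (\<Sum>j=start..n. (cauchy_curv (Z j \<omega>) - \<kappa>) * (x j \<bullet> h)\<^sup>2)"
            by (simp add: left_diff_distrib sum_subtractf sum_distrib_left)
          also have "(\<Sum>j=start..n. (cauchy_curv (Z j \<omega>) - \<kappa>) * (x j \<bullet> h)\<^sup>2) = (\<Sum>a\<in>UNIV. \<Sum>b\<in>UNIV. h $ a * h $ b * T a b)"
          proof -
            have "(cauchy_curv (Z j \<omega>) - \<kappa>) * (x j \<bullet> h)\<^sup>2
              = (\<Sum>a\<in>UNIV. \<Sum>b\<in>UNIV. h $ a * h $ b * ((x j $ a * x j $ b) * (cauchy_curv (Z j \<omega>) - \<kappa>)))" for j
            proof -
              have "x j \<bullet> h = (\<Sum>a\<in>UNIV. x j $ a * h $ a)" by (simp add: inner_vec_def)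
              then have "(cauchy_curv (Z j \<omega>) - \<kappa>) * (x j \<bullet> h)\<^sup>2
                = (\<Sum>a\<in>UNIV. \<Sum>b\<in>UNIV. (cauchy_curv (Z j \<omega>) - \<kappa>) * ((x j $ a * h $ a) * (x j $ b * h $ b)))"
                by (simp only: power2_eq_square sum_product) (simp only: sum_distrib_left)
              also have "\<dots> = (\<Sum>a\<in>UNIV. \<Sum>b\<in>UNIV. h $ a * h $ b * ((x j $ a * x j $ b) * (cauchy_curv (Z j \<omega>) - \<kappa>)))"
                by (intro sum.cong refl) (simp only: mult_ac)
              finally show ?thesis .
            qed
            then have "(\<Sum>j=start..n. (cauchy_curv (Z j \<omega>) - \<kappa>) * (x j \<bullet> h)\<^sup>2)
              = (\<Sum>j=start..n. \<Sum>a\<in>UNIV. \<Sum>b\<in>UNIV. h $ a * h $ b * ((x j $ a * x j $ b) * (cauchy_curv (Z j \<omega>) - \<kappa>)))"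
              by simp
            also have "\<dots> = (\<Sum>a\<in>UNIV. \<Sum>b\<in>UNIV. \<Sum>j=start..n. h $ a * h $ b * ((x j $ a * x j $ b) * (cauchy_curv (Z j \<omega>) - \<kappa>)))"
              by (subst sum.swap) (intro sum.cong refl, rule sum.swap)
            finally show ?thesis by (simp only: T_def sum_distrib_left)
          qed
          also have "- (\<Sum>a\<in>UNIV. \<Sum>b\<in>UNIV. h $ a * h $ b * T a b) \<le> (\<Sum>a\<in>UNIV. \<Sum>b\<in>UNIV. H\<^sup>2 * \<bar>T a b\<bar>)"
            unfolding sum_negf[symmetric]
          proof (intro sum_mono)
            fix a b
            have "- (h $ a * h $ b * T a b) \<le> (\<bar>h $ a\<bar> * \<bar>h $ b\<bar>) * \<bar>T a b\<bar>"
              by (metis abs_ge_minus_self abs_mult)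
            also have "\<dots> \<le> (H * H) * \<bar>T a b\<bar>" using comp_h H by (intro mult_right_mono mult_mono) auto
            finally show "- (h $ a * h $ b * T a b) \<le> H\<^sup>2 * \<bar>T a b\<bar>" by (simp add: power2_eq_square)
          qed
          also have "\<dots> = H\<^sup>2 * (sqrt (real n) * B n \<omega>)"
            unfolding B_def T_def \<kappa>_def mean_curv_def using n by (simp add: sum_distrib_left)
          finally show ?thesis by linarith
        qed
        have cub: "(\<Sum>j=start..n. 2 * \<bar>x j \<bullet> h\<bar> ^ 3) \<le> real n * (2 * C ^ 3 * \<rho> * H\<^sup>2)"
        proof -
          have "(\<Sum>j=start..n. 2 * \<bar>x j \<bullet> h\<bar> ^ 3) \<le> (\<Sum>j=start..n. 2 * C ^ 3 * \<rho> * H\<^sup>2)"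
          proof (rule sum_mono)
            fix j assume j: "j \<in> {start..n}"
            have "\<bar>x j \<bullet> h\<bar> \<le> norm (x j) * H" unfolding H_def by (rule Cauchy_Schwarz_ineq2)
            also have "\<dots> \<le> C * H" using x[of j] j H by (intro mult_right_mono) auto
            finally have "\<bar>x j \<bullet> h\<bar> ^ 3 \<le> (C * H) ^ 3" by (intro power_mono) auto
            also have "\<dots> = C ^ 3 * H * H\<^sup>2" by (simp add: power_mult_distrib power2_eq_square power3_eq_cube)
            also have "\<dots> \<le> C ^ 3 * \<rho> * H\<^sup>2" using C H by (intro mult_right_mono mult_left_mono) auto
            finally show "2 * \<bar>x j \<bullet> h\<bar> ^ 3 \<le> 2 * C ^ 3 * \<rho> * H\<^sup>2" by simp
          qed
          also have "\<dots> \<le> real n * (2 * C ^ 3 * \<rho> * H\<^sup>2)"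
            using start C \<rho> by (simp only: sum_constant) (intro mult_right_mono, auto)
          finally show ?thesis .
        qed
        have "0 \<ge> (\<Sum>j=start..n. cauchy_loss (Z j \<omega> - x j \<bullet> h) - cauchy_loss (Z j \<omega>))"
          using elim(5) \<omega> unfolding h_def by blast
        moreover have "(\<Sum>j=start..n. cauchy_curv (Z j \<omega>) * (x j \<bullet> h)\<^sup>2) - (\<Sum>j=start..n. cauchy_score (Z j \<omega>) * (x j \<bullet> h))
            - (\<Sum>j=start..n. 2 * \<bar>x j \<bullet> h\<bar> ^ 3)
            \<le> (\<Sum>j=start..n. cauchy_loss (Z j \<omega> - x j \<bullet> h) - cauchy_loss (Z j \<omega>))"
          unfolding sum_subtractf[symmetric]
        proof (rule sum_mono)
          show "cauchy_curv (Z j \<omega>) * (x j \<bullet> h)\<^sup>2 - cauchy_score (Z j \<omega>) * (x j \<bullet> h) - 2 * \<bar>x j \<bullet> h\<bar> ^ 3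
            \<le> cauchy_loss (Z j \<omega> - x j \<bullet> h) - cauchy_loss (Z j \<omega>)" for j
            using cauchy_loss_taylor[of "Z j \<omega>" "x j \<bullet> h"] by (simp add: abs_le_iff)
        qed
        ultimately have main: "\<kappa> * (\<Sum>j=start..n. (x j \<bullet> h)\<^sup>2) \<le> H * (sqrt (real n) * S n \<omega>)
            + H\<^sup>2 * (sqrt (real n) * B n \<omega>) + real n * (2 * C ^ 3 * \<rho> * H\<^sup>2)"
          using lin quad cub by linarith
        have "\<kappa> * (c * real n * H\<^sup>2) \<le> \<kappa> * (\<Sum>j=start..n. (x j \<bullet> h)\<^sup>2)"
          using elim(4) \<kappa> unfolding H_def by (intro mult_left_mono) auto
        moreover have "H * (sqrt (real n) * S n \<omega>) \<le> H * (sqrt (real n) * K)"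
          using S_n H by (intro mult_left_mono) auto
        moreover have "H\<^sup>2 * (sqrt (real n) * B n \<omega>) \<le> (\<kappa> * c / 4) * real n * H\<^sup>2"
        proof -
          have "sqrt (real n) * B n \<omega> \<le> sqrt (real n) * ((\<kappa> * c / 4) * sqrt (real n))"
            using S_n by (intro mult_left_mono) auto
          also have "\<dots> = (\<kappa> * c / 4) * real n" using sqn by (metis mult.assoc mult.commute)
          finally have "H\<^sup>2 * (sqrt (real n) * B n \<omega>) \<le> H\<^sup>2 * ((\<kappa> * c / 4) * real n)"
            by (rule mult_left_mono) simp
          then show ?thesis by (simp only: mult_ac)
        qed
        moreover have "real n * (2 * C ^ 3 * \<rho> * H\<^sup>2) = (\<kappa> * c / 4) * real n * H\<^sup>2"
          using C by (simp add: \<rho>_def field_simps)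
        moreover have "\<kappa> * (c * real n * H\<^sup>2) = 4 * ((\<kappa> * c / 4) * real n * H\<^sup>2)" by simp
        ultimately have key: "2 * ((\<kappa> * c / 4) * real n * H\<^sup>2) \<le> H * (sqrt (real n) * K)"
          using main by linarith
        have "sqrt (real n) * H \<le> 2 * K / (\<kappa> * c)"
        proof (cases "H = 0")
          case True then show ?thesis using K \<kappa> c by simp
        next
          case False
          then have Hp: "H > 0" "sqrt (real n) > 0" using H n by auto
          have eq: "2 * ((\<kappa> * c / 4) * real n * H\<^sup>2) = (H * sqrt (real n)) * ((\<kappa> * c / 2) * (sqrt (real n) * H))"
            by (subst sqn[symmetric]) (simp add: power2_eq_square)
          have "(H * sqrt (real n)) * ((\<kappa> * c / 2) * (sqrt (real n) * H)) \<le> (H * sqrt (real n)) * K"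
            using key unfolding eq by (simp only: mult.assoc)
          then have "(\<kappa> * c / 2) * (sqrt (real n) * H) \<le> K" using Hp by (simp add: mult_le_cancel_left_pos)
          then show ?thesis using \<kappa> c by (simp add: field_simps)
        qed
        then show "\<bar>sqrt (real n) * norm (\<mu>h n \<omega> - \<mu>0)\<bar> \<le> 2 * K / (\<kappa> * c)"
          by (simp add: H_def h_def)
      qed
    qed
    moreover have "2 * K / (\<kappa> * c) > 0" using K \<kappa> c by simp
    ultimately show "\<exists>K>0. \<forall>\<^sub>F n in sequentially. likely \<epsilon> (\<lambda>\<omega>. \<bar>sqrt (real n) * norm (\<mu>h n \<omega> - \<mu>0)\<bar> \<le> K)"
      by blast
  qed
qed

end

section \<open>Inverting the moment equations\<close>

text \<open>Lipschitz at the point \<open>x\<close> itself, not between nearby points. This is all that a rate requires, it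
is stable under composition, and it applies to \<open>beta_denom\<close> at \<open>1\<close>, which is defined there by its limit.\<close>

definition calm_at :: "('a::real_normed_vector \<Rightarrow> 'b::real_normed_vector) \<Rightarrow> 'a \<Rightarrow> bool" where
  "calm_at f x \<longleftrightarrow> (\<exists>C. \<forall>\<^sub>F y in nhds x. norm (f y - f x) \<le> C * norm (y - x))"

lemma calm_at_isCont:
  assumes "calm_at f x"
  shows "filterlim f (nhds (f x)) (nhds x)"
proof -
  obtain C where "\<forall>\<^sub>F y in nhds x. norm (f y - f x) \<le> C * norm (y - x)"
    using assms by (auto simp: calm_at_def)
  moreover have "((\<lambda>y. C * norm (y - x)) \<longlongrightarrow> C * norm (x - x)) (nhds x)"
    by (intro tendsto_intros filterlim_ident)
  ultimately have "((\<lambda>y. f y - f x) \<longlongrightarrow> 0) (nhds x)"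
    by (intro Lim_null_comparison[of "\<lambda>y. f y - f x" "\<lambda>y. C * norm (y - x)"]) auto
  then show ?thesis by (simp add: LIM_zero_iff)
qed

lemma calm_at_has_derivative:
  assumes "(f has_derivative D) (at x)"
  shows "calm_at f x"
proof -
  have bl: "bounded_linear D" and
    d: "\<And>e. e > 0 \<Longrightarrow> \<exists>d>0. \<forall>y. norm (y - x) < d \<longrightarrow> norm (f y - f x - D (y - x)) \<le> e * norm (y - x)"
    using assms by (auto simp: has_derivative_at_alt)
  obtain K where K: "\<And>y. norm (D y) \<le> norm y * K" using bounded_linear.bounded[OF bl] by blast
  obtain d where d: "d > 0" "\<And>y. norm (y - x) < d \<Longrightarrow> norm (f y - f x - D (y - x)) \<le> norm (y - x)"
    using d[of 1] by auto
  have "norm (f y - f x) \<le> (1 + K) * norm (y - x)" if "dist y x < d" for y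
  proof -
    have "norm (f y - f x) \<le> norm (f y - f x - D (y - x)) + norm (D (y - x))"
      using norm_triangle_ineq[of "f y - f x - D (y - x)" "D (y - x)"] by simp
    then show ?thesis using d(2)[of y] K[of "y - x"] that by (simp add: dist_norm algebra_simps)
  qed
  then show ?thesis unfolding calm_at_def eventually_nhds_metric using d(1) by blast
qed

lemma calm_at_compose:
  assumes g: "calm_at g (f x)" and f: "calm_at f x"
  shows "calm_at (\<lambda>y. g (f y)) x"
proof -
  obtain C where C: "\<forall>\<^sub>F y in nhds x. norm (f y - f x) \<le> C * norm (y - x)"
    using f by (auto simp: calm_at_def)
  obtain L where L: "\<forall>\<^sub>F z in nhds (f x). norm (g z - g (f x)) \<le> L * norm (z - f x)"
    using g by (auto simp: calm_at_def)
  have "\<forall>\<^sub>F y in nhds x. norm (g (f y) - g (f x)) \<le> L * norm (f y - f x)"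
    using eventually_compose_filterlim[OF L calm_at_isCont[OF f]] .
  with C have "\<forall>\<^sub>F y in nhds x. norm (g (f y) - g (f x)) \<le> (\<bar>L\<bar> * C) * norm (y - x)"
  proof eventually_elim
    case (elim y)
    have "L * norm (f y - f x) \<le> \<bar>L\<bar> * norm (f y - f x)" by (intro mult_right_mono) auto
    also have "\<dots> \<le> \<bar>L\<bar> * (C * norm (y - x))" using elim by (intro mult_left_mono) auto
    finally show ?case using elim by (simp add: mult.assoc)
  qed
  then show ?thesis unfolding calm_at_def by blast
qed

lemma calm_at_Pair:
  assumes "calm_at f x" "calm_at g x"
  shows "calm_at (\<lambda>y. (f y, g y)) x"
proof -
  obtain C L where C: "\<forall>\<^sub>F y in nhds x. norm (f y - f x) \<le> C * norm (y - x)"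
    and L: "\<forall>\<^sub>F y in nhds x. norm (g y - g x) \<le> L * norm (y - x)"
    using assms by (auto simp: calm_at_def)
  from C L have "\<forall>\<^sub>F y in nhds x. norm ((f y, g y) - (f x, g x)) \<le> (C + L) * norm (y - x)"
  proof eventually_elim
    case (elim y)
    have "norm ((f y, g y) - (f x, g x)) \<le> norm (f y - f x) + norm (g y - g x)"
      using norm_Pair_le[of "f y - f x" "g y - g x"] by simp
    with elim show ?case by (simp add: distrib_right)
  qed
  then show ?thesis unfolding calm_at_def by blast
qed

lemma calm_at_const [intro]: "calm_at (\<lambda>_. c) x"
  by (rule calm_at_has_derivative[OF has_derivative_const])

lemma calm_at_fst: "calm_at fst x"
  by (rule calm_at_has_derivative[OF has_derivative_fst[OF has_derivative_ident]])

lemma calm_at_snd: "calm_at snd x"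
  by (rule calm_at_has_derivative[OF has_derivative_snd[OF has_derivative_ident]])

lemma calm_at_DERIV:
  assumes "(g has_real_derivative D) (at (f x))" "calm_at f x"
  shows "calm_at (\<lambda>y. g (f y)) x"
  by (rule calm_at_compose[OF calm_at_has_derivative assms(2)])
    (use assms(1) in \<open>simp add: has_field_derivative_def\<close>)

lemma calm_at_add:
  assumes "calm_at f x" "calm_at g x"
  shows "calm_at (\<lambda>y. f y + g y) x"
proof -
  have "calm_at (\<lambda>p. fst p + snd p) (f x, g x)"
    by (rule calm_at_has_derivative) (rule derivative_intros)+
  from calm_at_compose[OF this calm_at_Pair[OF assms]] show ?thesis by simp
qed

lemma calm_at_ident: "calm_at (\<lambda>x. x) x"
  by (rule calm_at_has_derivative[OF has_derivative_ident])

lemma calm_at_diff: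
  assumes "calm_at f x" "calm_at g x"
  shows "calm_at (\<lambda>y. f y - g y) x"
proof -
  have "calm_at (\<lambda>p. fst p - snd p) (f x, g x)"
    by (rule calm_at_has_derivative) (rule derivative_intros)+
  from calm_at_compose[OF this calm_at_Pair[OF assms]] show ?thesis by simp
qed

lemma calm_at_sin:
  fixes f :: "'a::real_normed_vector \<Rightarrow> real"
  shows "calm_at f x \<Longrightarrow> calm_at (\<lambda>y. sin (f y)) x"
  by (rule calm_at_DERIV[OF DERIV_sin])

lemma calm_at_cos:
  fixes f :: "'a::real_normed_vector \<Rightarrow> real"
  shows "calm_at f x \<Longrightarrow> calm_at (\<lambda>y. cos (f y)) x"
  by (rule calm_at_DERIV[OF DERIV_cos])

lemma calm_at_mult:
  fixes f g :: "'a::real_normed_vector \<Rightarrow> real"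
  assumes "calm_at f x" "calm_at g x"
  shows "calm_at (\<lambda>y. f y * g y) x"
proof -
  have "calm_at (\<lambda>p. fst p * snd p) (f x, g x)"
    by (rule calm_at_has_derivative) (rule derivative_intros)+
  from calm_at_compose[OF this calm_at_Pair[OF assms]] show ?thesis by simp
qed

lemma calm_at_divide:
  fixes f g :: "'a::real_normed_vector \<Rightarrow> real"
  assumes "calm_at f x" "calm_at g x" "g x \<noteq> 0"
  shows "calm_at (\<lambda>y. f y / g y) x"
proof -
  have "calm_at (\<lambda>y. inverse (g y)) x"
    using assms by (intro calm_at_DERIV[OF DERIV_inverse]) auto
  from calm_at_mult[OF assms(1) this] show ?thesis by (simp add: divide_inverse)
qed

lemma calm_at_powr_const:
  fixes f :: "'a::real_normed_vector \<Rightarrow> real"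
  assumes "calm_at f x" "f x > 0"
  shows "calm_at (\<lambda>y. f y powr s) x"
  using assms by (intro calm_at_DERIV[OF has_real_derivative_powr]) auto

lemma calm_at_const_powr:
  fixes f :: "'a::real_normed_vector \<Rightarrow> real"
  assumes "calm_at f x" "c > 0"
  shows "calm_at (\<lambda>y. c powr f y) x"
proof (rule calm_at_DERIV[OF _ assms(1)])
  show "((\<lambda>z. c powr z) has_real_derivative ln c * c powr f x) (at (f x))"
    using assms(2) by (auto intro!: derivative_eq_intros)
qed

lemma calm_atE:
  assumes "calm_at f x"
  obtains \<rho> C where "0 < \<rho>" "0 \<le> C" "\<And>y. norm (y - x) \<le> \<rho> \<Longrightarrow> norm (f y - f x) \<le> C * norm (y - x)"
proof -
  obtain C d where d: "d > 0" "\<And>y. dist y x < d \<Longrightarrow> norm (f y - f x) \<le> C * norm (y - x)"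
    using assms unfolding calm_at_def eventually_nhds_metric by blast
  show thesis
  proof (rule that[of "d / 2" "\<bar>C\<bar>"])
    fix y assume "norm (y - x) \<le> d / 2"
    then have "norm (f y - f x) \<le> C * norm (y - x)" using d by (intro d(2)) (simp add: dist_norm)
    also have "\<dots> \<le> \<bar>C\<bar> * norm (y - x)" by (intro mult_right_mono) auto
    finally show "norm (f y - f x) \<le> \<bar>C\<bar> * norm (y - x)" .
  qed (use d in auto)
qed

text \<open>The derivative makes \<open>g\<close> cross the level \<open>y\<close> within \<open>2 |y - g x0| / c\<close> of \<open>x0\<close>, and strict
monotonicity excludes solutions elsewhere in the interval, however far they might be.\<close>

lemma strict_mono_inverse_calm:
  fixes g :: "real \<Rightarrow> real"
  assumes x0: "l < x0" "x0 < u" and cont: "continuous_on {l<..<u} g"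
    and mono: "\<And>x y. l < x \<Longrightarrow> x < y \<Longrightarrow> y < u \<Longrightarrow> g x < g y"
    and deriv: "(g has_real_derivative c) (at x0)" and c: "0 < c"
  shows "\<exists>\<rho> C. 0 < \<rho> \<and> 0 \<le> C \<and>
    (\<forall>y. \<bar>y - g x0\<bar> \<le> \<rho> \<longrightarrow> (\<exists>x. l < x \<and> x < u \<and> g x = y)) \<and>
    (\<forall>x. l < x \<longrightarrow> x < u \<longrightarrow> \<bar>g x - g x0\<bar> \<le> \<rho> \<longrightarrow> \<bar>x - x0\<bar> \<le> C * \<bar>g x - g x0\<bar>)"
proof -
  have "(g has_derivative (*) c) (at x0)" using deriv by (simp add: has_field_derivative_def)
  then obtain d where d: "d > 0"
      "\<And>y. norm (y - x0) < d \<Longrightarrow> norm (g y - g x0 - c * (y - x0)) \<le> c / 2 * norm (y - x0)"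
    using half_gt_zero[OF c] unfolding has_derivative_at_alt by blast
  define \<delta> where "\<delta> = min (d / 2) (min ((x0 - l) / 2) ((u - x0) / 2))"
  have \<delta>: "\<delta> > 0" "\<delta> < d" "l < x0 - \<delta>" "x0 + \<delta> < u"
    using d(1) x0 by (auto simp: \<delta>_def min_def field_simps)
  have up: "g (x0 + h) \<ge> g x0 + c / 2 * h" if "0 \<le> h" "h \<le> \<delta>" for h
  proof -
    have "\<bar>g (x0 + h) - g x0 - c * h\<bar> \<le> c / 2 * h" using d(2)[of "x0 + h"] that \<delta> by simp
    moreover have "c * h = 2 * (c / 2 * h)" by simp
    ultimately show ?thesis by linarith
  qed
  have dn: "g (x0 - h) \<le> g x0 - c / 2 * h" if "0 \<le> h" "h \<le> \<delta>" for h
  proof -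
    have "\<bar>g (x0 - h) - g x0 + c * h\<bar> \<le> c / 2 * h" using d(2)[of "x0 - h"] that \<delta> by simp
    moreover have "c * h = 2 * (c / 2 * h)" by simp
    ultimately show ?thesis by linarith
  qed
  have ex: "\<exists>x. x0 - h \<le> x \<and> x \<le> x0 + h \<and> g x = y"
    if "h = 2 * \<bar>y - g x0\<bar> / c" "h \<le> \<delta>" for y h
  proof -
    have h0: "h \<ge> 0" using that c by simp
    have ch: "c / 2 * h = \<bar>y - g x0\<bar>" using that c by simp
    show ?thesis
    proof (rule IVT')
      show "g (x0 - h) \<le> y" using dn[OF h0 that(2)] ch by linarith
      show "y \<le> g (x0 + h)" using up[OF h0 that(2)] ch by linarith
      show "continuous_on {x0 - h..x0 + h} g"
        using cont by (rule continuous_on_subset) (use \<delta> that h0 in auto)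
    qed (use h0 in auto)
  qed
  show ?thesis
  proof (rule exI[of _ "c / 2 * \<delta>"], rule exI[of _ "2 / c"], intro conjI allI impI)
    have small: "2 * \<bar>y - g x0\<bar> / c \<le> \<delta>" if "\<bar>y - g x0\<bar> \<le> c / 2 * \<delta>" for y
      using that c by (simp add: field_simps)
    show "\<exists>x. l < x \<and> x < u \<and> g x = y" if y: "\<bar>y - g x0\<bar> \<le> c / 2 * \<delta>" for y
    proof -
      obtain x where x: "x0 - 2 * \<bar>y - g x0\<bar> / c \<le> x" "x \<le> x0 + 2 * \<bar>y - g x0\<bar> / c" "g x = y"
        using ex[OF refl small[OF y]] by blast
      then have "l < x" "x < u" using small[OF y] \<delta> by linarith+
      with x(3) show ?thesis by blast
    qed
    fix x assume x: "l < x" "x < u" "\<bar>g x - g x0\<bar> \<le> c / 2 * \<delta>"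
    obtain z where z: "x0 - 2 * \<bar>g x - g x0\<bar> / c \<le> z" "z \<le> x0 + 2 * \<bar>g x - g x0\<bar> / c" "g z = g x"
      using ex[OF refl small[OF x(3)]] by blast
    then have "l < z" "z < u" using small[OF x(3)] \<delta> by linarith+
    then have "z = x" using mono[of z x] mono[of x z] x z(3) by (cases z x rule: linorder_cases) auto
    then show "\<bar>x - x0\<bar> \<le> 2 / c * \<bar>g x - g x0\<bar>" using z by (simp add: abs_le_iff)
  qed (use c \<delta> in auto)
qed

text \<open>The logarithm of the part of \<open>h\<^sub>r\<^sup>2 / h\<^sub>2\<^sub>r\<close> that depends on \<open>\<alpha>\<close>; the scale cancels, and the rest is the
constant defined below.\<close>

definition log_ratio :: "real \<Rightarrow> real \<Rightarrow> real" where
  "log_ratio r \<alpha> = 2 * ln_Gamma (1 - r / \<alpha>) - ln_Gamma (1 - 2 * r / \<alpha>)"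

text \<open>The derivative is a positive multiple of a difference of two values of the Digamma function, which
is strictly increasing.\<close>

lemma log_ratio_deriv:
  assumes "0 < r" "2 * r < \<alpha>"
  shows "\<exists>c>0. (log_ratio r has_real_derivative c) (at \<alpha>)"
proof -
  have \<alpha>: "\<alpha> > 0" using assms by linarith
  have pos: "0 < 1 - 2 * r / \<alpha>" "1 - 2 * r / \<alpha> < 1 - r / \<alpha>" using assms \<alpha> by (auto simp: field_simps)
  then have pos': "0 < 1 - r / \<alpha>" by linarith
  define c where "c = 2 * r / \<alpha>\<^sup>2 * (Digamma (1 - r / \<alpha>) - Digamma (1 - 2 * r / \<alpha>))"
  have "c > 0" using Digamma_real_strict_mono[OF pos] assms \<alpha> by (simp add: c_def)
  moreover have "(log_ratio r has_real_derivative c) (at \<alpha>)"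
    unfolding log_ratio_def[abs_def] c_def using pos pos' \<alpha>
    by (auto intro!: derivative_eq_intros simp: power2_eq_square algebra_simps)
  ultimately show ?thesis by blast
qed

definition ratio_const :: "real \<Rightarrow> real" where
  "ratio_const r = cos (r * pi) * Gamma (1 - 2 * r) / (cos (r * pi / 2) * Gamma (1 - r))\<^sup>2"

lemma h_mom_pos:
  assumes "0 < s" "s < \<alpha>" "s < 1" "0 < \<sigma>"
  shows "0 < h_mom s \<alpha> \<sigma>"
proof -
  have "s * pi / 2 < pi / 2" using assms by simp
  then have "cos (s * pi / 2) > 0"
    using assms by (intro cos_gt_zero) auto
  moreover have "Gamma (1 - s / \<alpha>) > 0" "Gamma (1 - s) > 0"
    using assms by (auto intro!: Gamma_real_pos)
  ultimately show ?thesis using assms by (simp add: h_mom_def)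
qed

lemma ratio_const_pos:
  assumes "0 < r" "r < 1 / 2"
  shows "0 < ratio_const r"
proof -
  have "r * pi < pi / 2" using assms by simp
  then have "cos (r * pi) > 0" "cos (r * pi / 2) > 0"
    using assms by (auto intro!: cos_gt_zero)
  moreover have "Gamma (1 - 2 * r) > 0" "Gamma (1 - r) > 0"
    using assms by (auto intro!: Gamma_real_pos)
  ultimately show ?thesis by (simp add: ratio_const_def)
qed

lemma h_mom_ratio:
  assumes "0 < r" "2 * r < \<alpha>" "r < 1 / 2" "0 < \<sigma>"
  shows "(h_mom r \<alpha> \<sigma>)\<^sup>2 / h_mom (2 * r) \<alpha> \<sigma> = ratio_const r * exp (log_ratio r \<alpha>)"
proof -
  have \<alpha>: "\<alpha> > 0" using assms by linarith
  have pos: "0 < 1 - 2 * r / \<alpha>" "0 < 1 - r / \<alpha>" using assms \<alpha> by (auto simp: field_simps)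
  have g: "Gamma (1 - 2 * r / \<alpha>) > 0" "Gamma (1 - r / \<alpha>) > 0" "Gamma (1 - 2 * r) > 0" "Gamma (1 - r) > 0"
    using assms pos by (auto intro!: Gamma_real_pos)
  have e: "exp (log_ratio r \<alpha>) = (Gamma (1 - r / \<alpha>))\<^sup>2 / Gamma (1 - 2 * r / \<alpha>)"
    unfolding log_ratio_def exp_diff using pos g
    by (simp add: ln_Gamma_real_pos exp_double)
  have s: "(\<sigma> powr r)\<^sup>2 = \<sigma> powr (2 * r)" "(2 powr (r / \<alpha>))\<^sup>2 = 2 powr (2 * r / \<alpha>)"
    by (simp_all add: power2_eq_square powr_add[symmetric])
  have c: "cos (2 * r * pi / 2) = cos (r * pi)" by simp
  have nz: "\<sigma> powr (2 * r) \<noteq> 0" "(2::real) powr (2 * r / \<alpha>) \<noteq> 0" using assms by auto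
  have gen: "(S * (G1 / G2) * (P / c1))\<^sup>2 / (S2 * (G3 / G4) * (P2 / c2)) = c2 * G4 / (c1 * G2)\<^sup>2 * (G1\<^sup>2 / G3)"
    if "S\<^sup>2 = S2" "P\<^sup>2 = P2" "S2 \<noteq> 0" "P2 \<noteq> 0" for S G1 G2 P c1 S2 G3 G4 P2 c2 :: real
    using that by (auto simp: power_mult_distrib power_divide mult_ac)
  show ?thesis
    unfolding h_mom_def c e ratio_const_def
    by (rule gen[OF s nz])
qed


lemma calm_at_cong:
  assumes "\<forall>\<^sub>F y in nhds x. f y = g y" "calm_at f x"
  shows "calm_at g x"
proof -
  have "f x = g x" using assms(1) by (rule eventually_nhds_x_imp_x)
  moreover obtain C where "\<forall>\<^sub>F y in nhds x. norm (f y - f x) \<le> C * norm (y - x)"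
    using assms(2) by (auto simp: calm_at_def)
  ultimately have "\<forall>\<^sub>F y in nhds x. norm (g y - g x) \<le> C * norm (y - x)"
    using assms(1) by (auto elim: eventually_elim2)
  then show ?thesis unfolding calm_at_def by blast
qed

lemma beta_denom_nonzero:
  assumes "0 < \<alpha>" "\<alpha> < 2"
  shows "beta_denom \<alpha> \<noteq> 0"
proof (cases "\<alpha> = 1")
  case False
  define x where "x = \<alpha> * pi / 2"
  have x: "0 < x" "x < pi" "x \<noteq> pi / 2" using assms False by (auto simp: x_def)
  have "cos x \<noteq> cos (pi / 2)"
    using x cos_inj_pi[of x "pi / 2"] by auto
  then have "tan x \<noteq> 0" using sin_gt_zero[OF x(1,2)] by (simp add: tan_def)
  moreover have "2 powr \<alpha> \<noteq> (2 :: real) powr 1"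
    using False powr_inj[of 2 \<alpha> 1] by simp
  ultimately show ?thesis using False by (simp add: beta_denom_def x_def)
qed (simp add: beta_denom_def)

text \<open>With \<open>y = 1 + t\<close> the difference to the limit is \<open>N t / (\<pi> sin (\<pi> t / 2))\<close>, where \<open>N\<close> vanishes to
second order at \<open>0\<close> while the sine vanishes only to first order.\<close>

lemma calm_at_beta_denom_1: "calm_at beta_denom 1"
proof -
  define N where "N t = 2 * pi * ((2 powr t - 1) * cos (pi * t / 2)) - 4 * ln 2 * sin (pi * t / 2)" for t :: real
  define N' where "N' t = 2 * pi * (ln 2 * 2 powr t * cos (pi * t / 2) - (2 powr t - 1) * (pi / 2 * sin (pi * t / 2)))
      - 4 * ln 2 * (pi / 2 * cos (pi * t / 2))" for t :: real
  have dN: "(N has_real_derivative N' t) (at t)" for t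
    unfolding N_def N'_def by (auto intro!: derivative_eq_intros simp: field_simps)
  have "calm_at N' 0"
    unfolding N'_def
    by (intro calm_at_diff calm_at_mult calm_at_const_powr calm_at_sin calm_at_cos
        calm_at_divide calm_at_const calm_at_ident) auto
  then obtain \<rho> C where \<rho>: "0 < \<rho>" "0 \<le> C" "\<And>t. norm (t - 0) \<le> \<rho> \<Longrightarrow> norm (N' t - N' 0) \<le> C * norm (t - 0)"
    by (rule calm_atE) blast
  have N'0: "N' 0 = 0" by (simp add: N'_def)
  have N_bound: "\<bar>N t\<bar> \<le> C * \<bar>t\<bar> * \<bar>t\<bar>" if "\<bar>t\<bar> \<le> \<rho>" for t
  proof -
    have "norm (N t - N 0) \<le> (C * \<bar>t\<bar>) * norm (t - 0)"
    proof (rule field_differentiable_bound[where S = "cball 0 \<bar>t\<bar>" and f' = N'])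
      show "norm (N' x) \<le> C * \<bar>t\<bar>" if "x \<in> cball 0 \<bar>t\<bar>" for x
      proof -
        have "norm (N' x) \<le> C * \<bar>x\<bar>" using \<rho>(3)[of x] that \<open>\<bar>t\<bar> \<le> \<rho>\<close> by (simp add: N'0)
        also have "\<dots> \<le> C * \<bar>t\<bar>" using that \<rho>(2) by (intro mult_left_mono) auto
        finally show ?thesis .
      qed
    qed (auto intro: has_field_derivative_at_within dN)
    then show ?thesis by (simp add: N_def)
  qed
  have "((\<lambda>t. sin (pi * t / 2)) has_real_derivative pi / 2) (at 0)"
    by (auto intro!: derivative_eq_intros)
  then have "((\<lambda>t. sin (pi * t / 2)) has_derivative (*) (pi / 2)) (at 0)"
    by (simp add: has_field_derivative_def)
  moreover have "(1 / 2 :: real) > 0" by simp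
  ultimately obtain d where d: "d > 0"
    "\<And>t. norm (t - 0) < d \<Longrightarrow> norm (sin (pi * t / 2) - sin (pi * 0 / 2) - pi / 2 * (t - 0)) \<le> 1 / 2 * norm (t - 0)"
    unfolding has_derivative_at_alt by blast
  have sin_bound: "\<bar>t\<bar> / 2 \<le> \<bar>sin (pi * t / 2)\<bar>" if "\<bar>t\<bar> < d" for t
  proof -
    have "\<bar>sin (pi * t / 2) - pi / 2 * t\<bar> \<le> \<bar>t\<bar> / 2" using d(2)[of t] that by simp
    moreover have "\<bar>pi / 2 * t\<bar> \<ge> \<bar>t\<bar>"
    proof -
      have "1 * \<bar>t\<bar> \<le> pi / 2 * \<bar>t\<bar>" using pi_ge_two by (intro mult_right_mono) auto
      then show ?thesis by (simp add: abs_mult)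
    qed
    ultimately show ?thesis by linarith
  qed
  have "norm (beta_denom y - beta_denom 1) \<le> (2 * C / pi) * norm (y - 1)" if y: "dist y 1 < min d \<rho>" for y
  proof (cases "y = 1")
    case False
    define t where "t = y - 1"
    have t: "t \<noteq> 0" "\<bar>t\<bar> < d" "\<bar>t\<bar> \<le> \<rho>" using False y by (auto simp: t_def dist_real_def)
    define S where "S = sin (pi * t / 2)"
    have S: "\<bar>t\<bar> / 2 \<le> \<bar>S\<bar>" using sin_bound[OF t(2)] by (simp add: S_def)
    have S0: "S \<noteq> 0" using S t by auto
    have tan: "tan (y * pi / 2) = - cos (pi * t / 2) / S"
    proof -
      have "y * pi / 2 = pi * t / 2 + pi / 2" by (simp add: t_def field_simps)
      then show ?thesis unfolding tan_def by (simp only: sin_add cos_add S_def) simp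
    qed
    have pw: "2 powr y = 2 * 2 powr t" by (simp add: t_def powr_diff)
    have "beta_denom y - beta_denom 1 = N t / (pi * S)"
    proof -
      have gen: "(2 - 2 * P) * (- c / S) - 4 / p * L = (2 * p * ((P - 1) * c) - 4 * L * S) / (p * S)"
        if "p \<noteq> 0" for P c p L :: real
      proof -
        have "(2 - 2 * P) * (- c / S) = (2 * ((P - 1) * c)) / S"
          unfolding times_divide_eq_right by (rule arg_cong[of _ _ "\<lambda>w. w / S"]) (simp add: algebra_simps)
        moreover have "4 / p * L = (4 * L) / p" by simp
        ultimately show ?thesis
          by (simp only: diff_frac_eq[OF S0 that]) (simp add: mult_ac)
      qed
      have "beta_denom y = (2 - 2 * 2 powr t) * (- cos (pi * t / 2) / S)"
        using False unfolding beta_denom_def tan pw by simp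
      moreover have "beta_denom 1 = 4 / pi * ln 2" by (simp add: beta_denom_def)
      moreover have "N t = 2 * pi * ((2 powr t - 1) * cos (pi * t / 2)) - 4 * ln 2 * S"
        unfolding N_def S_def ..
      ultimately show ?thesis using gen[of pi "2 powr t" "cos (pi * t / 2)" "ln 2"] by simp
    qed
    also have "\<bar>\<dots>\<bar> = \<bar>N t\<bar> / (pi * \<bar>S\<bar>)" by (simp add: abs_mult)
    also have "\<dots> \<le> (C * \<bar>t\<bar> * \<bar>t\<bar>) / (pi * (\<bar>t\<bar> / 2))"
      using N_bound[OF t(3)] S t \<rho>(2) by (intro frac_le mult_left_mono) auto
    also have "\<dots> = (2 * C / pi) * \<bar>t\<bar>" using t by (simp add: field_simps)
    finally show ?thesis by (simp add: t_def)
  qed simp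
  then show ?thesis unfolding calm_at_def eventually_nhds_metric
    using d(1) \<rho>(1) by (intro exI[of _ "2 * C / pi"] exI[of _ "min d \<rho>"]) auto
qed

lemma calm_at_beta_denom:
  assumes "0 < \<alpha>" "\<alpha> < 2"
  shows "calm_at beta_denom \<alpha>"
proof (cases "\<alpha> = 1")
  case False
  have "cos (\<alpha> * pi / 2) \<noteq> 0"
    using assms False cos_inj_pi[of "\<alpha> * pi / 2" "pi / 2"] by auto
  then have "((\<lambda>a. (2 - 2 powr a) * tan (a * pi / 2)) has_real_derivative
      (- (ln 2 * 2 powr \<alpha>) * tan (\<alpha> * pi / 2) + inverse ((cos (\<alpha> * pi / 2))\<^sup>2) * (pi / 2) * (2 - 2 powr \<alpha>))) (at \<alpha>)"
    by (auto intro!: derivative_eq_intros)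
  then have calm: "calm_at (\<lambda>a. (2 - 2 powr a) * tan (a * pi / 2)) \<alpha>"
    by (intro calm_at_has_derivative) (auto simp: has_field_derivative_def)
  have "\<forall>\<^sub>F a in nhds \<alpha>. a \<noteq> 1" using False by (rule t1_space_nhds)
  then have "\<forall>\<^sub>F a in nhds \<alpha>. (2 - 2 powr a) * tan (a * pi / 2) = beta_denom a"
    by eventually_elim (simp add: beta_denom_def)
  from calm_at_cong[OF this] show ?thesis using calm by blast
qed (simp add: calm_at_beta_denom_1)

lemma h_mom_scale:
  assumes "0 < \<sigma>"
  shows "h_mom s \<alpha> \<sigma> = \<sigma> powr s * h_mom s \<alpha> 1"
  by (simp add: h_mom_def)

lemma calm_at_h_mom:
  assumes "0 < s" "s < \<alpha>"
  shows "calm_at (\<lambda>a. h_mom s a 1) \<alpha>"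
proof -
  have pos: "0 < 1 - s / \<alpha>" using assms by simp
  then have "1 - s / \<alpha> \<notin> \<int>\<^sub>\<le>\<^sub>0" by (auto elim!: nonpos_Ints_cases)
  then have G: "calm_at (\<lambda>a. Gamma (1 - s / a)) \<alpha>"
    using assms by (intro calm_at_DERIV[OF has_field_derivative_Gamma] calm_at_diff calm_at_divide
        calm_at_const calm_at_ident) auto
  show ?thesis
    unfolding h_mom_def divide_inverse[of "Gamma (1 - s / a)" "Gamma (1 - s)" for a]
      divide_inverse[of "2 powr (s / a)" "cos (s * pi / 2)" for a]
    using assms by (intro calm_at_mult G calm_at_const calm_at_const_powr calm_at_divide calm_at_ident) auto
qed

text \<open>For small \<open>d\<close> all quantities are defined: the equation for \<open>\<alpha>\<close> is solvable, the moments are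
positive and \<open>\<eta>\<close> stays inside \<open>(-\<pi>/2, \<pi>/2)\<close>, so the estimator is the value of calm functions of the
moments, evaluated in the order \<open>\<alpha>\<close>, \<open>\<sigma>\<close>, \<open>\<beta>\<close>.\<close>

theorem moment_estimate_calm:
  fixes \<alpha>0 \<beta>0 \<sigma>0 r H3 :: real
  assumes \<alpha>0: "\<alpha>0 < 2" and r: "0 < r" "r < \<alpha>0 / 4" and \<sigma>0: "0 < \<sigma>0" and H3: "0 < H3"
  defines "\<eta>0 \<equiv> arctan (\<beta>0 * beta_denom \<alpha>0 / (2 + 2 powr \<alpha>0))"
  defines "H4 \<equiv> H3 * (tan (r * \<eta>0 / \<alpha>0) / tan (r * pi / 2))"
  shows "\<exists>C. \<forall>\<^sub>F d in at_right 0. \<forall>e n a b s. moment_estimate r e n a b s \<longrightarrow>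
    \<bar>moment_S e n r - h_mom r \<alpha>0 \<sigma>0\<bar> \<le> d \<longrightarrow>
    \<bar>moment_S e n (2 * r) - h_mom (2 * r) \<alpha>0 \<sigma>0\<bar> \<le> d \<longrightarrow>
    \<bar>moment_C e n r - H3\<bar> \<le> d \<longrightarrow> \<bar>signed_moment_C e n r - H4\<bar> \<le> d \<longrightarrow>
    \<bar>a - \<alpha>0\<bar> \<le> C * d \<and> \<bar>b - \<beta>0\<bar> \<le> C * d \<and> \<bar>s - \<sigma>0\<bar> \<le> C * d"
proof -
  have \<alpha>pos: "0 < \<alpha>0" using r by linarith
  have r2: "2 * r < \<alpha>0" "r < \<alpha>0" "r < 1 / 2" "2 * r < 1" "r < 1" using r \<alpha>0 by linarith+
  define H1 where "H1 = h_mom r \<alpha>0 \<sigma>0"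
  define H2 where "H2 = h_mom (2 * r) \<alpha>0 \<sigma>0"
  define \<kappa> where "\<kappa> = ratio_const r"
  have H: "H1 > 0" "H2 > 0" unfolding H1_def H2_def using h_mom_pos r r2 \<sigma>0 by auto
  have \<kappa>: "\<kappa> > 0" unfolding \<kappa>_def using ratio_const_pos r r2 by auto

  obtain c where c: "c > 0" "(log_ratio r has_real_derivative c) (at \<alpha>0)"
    using log_ratio_deriv[OF r(1) r2(1)] by blast
  have dlog: "\<exists>c>0. (log_ratio r has_real_derivative c) (at x)" if "2 * r < x" for x
    using log_ratio_deriv[OF r(1) that] .
  have mono: "log_ratio r x < log_ratio r y" if "2 * r < x" "x < y" "y < 2" for x y
  proof (rule DERIV_pos_imp_increasing[OF that(2)])
    fix z assume "x \<le> z"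
    then have "2 * r < z" using that(1) by linarith
    from dlog[OF this] show "\<exists>c. (log_ratio r has_real_derivative c) (at z) \<and> c > 0" by blast
  qed
  have cont: "continuous_on {2 * r<..<2} (log_ratio r)"
  proof (intro continuous_at_imp_continuous_on ballI)
    fix z assume "z \<in> {2 * r<..<2}"
    then have "2 * r < z" by simp
    from dlog[OF this] show "isCont (log_ratio r) z" using DERIV_isCont by blast
  qed
  obtain \<rho>1 C1 where C1: "0 < \<rho>1" "0 \<le> C1"
    "\<And>y. \<bar>y - log_ratio r \<alpha>0\<bar> \<le> \<rho>1 \<Longrightarrow> \<exists>x. 2 * r < x \<and> x < 2 \<and> log_ratio r x = y"
    "\<And>x. 2 * r < x \<Longrightarrow> x < 2 \<Longrightarrow> \<bar>log_ratio r x - log_ratio r \<alpha>0\<bar> \<le> \<rho>1 \<Longrightarrow> \<bar>x - \<alpha>0\<bar> \<le> C1 * \<bar>log_ratio r x - log_ratio r \<alpha>0\<bar>"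
    using strict_mono_inverse_calm[OF r2(1) \<alpha>0 cont mono c(2,1)] by blast

  \<comment> \<open>The three explicit formulas: \<open>F1\<close> is the value that \<open>log_ratio\<close> must take at \<open>\<alpha>\<close>, and \<open>F2\<close> and \<open>F3\<close>
  give \<open>\<sigma>\<close> and \<open>\<beta>\<close> in terms of \<open>\<alpha>\<close> and the moments.\<close>
  define F1 where "F1 p = ln ((fst p * fst p) / snd p / \<kappa>)" for p :: "real \<times> real"
  have F1_0: "F1 (H1, H2) = log_ratio r \<alpha>0"
  proof -
    have "H1 * H1 / H2 = \<kappa> * exp (log_ratio r \<alpha>0)"
      using h_mom_ratio[OF r(1) r2(1,3) \<sigma>0] by (simp add: H1_def H2_def \<kappa>_def power2_eq_square)
    then show ?thesis using \<kappa> by (simp add: F1_def)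
  qed
  have "calm_at F1 (H1, H2)"
    unfolding F1_def using H \<kappa>
    by (intro calm_at_DERIV[OF DERIV_ln] calm_at_divide calm_at_mult calm_at_fst calm_at_snd calm_at_const) auto
  then obtain \<rho>2 C2 where C2: "0 < \<rho>2" "0 \<le> C2"
    "\<And>p. norm (p - (H1, H2)) \<le> \<rho>2 \<Longrightarrow> norm (F1 p - F1 (H1, H2)) \<le> C2 * norm (p - (H1, H2))"
    by (rule calm_atE) blast

  define F2 where "F2 p = (fst p / h_mom r (snd p) 1) powr (1 / r)" for p :: "real \<times> real"
  have q0: "h_mom r \<alpha>0 1 > 0" using h_mom_pos[of r \<alpha>0 1] r r2 by simp
  have F2_0: "F2 (H1, \<alpha>0) = \<sigma>0"
  proof -
    have "H1 / h_mom r \<alpha>0 1 = \<sigma>0 powr r"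
      unfolding H1_def h_mom_scale[OF \<sigma>0, of r \<alpha>0] using q0 by simp
    then show ?thesis using \<sigma>0 r by (simp add: F2_def powr_powr)
  qed
  have "calm_at F2 (H1, \<alpha>0)"
    unfolding F2_def using H q0 r r2
    by (intro calm_at_powr_const calm_at_divide calm_at_fst
        calm_at_compose[OF calm_at_h_mom calm_at_snd]) auto
  then obtain \<rho>3 C3 where C3: "0 < \<rho>3" "0 \<le> C3"
    "\<And>p. norm (p - (H1, \<alpha>0)) \<le> \<rho>3 \<Longrightarrow> norm (F2 p - F2 (H1, \<alpha>0)) \<le> C3 * norm (p - (H1, \<alpha>0))"
    by (rule calm_atE) blast

  define x0 where "x0 = (\<alpha>0, H4, H3)"
  define E where "E p = fst p / r * arctan (tan (r * pi / 2) * (fst (snd p) / snd (snd p)))" for p :: "real \<times> real \<times> real"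
  have \<eta>0_bounds: "\<bar>\<eta>0\<bar> < pi / 2"
    unfolding \<eta>0_def using arctan_lbound arctan_ubound by (metis abs_less_iff minus_less_iff)
  have E_0: "E x0 = \<eta>0"
  proof -
    have "tan (r * pi / 2) > 0" using r r2 by (intro tan_gt_zero) auto
    then have "tan (r * pi / 2) * (H4 / H3) = tan (r * \<eta>0 / \<alpha>0)"
      using H3 by (simp add: H4_def)
    moreover have "arctan (tan (r * \<eta>0 / \<alpha>0)) = r * \<eta>0 / \<alpha>0"
    proof (rule arctan_tan)
      have "\<bar>r * \<eta>0 / \<alpha>0\<bar> = (r / \<alpha>0) * \<bar>\<eta>0\<bar>" using r \<alpha>pos by (simp add: abs_mult)
      also have "\<dots> \<le> 1 * \<bar>\<eta>0\<bar>" using r2 \<alpha>pos by (intro mult_right_mono) auto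
      finally have "\<bar>r * \<eta>0 / \<alpha>0\<bar> < pi / 2" using \<eta>0_bounds by linarith
      moreover have "- p < x \<and> x < p" if "\<bar>x\<bar> < p" for x p :: real using that by auto
      ultimately show "- (pi / 2) < r * \<eta>0 / \<alpha>0" "r * \<eta>0 / \<alpha>0 < pi / 2" by blast+
    qed
    ultimately show ?thesis using r \<alpha>pos by (simp add: E_def x0_def)
  qed
  have calm_E: "calm_at E x0"
    unfolding E_def
  proof (intro calm_at_mult calm_at_divide calm_at_fst calm_at_const)
    have c: "calm_at (\<lambda>p. fst (snd p)) x0" "calm_at (\<lambda>p. snd (snd p)) x0"
      by (rule calm_at_compose[OF calm_at_fst calm_at_snd], rule calm_at_compose[OF calm_at_snd calm_at_snd])
    have "calm_at (\<lambda>p. tan (r * pi / 2) * (fst (snd p) / snd (snd p))) x0"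
      using H3 by (intro calm_at_mult calm_at_divide calm_at_const c) (simp add: x0_def)
    then show "calm_at (\<lambda>p. arctan (tan (r * pi / 2) * (fst (snd p) / snd (snd p)))) x0"
      by (rule calm_at_DERIV[OF DERIV_arctan])
  qed (use r in simp)
  obtain \<rho>4 C4 where C4: "0 < \<rho>4" "0 \<le> C4"
    "\<And>p. norm (p - x0) \<le> \<rho>4 \<Longrightarrow> norm (E p - E x0) \<le> C4 * norm (p - x0)"
    using calm_E by (rule calm_atE) blast

  define F3 where "F3 p = (2 + 2 powr fst p) * tan (E p) / beta_denom (fst p)" for p
  have bd0: "beta_denom \<alpha>0 \<noteq> 0" using beta_denom_nonzero \<alpha>pos \<alpha>0 by auto
  have F3_0: "F3 x0 = \<beta>0"
  proof -
    have "2 + 2 powr \<alpha>0 \<noteq> 0" by (smt (verit) powr_gt_zero)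
    then show ?thesis using bd0 unfolding F3_def E_0 by (simp add: x0_def \<eta>0_def tan_arctan)
  qed
  have "calm_at F3 x0"
  proof -
    have "cos \<eta>0 \<noteq> 0" using \<eta>0_bounds by (intro less_imp_neq[THEN not_sym] cos_gt_zero_pi) auto
    then have t: "calm_at (\<lambda>p. tan (E p)) x0"
      by (intro calm_at_DERIV[OF DERIV_tan calm_E]) (simp add: E_0)
    have b: "calm_at (\<lambda>p. beta_denom (fst p)) x0"
      using \<alpha>pos \<alpha>0 by (intro calm_at_compose[OF calm_at_beta_denom calm_at_fst]) (auto simp: x0_def)
    show ?thesis unfolding F3_def
      by (intro calm_at_divide calm_at_mult calm_at_add calm_at_const calm_at_const_powr calm_at_fst t b)
        (auto simp: x0_def bd0)
  qed
  then obtain \<rho>5 C5 where C5: "0 < \<rho>5" "0 \<le> C5"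
    "\<And>p. norm (p - x0) \<le> \<rho>5 \<Longrightarrow> norm (F3 p - F3 x0) \<le> C5 * norm (p - x0)"
    by (rule calm_atE) blast

  \<comment> \<open>The errors propagate through \<open>\<alpha>\<close>, with constant \<open>A\<close>, into the other two components.\<close>
  define A where "A = C1 * (C2 * 2)"
  have A: "A \<ge> 0" using C1 C2 by (simp add: A_def)
  define C where "C = A + C5 * (A + 2) + C3 * (1 + A)"
  have small: "\<forall>\<^sub>F d in at_right 0. K * d \<le> \<rho>" if "\<rho> > 0" for K \<rho> :: real
  proof -
    have "((\<lambda>d. K * d) \<longlongrightarrow> K * 0) (at_right 0)" by (intro tendsto_intros)
    then have "\<forall>\<^sub>F d in at_right 0. K * d < \<rho>" using that by (intro order_tendstoD) auto
    then show ?thesis by (rule eventually_mono) simp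
  qed
  have gap: "(pi / 2 - \<bar>\<eta>0\<bar>) / 2 > 0" using \<eta>0_bounds by simp
  have "\<forall>\<^sub>F d in at_right 0. 0 < d \<and> 2 * d \<le> \<rho>2 \<and> 2 * d \<le> H1 \<and> 2 * d \<le> H2 \<and> 2 * d \<le> H3
      \<and> (C2 * 2) * d \<le> \<rho>1 \<and> (1 + A) * d \<le> \<rho>3 \<and> (A + 2) * d \<le> \<rho>4 \<and> (A + 2) * d \<le> \<rho>5
      \<and> (C4 * (A + 2)) * d \<le> (pi / 2 - \<bar>\<eta>0\<bar>) / 2"
    by (intro eventually_conj small C1 C2 C3 C4 C5 H H3 gap eventually_at_right_less)
  then have "\<forall>\<^sub>F d in at_right 0. \<forall>e n a b s. moment_estimate r e n a b s \<longrightarrow>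
    \<bar>moment_S e n r - h_mom r \<alpha>0 \<sigma>0\<bar> \<le> d \<longrightarrow>
    \<bar>moment_S e n (2 * r) - h_mom (2 * r) \<alpha>0 \<sigma>0\<bar> \<le> d \<longrightarrow>
    \<bar>moment_C e n r - H3\<bar> \<le> d \<longrightarrow> \<bar>signed_moment_C e n r - H4\<bar> \<le> d \<longrightarrow>
    \<bar>a - \<alpha>0\<bar> \<le> C * d \<and> \<bar>b - \<beta>0\<bar> \<le> C * d \<and> \<bar>s - \<sigma>0\<bar> \<le> C * d"
  proof eventually_elim
    case (elim d)
    then have d: "0 < d" "2 * d \<le> \<rho>2" "2 * d \<le> H1" "2 * d \<le> H2" "2 * d \<le> H3"
      "C2 * 2 * d \<le> \<rho>1" "(1 + A) * d \<le> \<rho>3" "(A + 2) * d \<le> \<rho>4" "(A + 2) * d \<le> \<rho>5"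
      "C4 * (A + 2) * d \<le> (pi / 2 - \<bar>\<eta>0\<bar>) / 2" by auto
    show ?case
    proof (intro allI impI)
      fix e n a b s
      assume est: "moment_estimate r e n a b s"
        and m1: "\<bar>moment_S e n r - h_mom r \<alpha>0 \<sigma>0\<bar> \<le> d"
        and m2: "\<bar>moment_S e n (2 * r) - h_mom (2 * r) \<alpha>0 \<sigma>0\<bar> \<le> d"
        and m3: "\<bar>moment_C e n r - H3\<bar> \<le> d" and m4: "\<bar>signed_moment_C e n r - H4\<bar> \<le> d"
      define M1 where "M1 = moment_S e n r"
      define M2 where "M2 = moment_S e n (2 * r)"
      define M3 where "M3 = moment_C e n r"
      define M4 where "M4 = signed_moment_C e n r"
      have M: "\<bar>M1 - H1\<bar> \<le> d" "\<bar>M2 - H2\<bar> \<le> d" "\<bar>M3 - H3\<bar> \<le> d" "\<bar>M4 - H4\<bar> \<le> d"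
        using m1 m2 m3 m4 by (simp_all add: M1_def M2_def M3_def M4_def H1_def H2_def)
      have Mpos: "M1 > 0" "M2 > 0" "M3 > 0" using M d by linarith+
      define y where "y = F1 (M1, M2)"
      have "norm ((M1, M2) - (H1, H2)) \<le> 2 * d"
        using norm_Pair_le[of "M1 - H1" "M2 - H2"] M by simp
      then have "\<bar>y - log_ratio r \<alpha>0\<bar> \<le> C2 * (2 * d)"
        using C2(3)[of "(M1, M2)"] d C2(2) mult_left_mono[of "norm ((M1, M2) - (H1, H2))" "2 * d" C2]
        by (simp add: y_def F1_0)
      then have y: "\<bar>y - log_ratio r \<alpha>0\<bar> \<le> C2 * 2 * d" "\<bar>y - log_ratio r \<alpha>0\<bar> \<le> \<rho>1"
        using d by simp_all
      have ey: "M1\<^sup>2 / M2 = \<kappa> * exp y"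
        using Mpos \<kappa> by (simp add: y_def F1_def power2_eq_square)
      have solves: "solves_alpha r e n x \<longleftrightarrow> 2 * r < x \<and> x < 2 \<and> log_ratio r x = y" for x
      proof -
        have "(\<forall>\<sigma>>0. M1\<^sup>2 / M2 = (h_mom r x \<sigma>)\<^sup>2 / h_mom (2 * r) x \<sigma>) \<longleftrightarrow> log_ratio r x = y"
          if "2 * r < x"
        proof -
          have "(\<forall>\<sigma>>0. M1\<^sup>2 / M2 = (h_mom r x \<sigma>)\<^sup>2 / h_mom (2 * r) x \<sigma>)
              \<longleftrightarrow> (\<forall>\<sigma>>0::real. \<kappa> * exp y = \<kappa> * exp (log_ratio r x))"
            using h_mom_ratio[OF r(1) that r2(3)] by (simp add: ey \<kappa>_def)
          also have "\<dots> \<longleftrightarrow> log_ratio r x = y" using \<kappa> by (auto intro: exI[of _ 1])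
          finally show ?thesis .
        qed
        then show ?thesis unfolding solves_alpha_def M1_def M2_def by blast
      qed
      then have "\<exists>x. solves_alpha r e n x" using C1(3)[OF y(2)] by blast
      with est have a: "solves_alpha r e n a"
        and s: "(\<exists>\<sigma>. solves_sigma r e n a \<sigma>) \<Longrightarrow> solves_sigma r e n a s"
        and b: "moment_C e n r \<noteq> 0 \<Longrightarrow> cos (eta_hat r e n a) \<noteq> 0 \<Longrightarrow> b = beta_formula r e n a"
        unfolding moment_estimate_def by blast+
      have a': "2 * r < a" "a < 2" "log_ratio r a = y" using a solves by blast+
      have a_le: "\<bar>a - \<alpha>0\<bar> \<le> A * d"
      proof -
        have "\<bar>a - \<alpha>0\<bar> \<le> C1 * \<bar>y - log_ratio r \<alpha>0\<bar>" using C1(4)[of a] a' y by simp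
        also have "\<dots> \<le> C1 * (C2 * 2 * d)" using y(1) C1(2) by (intro mult_left_mono)
        finally show ?thesis by (simp add: A_def mult.assoc)
      qed
      have q: "h_mom r a 1 > 0" using h_mom_pos[of r a 1] a' r r2 by simp
      have sigma_iff: "solves_sigma r e n a \<sigma> \<longleftrightarrow> \<sigma> = F2 (M1, a)" for \<sigma>
      proof
        assume "solves_sigma r e n a \<sigma>"
        then have \<sigma>: "\<sigma> > 0" "M1 = h_mom r a \<sigma>" by (auto simp: solves_sigma_def M1_def)
        then have "M1 / h_mom r a 1 = \<sigma> powr r" using h_mom_scale[OF \<sigma>(1), of r a] q by simp
        then show "\<sigma> = F2 (M1, a)" using \<sigma>(1) r by (simp add: F2_def powr_powr)
      next
        assume \<sigma>: "\<sigma> = F2 (M1, a)"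
        have pos: "\<sigma> > 0" using Mpos q by (simp add: \<sigma> F2_def)
        have "\<sigma> powr r = M1 / h_mom r a 1" using Mpos q r by (simp add: \<sigma> F2_def powr_powr)
        then show "solves_sigma r e n a \<sigma>"
          using pos q h_mom_scale[OF pos, of r a] by (simp add: solves_sigma_def M1_def)
      qed
      have s_le: "\<bar>s - \<sigma>0\<bar> \<le> C3 * (1 + A) * d"
      proof -
        have "s = F2 (M1, a)" using s sigma_iff by blast
        moreover have n: "norm ((M1, a) - (H1, \<alpha>0)) \<le> (1 + A) * d"
          using norm_Pair_le[of "M1 - H1" "a - \<alpha>0"] M a_le by (simp add: distrib_right)
        ultimately have "\<bar>s - \<sigma>0\<bar> \<le> C3 * norm ((M1, a) - (H1, \<alpha>0))"
          using C3(3)[of "(M1, a)"] d by (simp add: F2_0)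
        also have "\<dots> \<le> C3 * ((1 + A) * d)" using n C3(2) by (rule mult_left_mono)
        finally show ?thesis by (simp add: mult.assoc)
      qed
      define x where "x = (a, M4, M3)"
      have x: "norm (x - x0) \<le> (A + 2) * d"
      proof -
        have "norm (x - x0) \<le> \<bar>a - \<alpha>0\<bar> + norm (M4 - H4, M3 - H3)"
          using norm_Pair_le[of "a - \<alpha>0" "(M4 - H4, M3 - H3)"] by (simp add: x_def x0_def)
        also have "norm (M4 - H4, M3 - H3) \<le> \<bar>M4 - H4\<bar> + \<bar>M3 - H3\<bar>"
          using norm_Pair_le[of "M4 - H4" "M3 - H3"] by simp
        finally show ?thesis using a_le M by (simp add: distrib_right)
      qed
      have E_x: "eta_hat r e n a = E x"
        by (simp add: eta_hat_def E_def x_def M3_def M4_def)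
      have "\<bar>E x - \<eta>0\<bar> \<le> C4 * norm (x - x0)" using C4(3)[of x] x d by (simp add: E_0)
      also have "\<dots> \<le> C4 * ((A + 2) * d)" using x C4(2) by (rule mult_left_mono)
      finally have "\<bar>E x - \<eta>0\<bar> \<le> (pi / 2 - \<bar>\<eta>0\<bar>) / 2" using d(10) by (simp add: mult.assoc)
      moreover have "\<bar>E x\<bar> \<le> \<bar>E x - \<eta>0\<bar> + \<bar>\<eta>0\<bar>"
        using abs_triangle_ineq[of "E x - \<eta>0" \<eta>0] by simp
      moreover have "u < q" if "u \<le> v + w" "v \<le> (q - w) / 2" "w < q" for u v w q :: real
        using that by (simp add: field_simps)
      ultimately have "\<bar>E x\<bar> < pi / 2" using \<eta>0_bounds by blast
      moreover have "- q < u \<and> u < q" if "\<bar>u\<bar> < q" for u q :: real using that by auto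
      ultimately have "cos (E x) > 0" by (intro cos_gt_zero_pi) blast+
      then have "b = beta_formula r e n a" using b Mpos E_x by (simp add: M3_def)
      then have "b = F3 x" unfolding beta_formula_def E_x F3_def by (simp add: x_def)
      then have "\<bar>b - \<beta>0\<bar> \<le> C5 * norm (x - x0)" using C5(3)[of x] x d by (simp add: F3_0)
      also have "\<dots> \<le> C5 * ((A + 2) * d)" using x C5(2) by (rule mult_left_mono)
      finally have b_le: "\<bar>b - \<beta>0\<bar> \<le> C5 * (A + 2) * d" by (simp add: mult.assoc)
      have nn: "0 \<le> A * d" "0 \<le> C5 * (A + 2) * d" "0 \<le> C3 * (1 + A) * d"
        using A C5(2) C3(2) d(1) by auto
      have "C * d = A * d + C5 * (A + 2) * d + C3 * (1 + A) * d"
        by (simp add: C_def distrib_right)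
      then show "\<bar>a - \<alpha>0\<bar> \<le> C * d \<and> \<bar>b - \<beta>0\<bar> \<le> C * d \<and> \<bar>s - \<sigma>0\<bar> \<le> C * d"
        using a_le b_le s_le nn by linarith
    qed
  qed
  then show ?thesis by blast
qed

section \<open>Contrasts of skewed stable noise\<close>

lemma stable0_char_nonzero:
  assumes "u \<noteq> 0"
  shows "stable0_char \<alpha> \<beta> 1 0 u = exp (- of_real (\<bar>u\<bar> powr \<alpha>) *
    (1 + \<i> * of_real (\<beta> * sgn u * (if \<alpha> = 1 then 2 / pi * ln \<bar>u\<bar>
       else tan (\<alpha> * pi / 2) * (\<bar>u\<bar> powr (1 - \<alpha>) - 1)))))"
  by (simp add: stable0_char_def Let_def)

text \<open>The skewness enters with opposite signs and cancels.\<close>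

lemma stable0_char_symmetrized:
  assumes "u > 0"
  shows "stable0_char \<alpha> \<beta> 1 0 u * stable0_char \<alpha> \<beta> 1 0 (- u) = exp (- of_real (2 * u powr \<alpha>))"
proof -
  have gen: "- A * (1 + \<i> * of_real b) + - A * (1 + \<i> * of_real (- b)) = - (2 * A)" for A :: complex and b :: real
    by (simp add: algebra_simps)
  define w where "w = (if \<alpha> = 1 then 2 / pi * ln \<bar>u\<bar> else tan (\<alpha> * pi / 2) * (\<bar>u\<bar> powr (1 - \<alpha>) - 1))"
  have "stable0_char \<alpha> \<beta> 1 0 u = exp (- of_real (u powr \<alpha>) * (1 + \<i> * of_real (\<beta> * w)))"
    "stable0_char \<alpha> \<beta> 1 0 (- u) = exp (- of_real (u powr \<alpha>) * (1 + \<i> * of_real (- (\<beta> * w))))"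
    using assms by (auto simp: stable0_char_nonzero w_def)
  then show ?thesis by (simp only: exp_add[symmetric] gen) simp
qed

text \<open>The weights \<open>1, 1, -2\<close> sum to \<open>0\<close>, so the terms linear in \<open>u\<close> cancel and the skewness that remains
is exactly \<open>beta_denom\<close>; for \<open>\<alpha> = 1\<close> it comes from \<open>ln (2 u) - ln u\<close>, which explains the value of
\<open>beta_denom\<close> there.\<close>

lemma stable0_char_contrast:
  assumes u: "u > 0"
  shows "(stable0_char \<alpha> \<beta> 1 0 u)\<^sup>2 * stable0_char \<alpha> \<beta> 1 0 (- 2 * u)
    = exp (- of_real (u powr \<alpha>) * (of_real (2 + 2 powr \<alpha>) - \<i> * of_real (\<beta> * beta_denom \<alpha>)))"
proof -
  define w where "w v = (if \<alpha> = 1 then 2 / pi * ln v else tan (\<alpha> * pi / 2) * (v powr (1 - \<alpha>) - 1))" for v :: real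
  define P where "P = u powr \<alpha>"
  have p2: "(2 * u) powr \<alpha> = 2 powr \<alpha> * P" using u by (simp add: powr_mult P_def)
  have s1: "stable0_char \<alpha> \<beta> 1 0 u = exp (- of_real P * (1 + \<i> * of_real (\<beta> * w u)))"
    using u by (simp add: stable0_char_nonzero w_def P_def)
  have s2: "stable0_char \<alpha> \<beta> 1 0 (- 2 * u) = exp (- of_real (2 powr \<alpha> * P) * (1 - \<i> * of_real (\<beta> * w (2 * u))))"
    using u p2 by (simp add: stable0_char_nonzero w_def sgn_mult)
  have im: "2 * w u - 2 powr \<alpha> * w (2 * u) = - beta_denom \<alpha>"
  proof (cases "\<alpha> = 1")
    case True
    then show ?thesis using u by (simp add: w_def beta_denom_def ln_mult algebra_simps)
  next
    case False
    have "2 powr \<alpha> * (2 * u) powr (1 - \<alpha>) = 2 * u powr (1 - \<alpha>)"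
      using u by (simp add: powr_mult powr_diff)
    then have "2 * (u powr (1 - \<alpha>) - 1) - 2 powr \<alpha> * ((2 * u) powr (1 - \<alpha>) - 1) = 2 powr \<alpha> - 2"
      by (simp add: right_diff_distrib)
    then have "tan (\<alpha> * pi / 2) * (2 * (u powr (1 - \<alpha>) - 1) - 2 powr \<alpha> * ((2 * u) powr (1 - \<alpha>) - 1))
        = tan (\<alpha> * pi / 2) * (2 powr \<alpha> - 2)" by (simp only:)
    also have "\<dots> = - ((2 - 2 powr \<alpha>) * tan (\<alpha> * pi / 2))" by (simp add: algebra_simps)
    finally have "tan (\<alpha> * pi / 2) * (2 * (u powr (1 - \<alpha>) - 1) - 2 powr \<alpha> * ((2 * u) powr (1 - \<alpha>) - 1))
        = - ((2 - 2 powr \<alpha>) * tan (\<alpha> * pi / 2))" .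
    then show ?thesis using False by (simp add: w_def beta_denom_def algebra_simps)
  qed
  have gen: "- A * (1 + \<i> * of_real b) + - A * (1 + \<i> * of_real b) + - (B * A) * (1 - \<i> * of_real d)
      = - A * ((2 + B) + \<i> * (2 * of_real b - B * of_real d))" for A B :: complex and b d :: real
    by (simp add: algebra_simps)
  have "(stable0_char \<alpha> \<beta> 1 0 u)\<^sup>2 * stable0_char \<alpha> \<beta> 1 0 (- 2 * u)
    = exp (- of_real P * (1 + \<i> * of_real (\<beta> * w u)) + - of_real P * (1 + \<i> * of_real (\<beta> * w u))
      + - (of_real (2 powr \<alpha>) * of_real P) * (1 - \<i> * of_real (\<beta> * w (2 * u))))"
    unfolding s1 s2 power2_eq_square exp_add by simp
  also have "\<dots> = exp (- of_real P * ((2 + of_real (2 powr \<alpha>))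
      + \<i> * (2 * of_real (\<beta> * w u) - of_real (2 powr \<alpha>) * of_real (\<beta> * w (2 * u)))))"
    unfolding gen ..
  also have "2 * complex_of_real (\<beta> * w u) - of_real (2 powr \<alpha>) * of_real (\<beta> * w (2 * u))
      = of_real (\<beta> * (2 * w u - 2 powr \<alpha> * w (2 * u)))"
    by (simp add: algebra_simps)
  finally show ?thesis unfolding im P_def[symmetric] by simp
qed

lemma (in iid_noise) char_linear_combination:
  assumes "finite A" "A \<subseteq> {1..}"
    and "\<And>i u. i \<in> A \<Longrightarrow> char (distr M borel (eps i)) u = \<phi> u"
  shows "char (distr M borel (\<lambda>\<omega>. \<Sum>i\<in>A. c i * eps i \<omega>)) u = (\<Prod>i\<in>A. \<phi> (c i * u))"
proof -
  have "indep_vars (\<lambda>_. borel) eps A" using indep assms(2) by (rule indep_vars_subset)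
  then have "indep_vars (\<lambda>_. borel) (\<lambda>i \<omega>. c i * eps i \<omega>) A"
    by (rule indep_vars_compose2) simp
  then have "char (distr M borel (\<lambda>\<omega>. \<Sum>i\<in>A. c i * eps i \<omega>)) u
      = (\<Prod>i\<in>A. char (distr M borel (\<lambda>\<omega>. c i * eps i \<omega>)) u)"
    by (rule char_distr_sum)
  also have "\<dots> = (\<Prod>i\<in>A. \<phi> (c i * u))"
  proof (rule prod.cong[OF refl])
    fix i assume i: "i \<in> A"
    then have m: "eps i \<in> borel_measurable M" using assms(2) eps_measurable by auto
    have "char (distr M borel (\<lambda>\<omega>. c i * eps i \<omega>)) u = char (distr M borel (eps i)) (c i * u)"
      unfolding char_def using m by (subst (1 2) integral_distr) (auto simp: mult_ac)
    then show "char (distr M borel (\<lambda>\<omega>. c i * eps i \<omega>)) u = \<phi> (c i * u)" using assms(3)[OF i] by simp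
  qed
  finally show ?thesis .
qed

lemma complex_powr_polar:
  assumes "0 < c" "0 < b"
  shows "(of_real (c * b) * (1 - \<i> * of_real t)) powr of_real p
    = of_real ((c * b * sqrt (1 + t\<^sup>2)) powr p) * (of_real (cos (p * arctan t)) - \<i> * of_real (sin (p * arctan t)))"
proof -
  define \<eta> where "\<eta> = arctan t"
  define R where "R = c * b * sqrt (1 + t\<^sup>2)"
  have q: "sqrt (1 + t\<^sup>2) > 0" by (simp add: add_pos_nonneg)
  have R: "R > 0" unfolding R_def using assms q by (intro mult_pos_pos)
  have z: "of_real (c * b) * (1 - \<i> * of_real t) = of_real R * exp (\<i> * of_real (- \<eta>))"
  proof -
    have "cos \<eta> = 1 / sqrt (1 + t\<^sup>2)" "sin \<eta> = t / sqrt (1 + t\<^sup>2)"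
      by (simp_all add: \<eta>_def cos_arctan sin_arctan)
    then have "R * cos \<eta> = c * b" "R * sin \<eta> = c * b * t" using q by (simp_all add: R_def)
    then show ?thesis
      unfolding cis_conv_exp[symmetric] by (simp add: complex_eq_iff)
  qed
  have nz: "of_real R * exp (\<i> * of_real (- \<eta>)) \<noteq> 0" using R by simp
  have bounds: "- pi < - \<eta>" "- \<eta> \<le> pi"
    using arctan_lbound[of t] arctan_ubound[of t] pi_gt_zero unfolding \<eta>_def by linarith+
  have "Ln (of_real R * exp (\<i> * of_real (- \<eta>))) = ln (of_real R) + Ln (exp (\<i> * of_real (- \<eta>)))"
    using R Ln_times_of_real[of R "exp (\<i> * of_real (- \<eta>))"] by (simp add: Ln_of_real)
  also have "Ln (exp (\<i> * of_real (- \<eta>))) = \<i> * of_real (- \<eta>)"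
    using bounds by (intro Ln_exp) auto
  also have "ln (complex_of_real R) = of_real (ln R)" using R by (rule Ln_of_real)
  finally have ln: "Ln (of_real R * exp (\<i> * of_real (- \<eta>))) = of_real (ln R) + \<i> * of_real (- \<eta>)" .
  have "(of_real R * exp (\<i> * of_real (- \<eta>))) powr of_real p = exp (of_real (p * ln R)) * exp (\<i> * of_real (- (p * \<eta>)))"
    using nz unfolding powr_def ln exp_add[symmetric] by (simp add: algebra_simps)
  also have "exp (complex_of_real (p * ln R)) = of_real (R powr p)"
    unfolding exp_of_real using R by (simp add: powr_def)
  also have "exp (\<i> * of_real (- (p * \<eta>))) = of_real (cos (p * \<eta>)) - \<i> * of_real (sin (p * \<eta>))"
    unfolding cis_conv_exp[symmetric] by (simp add: complex_eq_iff)
  finally show ?thesis unfolding z by (simp add: R_def \<eta>_def)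
qed

lemma symmetric_stable_abs_moment:
  assumes N: "stable_char N \<alpha> (of_real (2 * \<sigma> powr \<alpha>))" and \<sigma>: "0 < \<sigma>" and s: "0 < s" "s < \<alpha>" "s < 1"
  shows "(\<integral>x. \<bar>x\<bar> powr s \<partial>N) = h_mom s \<alpha> \<sigma>"
proof -
  interpret stable_char N \<alpha> "of_real (2 * \<sigma> powr \<alpha>)" by (rule N)
  have g: "cos (s * pi / 2) > 0" "Gamma (1 - s) > 0"
    using s by (auto intro!: cos_gt_zero Gamma_real_pos)
  have "complex_of_real (2 * \<sigma> powr \<alpha>) powr of_real (s / \<alpha>) = of_real ((2 * \<sigma> powr \<alpha>) powr (s / \<alpha>))"
    using \<sigma> by (intro powr_of_real) auto
  also have "(2 * \<sigma> powr \<alpha>) powr (s / \<alpha>) = 2 powr (s / \<alpha>) * \<sigma> powr s"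
    using \<sigma> s by (simp add: powr_mult powr_powr)
  finally have "Re (complex_of_real (2 * \<sigma> powr \<alpha>) powr of_real (s / \<alpha>)) = 2 powr (s / \<alpha>) * \<sigma> powr s"
    by simp
  then show ?thesis using moments(1)[OF s] g by (simp add: h_mom_def field_simps)
qed

text \<open>The argument of \<open>\<zeta>\<close> is \<open>- arctan \<tau>\<close>. Raising \<open>\<zeta>\<close> to the power \<open>s / \<alpha>\<close> multiplies the argument, so the
two moments are a common positive factor times a cosine and a sine.\<close>

lemma skewed_stable_moments:
  fixes \<alpha> \<beta> \<sigma> s :: real
  defines "\<tau> \<equiv> \<beta> * beta_denom \<alpha> / (2 + 2 powr \<alpha>)"
  assumes N: "stable_char N \<alpha> (of_real (\<sigma> powr \<alpha>) * (of_real (2 + 2 powr \<alpha>) - \<i> * of_real (\<beta> * beta_denom \<alpha>)))"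
    and \<sigma>: "0 < \<sigma>" and s: "0 < s" "s < \<alpha>" "s < 1"
  shows "0 < (\<integral>x. \<bar>x\<bar> powr s \<partial>N)"
    and "(\<integral>x. signed_powr x s \<partial>N)
      = (\<integral>x. \<bar>x\<bar> powr s \<partial>N) * (tan (s * arctan \<tau> / \<alpha>) / tan (s * pi / 2))"
proof -
  interpret stable_char N \<alpha> "of_real (\<sigma> powr \<alpha>) * (of_real (2 + 2 powr \<alpha>) - \<i> * of_real (\<beta> * beta_denom \<alpha>))" by (rule N)
  define c where "c = 2 + 2 powr \<alpha>"
  have c: "c > 0" unfolding c_def by (intro add_pos_pos) auto
  define p where "p = s / \<alpha>"
  have \<alpha>: "\<alpha> > 0" using s by linarith
  have p: "0 < p" "p < 1" using s by (auto simp: p_def)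
  define R where "R = (\<sigma> powr \<alpha> * c * sqrt (1 + \<tau>\<^sup>2)) powr p"
  have R: "R > 0"
  proof -
    have "\<sigma> powr \<alpha> * c * sqrt (1 + \<tau>\<^sup>2) > 0"
      using \<sigma> c by (intro mult_pos_pos) (auto simp: add_pos_nonneg)
    then have "\<sigma> powr \<alpha> * c * sqrt (1 + \<tau>\<^sup>2) \<noteq> 0" by (rule less_imp_neq[THEN not_sym])
    then show ?thesis unfolding R_def powr_gt_zero .
  qed
  have "\<beta> * beta_denom \<alpha> = c * \<tau>" using c by (simp add: \<tau>_def c_def)
  then have "of_real (\<sigma> powr \<alpha>) * (complex_of_real (2 + 2 powr \<alpha>) - \<i> * of_real (\<beta> * beta_denom \<alpha>))
      = of_real (\<sigma> powr \<alpha> * c) * (1 - \<i> * of_real \<tau>)"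
    by (simp add: c_def[symmetric] algebra_simps)
  note e = this
  have z: "(of_real (\<sigma> powr \<alpha>) * (complex_of_real (2 + 2 powr \<alpha>) - \<i> * of_real (\<beta> * beta_denom \<alpha>))) powr of_real (s / \<alpha>)
      = of_real R * (of_real (cos (p * arctan \<tau>)) - \<i> * of_real (sin (p * arctan \<tau>)))"
    unfolding e p_def[symmetric] R_def by (rule complex_powr_polar) (use \<sigma> c in auto)
  have "\<bar>p * arctan \<tau>\<bar> < pi / 2"
  proof -
    have "\<bar>arctan \<tau>\<bar> < pi / 2" using arctan_lbound[of \<tau>] arctan_ubound[of \<tau>] by auto
    moreover have "\<bar>p * arctan \<tau>\<bar> \<le> 1 * \<bar>arctan \<tau>\<bar>" unfolding abs_mult using p by (intro mult_right_mono) auto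
    ultimately show ?thesis by linarith
  qed
  then have cosp: "cos (p * arctan \<tau>) > 0" by (intro cos_gt_zero_pi) auto
  have "s * pi / 2 < pi / 2" "0 < s * pi / 2" using s by simp_all
  then have "cos (s * pi / 2) > 0" "sin (s * pi / 2) > 0"
    using cos_gt_zero[of "s * pi / 2"] sin_gt_zero[of "s * pi / 2"] by linarith+
  moreover have "Gamma (1 - s) > 0" "Gamma (1 - s / \<alpha>) > 0"
    using s \<alpha> by (simp_all add: Gamma_real_pos)
  ultimately have g: "cos (s * pi / 2) > 0" "sin (s * pi / 2) > 0" "Gamma (1 - s) > 0" "Gamma (1 - s / \<alpha>) > 0"
    by auto
  define G where "G = R * Gamma (1 - s / \<alpha>) / Gamma (1 - s)"
  have G: "G > 0" using R g by (simp add: G_def)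
  have m1: "(\<integral>x. \<bar>x\<bar> powr s \<partial>N) = G * cos (p * arctan \<tau>) / cos (s * pi / 2)"
    using moments(1)[OF s] g unfolding z by (simp add: G_def field_simps)
  have m2: "(\<integral>x. signed_powr x s \<partial>N) = G * sin (p * arctan \<tau>) / sin (s * pi / 2)"
    using moments(2)[OF s] g unfolding z signed_powr_def by (simp add: G_def field_simps)
  show "0 < (\<integral>x. \<bar>x\<bar> powr s \<partial>N)" unfolding m1 using G cosp g by simp
  have "s * arctan \<tau> / \<alpha> = p * arctan \<tau>" by (simp add: p_def)
  then show "(\<integral>x. signed_powr x s \<partial>N)
      = (\<integral>x. \<bar>x\<bar> powr s \<partial>N) * (tan (s * arctan \<tau> / \<alpha>) / tan (s * pi / 2))"
    unfolding m1 m2 tan_def using cosp g by (simp add: field_simps)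
qed

section \<open>Root-n consistency of the residual-based estimator\<close>

theorem theorem3p2:
  fixes M :: "'a measure"
    and X :: "nat \<Rightarrow> real ^ 'q"
    and Y eps :: "nat \<Rightarrow> 'a \<Rightarrow> real"
    and \<Theta> :: "(real \<times> real \<times> real \<times> (real ^ 'q)) set"
    and \<Theta>\<^sub>\<mu> :: "(real ^ 'q) set"
    and \<alpha>0 \<beta>0 \<sigma>0 r :: real
    and \<mu>0 :: "real ^ 'q"
    and \<alpha>h \<beta>h \<sigma>h :: "nat \<Rightarrow> 'a \<Rightarrow> real"
    and \<mu>h :: "nat \<Rightarrow> 'a \<Rightarrow> real ^ 'q"
  assumes "prob_space M"
    and Theta: "bounded \<Theta>" "convex \<Theta>"
      "\<Theta> \<subseteq> {0<..<2} \<times> {-1<..<1} \<times> {0<..} \<times> UNIV"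
      "(\<alpha>0, \<beta>0, \<sigma>0, \<mu>0) \<in> \<Theta>"
    and Theta_mu: "bounded \<Theta>\<^sub>\<mu>" "convex \<Theta>\<^sub>\<mu>" "open \<Theta>\<^sub>\<mu>" "\<mu>0 \<in> \<Theta>\<^sub>\<mu>"
    and noise_indep: "prob_space.indep_vars M (\<lambda>_. borel) eps {1..}"
    and noise_law: "\<forall>j\<ge>1. has_stable0_law M (eps j) \<alpha>0 \<beta>0 1 0"
    and model: "\<forall>j\<ge>1. \<forall>\<omega>\<in>space M. Y j \<omega> = X j \<bullet> \<mu>0 + \<sigma>0 * eps j \<omega>"
    and cond1: "\<exists>C\<^sub>X>0. \<forall>j\<ge>2. norm (incr X j) < C\<^sub>X"
    and cond2: "\<exists>C\<^sub>0 \<beta>1. pos_def C\<^sub>0 \<and> 0 < \<beta>1 \<and> \<beta>1 < 1/2 \<and>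
      (\<exists>B. \<forall>n\<ge>1. norm (real n powr \<beta>1 *\<^sub>R
         ((1 / real n) *\<^sub>R (\<Sum>j=2..n. outer (incr X j) (incr X j)) - C\<^sub>0)) \<le> B)"
    and cond3: "\<exists>D\<^sub>0. (\<lambda>n. (1 / (real n - 2)) *\<^sub>R
         (\<Sum>j=2..n-1. outer (incr X j) (incr X (j + 1)))) \<longlonglongrightarrow> D\<^sub>0"
    and cond4: "\<exists>\<Upsilon> \<beta>2. continuous_on \<Theta>\<^sub>\<mu> \<Upsilon> \<and> 0 \<le> \<beta>2 \<and> \<beta>2 < 1/2 \<and>
      (\<exists>B. \<forall>n\<ge>1. \<forall>\<mu>\<in>\<Theta>\<^sub>\<mu>.
         \<bar>real n powr (1/2 - \<beta>2) * (Y_star M eps X \<sigma>0 \<mu>0 n \<mu> - \<Upsilon> \<mu>)\<bar> \<le> B) \<and>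
      (\<exists>l>0. \<forall>\<mu>\<in>\<Theta>\<^sub>\<mu>. \<Upsilon> \<mu> = \<Upsilon> \<mu> - \<Upsilon> \<mu>0 \<and>
         \<Upsilon> \<mu> - \<Upsilon> \<mu>0 \<le> - l * (norm (\<mu> - \<mu>0))\<^sup>2)"
    and cond5_moments: "\<forall>K>0. integrable M (\<lambda>\<omega>. \<bar>ln (1 + (eps 1 \<omega>)\<^sup>2)\<bar> powr K)"
    and cond5_density: "\<exists>f c1 c2 b.
      distributed M lborel (\<lambda>\<omega>. \<sigma>0 * (eps 2 \<omega> - eps 1 \<omega>)) (\<lambda>x. ennreal (f x)) \<and>
      (\<forall>x. 0 \<le> f x) \<and> (\<forall>x. f (- x) = f x) \<and> f 1 > 0 \<and>
      (\<forall>x\<ge>1. f x \<le> f 1) \<and> (\<forall>x\<in>{0..1}. f 1 \<le> f x) \<and>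
      0 < c1 \<and> c1 < c2 \<and> c2 < 1 \<and> b > 0 \<and>
      (\<forall>x\<in>{c1..c2}. (1 + b) * f 1 \<le> f x)"
    and r: "0 < r" "r < \<alpha>0 / 4"
    and measurable_est: "\<forall>n. \<mu>h n \<in> borel_measurable M" "\<forall>n. \<alpha>h n \<in> borel_measurable M"
      "\<forall>n. \<beta>h n \<in> borel_measurable M" "\<forall>n. \<sigma>h n \<in> borel_measurable M"
    and CQMLE: "\<forall>n\<ge>2. \<forall>\<omega>\<in>space M.
      is_arg_max (cauchy_qlik X (\<lambda>j. Y j \<omega>) n) (\<lambda>\<mu>. \<mu> \<in> closure \<Theta>\<^sub>\<mu>) (\<mu>h n \<omega>)"
    and moment_est: "\<forall>n\<ge>3. \<forall>\<omega>\<in>space M.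
      moment_estimate r (resid X (\<lambda>j. Y j \<omega>) (\<mu>h n \<omega>)) n (\<alpha>h n \<omega>) (\<beta>h n \<omega>) (\<sigma>h n \<omega>)"
  shows "bounded_in_prob M (\<lambda>n \<omega>. sqrt (real n) *\<^sub>R
           ((\<alpha>h n \<omega>, \<beta>h n \<omega>, \<sigma>h n \<omega>, \<mu>h n \<omega>) - (\<alpha>0, \<beta>0, \<sigma>0, \<mu>0)))"
proof -
  interpret prob_space M by fact
  interpret iid_noise M eps by unfold_locales (rule noise_indep)
  have \<alpha>0: "0 < \<alpha>0" "\<alpha>0 < 2" and \<sigma>0: "0 < \<sigma>0" using Theta(3,4) by auto
  have r2: "2 * r < 1" "4 * r < \<alpha>0" "r < 1" using r \<alpha>0 by linarith+
  have char_eps: "char (distr M borel (eps i)) u = stable0_char \<alpha>0 \<beta>0 1 0 u" if "1 \<le> i" for i u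
    using noise_law that by (simp add: has_stable0_law_def)
  have eps_m: "eps i \<in> borel_measurable M" if "1 \<le> i" for i using eps_measurable[OF that] .

  define Z where "Z j \<omega> = \<sigma>0 * (eps j \<omega> - eps (j - 1) \<omega>)" for j \<omega>
  define W where "W j \<omega> = \<sigma>0 * (eps j \<omega> + eps (j - 1) \<omega> - 2 * eps (j - 2) \<omega>)" for j \<omega>
  define NZ where "NZ = distr M borel (Z 2)"
  define NW where "NW = distr M borel (W 3)"
  define \<phi> where "\<phi> = stable0_char \<alpha>0 \<beta>0 1 0"

  have Z_m: "Z j \<in> borel_measurable M" if "2 \<le> j" for j
    unfolding Z_def using eps_m[of j] eps_m[of "j - 1"] that by auto
  have W_m: "W j \<in> borel_measurable M" if "3 \<le> j" for j
    unfolding W_def using eps_m[of j] eps_m[of "j - 1"] eps_m[of "j - 2"] that by auto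
  \<comment> \<open>The characteristic functions do not depend on \<open>j\<close>, hence neither do the laws.\<close>
  have char_Z: "char (distr M borel (Z j)) u = \<phi> (\<sigma>0 * u) * \<phi> (- (\<sigma>0 * u))" if j: "2 \<le> j" for j u
  proof -
    define c where "c i = (if i = j then \<sigma>0 else - \<sigma>0)" for i
    have "j = Suc (Suc (j - 2))" using j by simp
    then obtain k where k: "j = Suc (Suc k)" by blast
    have "Z j = (\<lambda>\<omega>. \<Sum>i\<in>{j, j - 1}. c i * eps i \<omega>)"
      by (simp add: fun_eq_iff Z_def c_def k right_diff_distrib)
    moreover have "char (distr M borel (\<lambda>\<omega>. \<Sum>i\<in>{j, j - 1}. c i * eps i \<omega>)) u = (\<Prod>i\<in>{j, j - 1}. \<phi> (c i * u))"
      using j char_eps by (intro char_linear_combination) (auto simp: \<phi>_def)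
    moreover have "(\<Prod>i\<in>{j, j - 1}. \<phi> (c i * u)) = \<phi> (\<sigma>0 * u) * \<phi> (- (\<sigma>0 * u))"
      by (simp add: c_def k)
    ultimately show ?thesis by simp
  qed
  have char_W: "char (distr M borel (W j)) u = (\<phi> (\<sigma>0 * u))\<^sup>2 * \<phi> (- 2 * (\<sigma>0 * u))" if j: "3 \<le> j" for j u
  proof -
    define c where "c i = (if i = j - 2 then - 2 * \<sigma>0 else \<sigma>0)" for i
    have "j = Suc (Suc (Suc (j - 3)))" using j by simp
    then obtain k where k: "j = Suc (Suc (Suc k))" by blast
    have "W j = (\<lambda>\<omega>. \<Sum>i\<in>{j, j - 1, j - 2}. c i * eps i \<omega>)"
      by (simp add: fun_eq_iff W_def c_def k numeral_2_eq_2 right_diff_distrib distrib_left)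
    moreover have "char (distr M borel (\<lambda>\<omega>. \<Sum>i\<in>{j, j - 1, j - 2}. c i * eps i \<omega>)) u = (\<Prod>i\<in>{j, j - 1, j - 2}. \<phi> (c i * u))"
      using j char_eps by (intro char_linear_combination) (auto simp: \<phi>_def)
    moreover have "(\<Prod>i\<in>{j, j - 1, j - 2}. \<phi> (c i * u)) = (\<phi> (\<sigma>0 * u))\<^sup>2 * \<phi> (- 2 * (\<sigma>0 * u))"
      by (simp add: c_def k numeral_2_eq_2 mult.assoc)
    ultimately show ?thesis by simp
  qed
  have law_Z: "distr M borel (Z j) = NZ" if "2 \<le> j" for j
    unfolding NZ_def using that Z_m char_Z
    by (intro Levy_uniqueness real_distribution_distr) (auto simp: fun_eq_iff)
  have law_W: "distr M borel (W j) = NW" if "3 \<le> j" for j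
    unfolding NW_def using that W_m char_W
    by (intro Levy_uniqueness real_distribution_distr) (auto simp: fun_eq_iff)
  have window_Z: "window_fn j (Z j)" if j: "2 \<le> j" for j
  proof -
    have "window_fn j (\<lambda>\<omega>. \<sigma>0 * eps j \<omega>)"
      by (rule window_fn_compose[OF window_fn_eps, of j j "\<lambda>x. \<sigma>0 * x"]) (use j in \<open>auto simp: window_def\<close>)
    moreover have "window_fn j (\<lambda>\<omega>. - \<sigma>0 * eps (j - 1) \<omega>)"
      by (rule window_fn_compose[OF window_fn_eps, of "j - 1" j "\<lambda>x. - \<sigma>0 * x"]) (use j in \<open>auto simp: window_def\<close>)
    ultimately have "window_fn j (\<lambda>\<omega>. \<sigma>0 * eps j \<omega> + - \<sigma>0 * eps (j - 1) \<omega>)" by (rule window_fn_add)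
    then show ?thesis by (simp add: Z_def[abs_def] algebra_simps)
  qed
  have window_W: "window_fn j (W j)" if j: "3 \<le> j" for j
  proof -
    have a: "window_fn j (\<lambda>\<omega>. \<sigma>0 * eps j \<omega>)"
      by (rule window_fn_compose[OF window_fn_eps, of j j "\<lambda>x. \<sigma>0 * x"]) (use j in \<open>auto simp: window_def\<close>)
    have b: "window_fn j (\<lambda>\<omega>. \<sigma>0 * eps (j - 1) \<omega>)"
      by (rule window_fn_compose[OF window_fn_eps, of "j - 1" j "\<lambda>x. \<sigma>0 * x"]) (use j in \<open>auto simp: window_def\<close>)
    have c: "window_fn j (\<lambda>\<omega>. - 2 * \<sigma>0 * eps (j - 2) \<omega>)"
      by (rule window_fn_compose[OF window_fn_eps, of "j - 2" j "\<lambda>x. - 2 * \<sigma>0 * x"]) (use j in \<open>auto simp: window_def\<close>)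
    have "window_fn j (\<lambda>\<omega>. (\<sigma>0 * eps j \<omega> + \<sigma>0 * eps (j - 1) \<omega>) + - 2 * \<sigma>0 * eps (j - 2) \<omega>)"
      by (intro window_fn_add a b c)
    then show ?thesis by (simp add: W_def[abs_def] algebra_simps)
  qed
  interpret SZ: stationary_noise M eps Z 2 NZ
    by unfold_locales (use window_Z law_Z in auto)
  interpret SW: stationary_noise M eps W 3 NW
    by unfold_locales (use window_W law_W in auto)

  define \<zeta>Z where "\<zeta>Z = complex_of_real (2 * \<sigma>0 powr \<alpha>0)"
  define \<zeta>W where "\<zeta>W = of_real (\<sigma>0 powr \<alpha>0) * (complex_of_real (2 + 2 powr \<alpha>0) - \<i> * of_real (\<beta>0 * beta_denom \<alpha>0))"
  have Re_pos: "0 < Re \<zeta>Z" "0 < Re \<zeta>W"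
    using \<sigma>0 by (auto simp: \<zeta>Z_def \<zeta>W_def intro!: mult_pos_pos add_pos_pos)
  have "real_distribution NZ" "real_distribution NW"
    unfolding NZ_def NW_def using Z_m[of 2] W_m[of 3] by (auto intro!: real_distribution_distr)
  moreover have "char NZ u = exp (- \<zeta>Z * of_real (u powr \<alpha>0))" if "0 < u" for u
    using char_Z[of 2 u] stable0_char_symmetrized[of "\<sigma>0 * u" \<alpha>0 \<beta>0] that \<sigma>0
    by (simp add: NZ_def \<phi>_def \<zeta>Z_def powr_mult mult_ac)
  moreover have "char NW u = exp (- \<zeta>W * of_real (u powr \<alpha>0))" if "0 < u" for u
    using char_W[of 3 u] stable0_char_contrast[of "\<sigma>0 * u" \<alpha>0 \<beta>0] that \<sigma>0
    by (simp add: NW_def \<phi>_def \<zeta>W_def powr_mult mult_ac)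
  ultimately have stable: "stable_char NZ \<alpha>0 \<zeta>Z" "stable_char NW \<alpha>0 \<zeta>W"
    using Re_pos \<alpha>0 by (auto simp: stable_char_def stable_char_axioms_def)
  interpret CZ: stable_char NZ \<alpha>0 \<zeta>Z by (rule stable(1))
  interpret CW: stable_char NW \<alpha>0 \<zeta>W by (rule stable(2))

  obtain C where C: "C > 0" "\<And>j. 2 \<le> j \<Longrightarrow> norm (incr X j) < C" using cond1 by blast
  define h where "h n \<omega> = \<mu>h n \<omega> - \<mu>0" for n \<omega>
  have incr_Y: "incr (\<lambda>j. Y j \<omega>) j - incr X j \<bullet> \<mu> = Z j \<omega> - incr X j \<bullet> (\<mu> - \<mu>0)"
    if "\<omega> \<in> space M" "2 \<le> j" for \<omega> j \<mu>
    using that model by (simp add: incr_def Z_def algebra_simps inner_simps)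

  have h_bounded: "stoch_bounded (\<lambda>n \<omega>. sqrt (real n) * norm (h n \<omega>))"
  proof -
    obtain C0 \<beta>1 B where C0: "pos_def C0" "0 < \<beta>1" and B: "\<And>n. 1 \<le> n \<Longrightarrow> norm (real n powr \<beta>1 *\<^sub>R
         ((1 / real n) *\<^sub>R (\<Sum>j=2..n. outer (incr X j) (incr X j)) - C0)) \<le> B"
      using cond2 by blast
    have gram: "(\<lambda>n. (1 / real n) *\<^sub>R (\<Sum>j=2..n. outer (incr X j) (incr X j))) \<longlonglongrightarrow> C0"
    proof (rule LIM_zero_cancel, rule Lim_null_comparison)
      show "\<forall>\<^sub>F n in sequentially. norm ((1 / real n) *\<^sub>R (\<Sum>j=2..n. outer (incr X j) (incr X j)) - C0)
          \<le> B * real n powr (- \<beta>1)"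
        using eventually_ge_at_top[of 1]
      proof eventually_elim
        case (elim n)
        have p: "real n powr \<beta>1 > 0" using elim by simp
        have "real n powr \<beta>1 * norm ((1 / real n) *\<^sub>R (\<Sum>j=2..n. outer (incr X j) (incr X j)) - C0) \<le> B"
          using B[OF elim] unfolding norm_scaleR abs_of_pos[OF p] .
        then have "norm ((1 / real n) *\<^sub>R (\<Sum>j=2..n. outer (incr X j) (incr X j)) - C0) \<le> B / real n powr \<beta>1"
          unfolding pos_le_divide_eq[OF p] by (simp only: mult.commute)
        then show ?case by (simp only: powr_minus divide_inverse)
      qed
      show "(\<lambda>n. B * real n powr (- \<beta>1)) \<longlonglongrightarrow> 0"
        using C0 by (intro tendsto_mult_right_zero tendsto_neg_powr filterlim_real_sequentially) auto
    qed
    obtain \<Upsilon> \<beta>2 B' l where \<beta>2: "\<beta>2 < 1 / 2"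
      and B': "\<And>n \<mu>. 1 \<le> n \<Longrightarrow> \<mu> \<in> \<Theta>\<^sub>\<mu> \<Longrightarrow>
         \<bar>real n powr (1/2 - \<beta>2) * (Y_star M eps X \<sigma>0 \<mu>0 n \<mu> - \<Upsilon> \<mu>)\<bar> \<le> B'"
      and l: "0 < l" "\<And>\<mu>. \<mu> \<in> \<Theta>\<^sub>\<mu> \<Longrightarrow> \<Upsilon> \<mu> = \<Upsilon> \<mu> - \<Upsilon> \<mu>0 \<and> \<Upsilon> \<mu> - \<Upsilon> \<mu>0 \<le> - l * (norm (\<mu> - \<mu>0))\<^sup>2"
      using cond4 by blast
    have Y_star: "Y_star M eps X \<sigma>0 \<mu>0 n \<mu> = - ((\<Sum>j=2..n. SZ.mean_contrast (incr X j \<bullet> (\<mu> - \<mu>0))) / real n)" for n \<mu>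
    proof -
      have "(\<integral>\<omega>. (ln (1 + (\<sigma>0 * incr (\<lambda>k. eps k \<omega>) 2 - t)\<^sup>2) - ln (1 + (\<sigma>0 * incr (\<lambda>k. eps k \<omega>) 2)\<^sup>2)) \<partial>M)
          = SZ.mean_contrast t" for t
      proof -
        have "SZ.mean_contrast t = expectation (\<lambda>\<omega>. cauchy_loss (Z 2 \<omega> - t) - cauchy_loss (Z 2 \<omega>))"
          unfolding SZ.mean_contrast_def by (rule SZ.expectation_Z[symmetric]) (auto simp: SZ.cauchy_measurable)
        then show ?thesis by (simp add: cauchy_loss_def Z_def incr_def)
      qed
      then show ?thesis by (simp add: Y_star_def)
    qed
    have contrast: "(\<lambda>n. (\<Sum>j=2..n. SZ.mean_contrast (incr X j \<bullet> (\<mu> - \<mu>0))) / real n) \<longlonglongrightarrow> - \<Upsilon> \<mu>"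
      if \<mu>: "\<mu> \<in> \<Theta>\<^sub>\<mu>" for \<mu>
    proof -
      have "(\<lambda>n. Y_star M eps X \<sigma>0 \<mu>0 n \<mu>) \<longlonglongrightarrow> \<Upsilon> \<mu>"
      proof (rule LIM_zero_cancel, rule Lim_null_comparison)
        show "\<forall>\<^sub>F n in sequentially. norm (Y_star M eps X \<sigma>0 \<mu>0 n \<mu> - \<Upsilon> \<mu>) \<le> B' * real n powr (- (1/2 - \<beta>2))"
          using eventually_ge_at_top[of 1]
        proof eventually_elim
          case (elim n)
          have p: "real n powr (1/2 - \<beta>2) > 0" using elim by simp
          have "real n powr (1/2 - \<beta>2) * \<bar>Y_star M eps X \<sigma>0 \<mu>0 n \<mu> - \<Upsilon> \<mu>\<bar> \<le> B'"
            using B'[OF elim \<mu>] by (simp add: abs_mult)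
          then show ?case unfolding powr_minus using p by (simp add: field_simps)
        qed
        show "(\<lambda>n. B' * real n powr (- (1/2 - \<beta>2))) \<longlonglongrightarrow> 0"
          using \<beta>2 by (intro tendsto_mult_right_zero tendsto_neg_powr filterlim_real_sequentially) auto
      qed
      from tendsto_minus[OF this] show ?thesis by (simp add: Y_star)
    qed
    have L: "l * (norm (\<mu> - \<mu>0))\<^sup>2 \<le> - \<Upsilon> \<mu>" if "\<mu> \<in> \<Theta>\<^sub>\<mu>" for \<mu>
      using l(2)[OF that] by linarith
    \<comment> \<open>The score is odd and the law of \<open>Z 2\<close> is symmetric.\<close>
    have score: "integral\<^sup>L NZ cauchy_score = 0"
    proof -
      have m: "(\<lambda>\<omega>. - Z 2 \<omega>) \<in> borel_measurable M" using Z_m[of 2] by simp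
      have "distr M borel (\<lambda>\<omega>. - Z 2 \<omega>) = NZ"
        unfolding NZ_def
      proof (intro Levy_uniqueness real_distribution_distr m Z_m ext)
        fix u
        have "char (distr M borel (\<lambda>\<omega>. - Z 2 \<omega>)) u = char (distr M borel (Z 2)) (- u)"
          unfolding char_def using m Z_m[of 2] by (subst (1 2) integral_distr) auto
        then show "char (distr M borel (\<lambda>\<omega>. - Z 2 \<omega>)) u = char (distr M borel (Z 2)) u"
          by (simp add: char_Z mult.commute)
      qed simp
      then have "integral\<^sup>L NZ cauchy_score = expectation (\<lambda>\<omega>. cauchy_score (- Z 2 \<omega>))"
        using integral_distr[OF m SZ.cauchy_measurable(2)] by simp
      also have "\<dots> = - expectation (\<lambda>\<omega>. cauchy_score (Z 2 \<omega>))" by (simp add: cauchy_score_def)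
      also have "expectation (\<lambda>\<omega>. cauchy_score (Z 2 \<omega>)) = integral\<^sup>L NZ cauchy_score"
        by (rule SZ.expectation_Z) (auto simp: SZ.cauchy_measurable)
      finally show ?thesis by simp
    qed
    have min: "\<forall>\<^sub>F n in sequentially. \<forall>\<omega>\<in>space M. \<mu>h n \<omega> \<in> closure \<Theta>\<^sub>\<mu> \<and>
      (\<Sum>j=2..n. cauchy_loss (Z j \<omega> - incr X j \<bullet> (\<mu>h n \<omega> - \<mu>0)) - cauchy_loss (Z j \<omega>)) \<le> 0"
      using eventually_ge_at_top[of 2]
    proof (eventually_elim, intro ballI conjI)
      fix n :: nat and \<omega> assume n: "2 \<le> n" and \<omega>: "\<omega> \<in> space M"
      have am: "is_arg_max (cauchy_qlik X (\<lambda>j. Y j \<omega>) n) (\<lambda>\<mu>. \<mu> \<in> closure \<Theta>\<^sub>\<mu>) (\<mu>h n \<omega>)"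
        using CQMLE n \<omega> by blast
      show "\<mu>h n \<omega> \<in> closure \<Theta>\<^sub>\<mu>" using am by (simp add: is_arg_max_def)
      have lik: "cauchy_qlik X (\<lambda>j. Y j \<omega>) n \<mu> = - (\<Sum>j=2..n. cauchy_loss (Z j \<omega> - incr X j \<bullet> (\<mu> - \<mu>0)))" for \<mu>
        unfolding cauchy_qlik_def sum_negf[symmetric]
        by (intro sum.cong refl) (simp add: incr_Y[OF \<omega>] cauchy_loss_def ln_div one_plus_square_pos)
      have "\<mu>0 \<in> closure \<Theta>\<^sub>\<mu>" using Theta_mu(4) closure_subset by blast
      then have "cauchy_qlik X (\<lambda>j. Y j \<omega>) n \<mu>0 \<le> cauchy_qlik X (\<lambda>j. Y j \<omega>) n (\<mu>h n \<omega>)"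
        using am by (auto simp: is_arg_max_def not_less)
      then show "(\<Sum>j=2..n. cauchy_loss (Z j \<omega> - incr X j \<bullet> (\<mu>h n \<omega> - \<mu>0)) - cauchy_loss (Z j \<omega>)) \<le> 0"
        unfolding lik by (simp add: sum_subtractf)
    qed
    show ?thesis
      unfolding h_def
      by (rule SZ.cauchy_qmle_root_n[OF _ _ C(1) gram C0(1) Theta_mu(1,3,4) contrast l(1) L score min])
        (use C(2) in \<open>auto intro: less_imp_le\<close>)
  qed

  define e where "e n \<omega> = resid X (\<lambda>j. Y j \<omega>) (\<mu>h n \<omega>)" for n \<omega>
  have res_S: "resid_S (e n \<omega>) j = Z j \<omega> - incr X j \<bullet> h n \<omega>" if "\<omega> \<in> space M" "2 \<le> j" for n \<omega> j
    using that model by (simp add: resid_S_def e_def resid_def Z_def incr_def h_def algebra_simps inner_simps)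
  define x2 where "x2 j = incr X j + 2 *\<^sub>R incr X (j - 1)" for j
  have res_C: "resid_C (e n \<omega>) j = W j \<omega> - x2 j \<bullet> h n \<omega>" if "\<omega> \<in> space M" "3 \<le> j" for n \<omega> j
  proof -
    have "j - 1 - 1 = j - 2" by simp
    then show ?thesis using that model
      by (simp add: resid_C_def e_def resid_def W_def x2_def incr_def h_def algebra_simps inner_simps)
  qed
  have x2: "norm (x2 j) \<le> 3 * C" if "3 \<le> j" for j
  proof -
    have "norm (x2 j) \<le> norm (incr X j) + norm (2 *\<^sub>R incr X (j - 1))" unfolding x2_def by (rule norm_triangle_ineq)
    moreover have "norm (incr X j) < C" "norm (incr X (j - 1)) < C" using that by (auto intro!: C(2))
    ultimately show ?thesis by simp
  qed
  have sq_abs: "(\<bar>x\<bar> powr s)\<^sup>2 = \<bar>x\<bar> powr (2 * s)" for x s :: real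
    unfolding power2_eq_square powr_add[symmetric] by simp
  have sq_signed: "(signed_powr x s)\<^sup>2 = \<bar>x\<bar> powr (2 * s)" for x s :: real
    by (cases "x = 0") (simp_all add: signed_powr_def power_mult_distrib sq_abs sgn_if)
  note sq_powr = sq_abs sq_signed
  have powr_diff_2: "\<bar>\<bar>z - t\<bar> powr s - \<bar>z\<bar> powr s\<bar> \<le> 2 * \<bar>t\<bar> * \<bar>z\<bar> powr (s - 1)"
    if "0 < s" "s \<le> 1" "z \<noteq> 0" for s z t :: real
    using abs_powr_diff_le[OF that, of t] by (rule order_trans) (simp add: mult_right_mono)
  have signed_m: "(\<lambda>x. signed_powr x r) \<in> borel_measurable borel"
    unfolding signed_powr_def by measurable

  \<comment> \<open>Used for the exponents \<open>r\<close> and \<open>2 r\<close>; square integrability in the second case is where \<open>4 r < \<alpha>0\<close> enters.\<close>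
  have mS: "stoch_bounded (\<lambda>n \<omega>. sqrt (real n) * (moment_S (e n \<omega>) n s - h_mom s \<alpha>0 \<sigma>0))"
    if s: "0 < s" "s \<le> 2 * r" for s
  proof -
    have s1: "s < 1" "s < \<alpha>0" "2 * s < \<alpha>0" using s r2 r by linarith+
    have "stoch_bounded (\<lambda>n \<omega>. sqrt (real n) *
        ((\<Sum>j=2..n. \<bar>Z j \<omega> - incr X j \<bullet> h n \<omega>\<bar> powr s) / (real n - (real 2 - 1)) - (\<integral>x. \<bar>x\<bar> powr s \<partial>NZ)))"
    proof (rule SZ.residual_average_root_n[where s = s and C = C, OF _ _ _ _ _ _ _ h_bounded])
      show "integrable NZ (\<lambda>x. (\<bar>x\<bar> powr s)\<^sup>2)"
        unfolding sq_powr using s s1 by (intro CZ.integrable_abs_powr) auto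
      show "integrable NZ (\<lambda>x. \<bar>x\<bar> powr (s - 1))"
        using CZ.integrable_abs_powr_minus[OF Re_pos(1), of "1 - s"] s s1 by simp
      show "AE x in NZ. x \<noteq> 0" by (rule CZ.AE_nonzero[OF Re_pos(1)])
      show "\<bar>\<bar>z - t\<bar> powr s - \<bar>z\<bar> powr s\<bar> \<le> 2 * \<bar>t\<bar> * \<bar>z\<bar> powr (s - 1)" if "z \<noteq> 0" for z t
        using s s1 that by (intro powr_diff_2) auto
    qed (use C(2) in \<open>auto intro: less_imp_le\<close>)
    then show ?thesis
    proof (rule stoch_bounded_cong)
      fix n \<omega> assume \<omega>: "\<omega> \<in> space M"
      have "(\<Sum>j=2..n. \<bar>resid_S (e n \<omega>) j\<bar> powr s) = (\<Sum>j=2..n. \<bar>Z j \<omega> - incr X j \<bullet> h n \<omega>\<bar> powr s)"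
        by (intro sum.cong refl) (simp add: res_S[OF \<omega>])
      moreover have "(\<integral>x. \<bar>x\<bar> powr s \<partial>NZ) = h_mom s \<alpha>0 \<sigma>0"
        using symmetric_stable_abs_moment[OF stable(1)[unfolded \<zeta>Z_def] \<sigma>0 s(1) s1(2,1)] .
      ultimately show "sqrt (real n) * (moment_S (e n \<omega>) n s - h_mom s \<alpha>0 \<sigma>0) = sqrt (real n) *
        ((\<Sum>j=2..n. \<bar>Z j \<omega> - incr X j \<bullet> h n \<omega>\<bar> powr s) / (real n - (real 2 - 1)) - (\<integral>x. \<bar>x\<bar> powr s \<partial>NZ))"
        by (simp add: moment_S_def)
    qed
  qed

  define H3 where "H3 = (\<integral>x. \<bar>x\<bar> powr r \<partial>NW)"
  define H4 where "H4 = (\<integral>x. signed_powr x r \<partial>NW)"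
  have W_conditions: "integrable NW (\<lambda>x. \<bar>x\<bar> powr (2 * r))" "integrable NW (\<lambda>x. \<bar>x\<bar> powr (r - 1))" "AE x in NW. x \<noteq> 0"
    using CW.integrable_abs_powr[of "2 * r"] CW.integrable_abs_powr_minus[OF Re_pos(2), of "1 - r"]
      CW.AE_nonzero[OF Re_pos(2)] r r2 by simp_all
  have mC: "stoch_bounded (\<lambda>n \<omega>. sqrt (real n) * (moment_C (e n \<omega>) n r - H3))"
  proof -
    have "stoch_bounded (\<lambda>n \<omega>. sqrt (real n) *
        ((\<Sum>j=3..n. \<bar>W j \<omega> - x2 j \<bullet> h n \<omega>\<bar> powr r) / (real n - (real 3 - 1)) - H3))"
      unfolding H3_def
      by (rule SW.residual_average_root_n[where s = r and C = "3 * C", OF _ _ _ _ _ _ x2 h_bounded])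
        (use W_conditions r r2 in \<open>auto simp: sq_powr intro!: powr_diff_2\<close>)
    then show ?thesis
    proof (rule stoch_bounded_cong)
      fix n \<omega> assume \<omega>: "\<omega> \<in> space M"
      have "(\<Sum>j=3..n. \<bar>resid_C (e n \<omega>) j\<bar> powr r) = (\<Sum>j=3..n. \<bar>W j \<omega> - x2 j \<bullet> h n \<omega>\<bar> powr r)"
        by (intro sum.cong refl) (simp add: res_C[OF \<omega>])
      then show "sqrt (real n) * (moment_C (e n \<omega>) n r - H3) = sqrt (real n) *
        ((\<Sum>j=3..n. \<bar>W j \<omega> - x2 j \<bullet> h n \<omega>\<bar> powr r) / (real n - (real 3 - 1)) - H3)"
        by (simp add: moment_C_def)
    qed
  qed
  have mC': "stoch_bounded (\<lambda>n \<omega>. sqrt (real n) * (signed_moment_C (e n \<omega>) n r - H4))"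
  proof -
    have "stoch_bounded (\<lambda>n \<omega>. sqrt (real n) *
        ((\<Sum>j=3..n. signed_powr (W j \<omega> - x2 j \<bullet> h n \<omega>) r) / (real n - (real 3 - 1)) - H4))"
      unfolding H4_def
      by (rule SW.residual_average_root_n[where s = r and C = "3 * C", OF _ signed_m _ _ _ _ x2 h_bounded])
        (use W_conditions r r2 in \<open>auto simp: sq_powr intro!: signed_powr_diff_le\<close>)
    then show ?thesis
    proof (rule stoch_bounded_cong)
      fix n \<omega> assume \<omega>: "\<omega> \<in> space M"
      have "(\<Sum>j=3..n. signed_powr (resid_C (e n \<omega>) j) r) = (\<Sum>j=3..n. signed_powr (W j \<omega> - x2 j \<bullet> h n \<omega>) r)"
        by (intro sum.cong refl) (simp add: res_C[OF \<omega>])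
      then show "sqrt (real n) * (signed_moment_C (e n \<omega>) n r - H4) = sqrt (real n) *
        ((\<Sum>j=3..n. signed_powr (W j \<omega> - x2 j \<bullet> h n \<omega>) r) / (real n - (real 3 - 1)) - H4)"
        by (simp add: signed_moment_C_def)
    qed
  qed

  define D where "D n \<omega> = \<bar>sqrt (real n) * (moment_S (e n \<omega>) n r - h_mom r \<alpha>0 \<sigma>0)\<bar>
    + \<bar>sqrt (real n) * (moment_S (e n \<omega>) n (2 * r) - h_mom (2 * r) \<alpha>0 \<sigma>0)\<bar>
    + \<bar>sqrt (real n) * (moment_C (e n \<omega>) n r - H3)\<bar>
    + \<bar>sqrt (real n) * (signed_moment_C (e n \<omega>) n r - H4)\<bar>
    + \<bar>sqrt (real n) * norm (h n \<omega>)\<bar>" for n \<omega>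
  have D: "stoch_bounded D"
    unfolding D_def using r
    by (intro stoch_bounded_add stoch_bounded_abs mS mC mC' h_bounded) auto

  have "r < \<alpha>0" using r by linarith
  note W_moments = skewed_stable_moments[OF stable(2)[unfolded \<zeta>W_def] \<sigma>0 r(1) this r2(3)]
  have H4_eq: "H4 = H3 * (tan (r * arctan (\<beta>0 * beta_denom \<alpha>0 / (2 + 2 powr \<alpha>0)) / \<alpha>0) / tan (r * pi / 2))"
    unfolding H3_def H4_def by (rule W_moments(2))
  obtain Cm where Cm: "\<forall>\<^sub>F d in at_right 0. \<forall>e n a b s. moment_estimate r e n a b s \<longrightarrow>
    \<bar>moment_S e n r - h_mom r \<alpha>0 \<sigma>0\<bar> \<le> d \<longrightarrow>
    \<bar>moment_S e n (2 * r) - h_mom (2 * r) \<alpha>0 \<sigma>0\<bar> \<le> d \<longrightarrow>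
    \<bar>moment_C e n r - H3\<bar> \<le> d \<longrightarrow> \<bar>signed_moment_C e n r - H4\<bar> \<le> d \<longrightarrow>
    \<bar>a - \<alpha>0\<bar> \<le> Cm * d \<and> \<bar>b - \<beta>0\<bar> \<le> Cm * d \<and> \<bar>s - \<sigma>0\<bar> \<le> Cm * d"
    using moment_estimate_calm[OF \<alpha>0(2) r \<sigma>0 W_moments(1)[folded H3_def], of \<beta>0]
    unfolding H4_eq by blast

  define V where "V n \<omega> = sqrt (real n) *\<^sub>R ((\<alpha>h n \<omega>, \<beta>h n \<omega>, \<sigma>h n \<omega>, \<mu>h n \<omega>) - (\<alpha>0, \<beta>0, \<sigma>0, \<mu>0))" for n \<omega>
  have V_m: "V n \<in> borel_measurable M" for n
    unfolding V_def using measurable_est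
    by (intro borel_measurable_scaleR borel_measurable_diff borel_measurable_Pair borel_measurable_const) auto
  have "\<exists>K>0. \<forall>\<^sub>F n in sequentially. measure M {\<omega> \<in> space M. norm (V n \<omega>) > K} \<le> \<epsilon>" if \<epsilon>: "\<epsilon> > 0" for \<epsilon>
  proof -
    obtain K where K: "0 < K" "\<forall>\<^sub>F n in sequentially. likely \<epsilon> (\<lambda>\<omega>. \<bar>D n \<omega>\<bar> \<le> K)"
      using D \<epsilon> by (rule stoch_boundedE)
    define K' where "K' = 3 * \<bar>Cm\<bar> * K + K"
    have "K' > 0" using K by (simp add: K'_def add_nonneg_pos)
    have "((\<lambda>n. K / sqrt (real n)) \<longlongrightarrow> 0) sequentially"
      by (intro tendsto_divide_0[OF tendsto_const] filterlim_at_top_imp_at_infinity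
          filterlim_compose[OF sqrt_at_top filterlim_real_sequentially])
    moreover have "\<forall>\<^sub>F n in sequentially. K / sqrt (real n) \<in> {0<..} \<and> K / sqrt (real n) \<noteq> 0"
      using eventually_gt_at_top[of 0] by eventually_elim (use K in simp)
    ultimately have "filterlim (\<lambda>n. K / sqrt (real n)) (at_right 0) sequentially"
      by (simp add: filterlim_at)
    from eventually_compose_filterlim[OF Cm this] K(2) eventually_ge_at_top[of 3]
    have "\<forall>\<^sub>F n in sequentially. measure M {\<omega> \<in> space M. norm (V n \<omega>) > K'} \<le> \<epsilon>"
    proof eventually_elim
      case (elim n)
      \<comment> \<open>Where all scaled deviations are at most \<open>K\<close>, the moments are within \<open>d = K / sqrt n\<close> of their population
      values, and the deterministic inversion applies.\<close>
      have sq: "sqrt (real n) > 0" using elim by simp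
      have "norm (V n \<omega>) \<le> K'" if \<omega>: "\<omega> \<in> space M" and D_le: "\<bar>D n \<omega>\<bar> \<le> K" for \<omega>
      proof -
        have est: "moment_estimate r (e n \<omega>) n (\<alpha>h n \<omega>) (\<beta>h n \<omega>) (\<sigma>h n \<omega>)"
          unfolding e_def using moment_est elim \<omega> by blast
        have parts: "\<bar>sqrt (real n) * (moment_S (e n \<omega>) n r - h_mom r \<alpha>0 \<sigma>0)\<bar> \<le> K"
          "\<bar>sqrt (real n) * (moment_S (e n \<omega>) n (2 * r) - h_mom (2 * r) \<alpha>0 \<sigma>0)\<bar> \<le> K"
          "\<bar>sqrt (real n) * (moment_C (e n \<omega>) n r - H3)\<bar> \<le> K"
          "\<bar>sqrt (real n) * (signed_moment_C (e n \<omega>) n r - H4)\<bar> \<le> K"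
          "\<bar>sqrt (real n) * norm (h n \<omega>)\<bar> \<le> K"
        proof -
          have "a \<le> K \<and> b \<le> K \<and> c \<le> K \<and> d \<le> K \<and> f \<le> K"
            if "0 \<le> a" "0 \<le> b" "0 \<le> c" "0 \<le> d" "0 \<le> f" "\<bar>a + b + c + d + f\<bar> \<le> K" for a b c d f :: real
            using that by linarith
          from this[OF abs_ge_zero abs_ge_zero abs_ge_zero abs_ge_zero abs_ge_zero D_le[unfolded D_def]]
          show "\<bar>sqrt (real n) * (moment_S (e n \<omega>) n r - h_mom r \<alpha>0 \<sigma>0)\<bar> \<le> K"
            "\<bar>sqrt (real n) * (moment_S (e n \<omega>) n (2 * r) - h_mom (2 * r) \<alpha>0 \<sigma>0)\<bar> \<le> K"
            "\<bar>sqrt (real n) * (moment_C (e n \<omega>) n r - H3)\<bar> \<le> K"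
            "\<bar>sqrt (real n) * (signed_moment_C (e n \<omega>) n r - H4)\<bar> \<le> K"
            "\<bar>sqrt (real n) * norm (h n \<omega>)\<bar> \<le> K"
            by blast+
        qed
        have scale: "\<bar>t\<bar> \<le> K / sqrt (real n)" if "\<bar>sqrt (real n) * t\<bar> \<le> K" for t
          using that sq by (simp add: abs_mult pos_le_divide_eq mult.commute)
        have close: "\<bar>\<alpha>h n \<omega> - \<alpha>0\<bar> \<le> Cm * (K / sqrt (real n))" "\<bar>\<beta>h n \<omega> - \<beta>0\<bar> \<le> Cm * (K / sqrt (real n))"
          "\<bar>\<sigma>h n \<omega> - \<sigma>0\<bar> \<le> Cm * (K / sqrt (real n))"
          using elim(1) est scale[OF parts(1)] scale[OF parts(2)] scale[OF parts(3)] scale[OF parts(4)] by blast+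
        have scaled: "\<bar>sqrt (real n) * t\<bar> \<le> \<bar>Cm\<bar> * K" if "\<bar>t\<bar> \<le> Cm * (K / sqrt (real n))" for t
        proof -
          have "\<bar>sqrt (real n) * t\<bar> \<le> sqrt (real n) * (Cm * (K / sqrt (real n)))"
            unfolding abs_mult using that sq by (intro mult_mono) auto
          also have "\<dots> = Cm * K" using sq by simp
          also have "\<dots> \<le> \<bar>Cm\<bar> * K" using K by (intro mult_right_mono) auto
          finally show ?thesis .
        qed
        define a where "a = sqrt (real n) * (\<alpha>h n \<omega> - \<alpha>0)"
        define b where "b = sqrt (real n) * (\<beta>h n \<omega> - \<beta>0)"
        define s where "s = sqrt (real n) * (\<sigma>h n \<omega> - \<sigma>0)"
        define m where "m = sqrt (real n) *\<^sub>R h n \<omega>"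
        have "V n \<omega> = (a, b, s, m)" by (simp add: V_def a_def b_def s_def m_def h_def)
        moreover have "norm (a, b, s, m) \<le> \<bar>a\<bar> + norm (b, s, m)" using norm_Pair_le[of a "(b, s, m)"] by simp
        moreover have "norm (b, s, m) \<le> \<bar>b\<bar> + norm (s, m)" using norm_Pair_le[of b "(s, m)"] by simp
        moreover have "norm (s, m) \<le> \<bar>s\<bar> + norm m" using norm_Pair_le[of s m] by simp
        moreover have "norm m \<le> K" using parts(5) by (simp add: m_def abs_mult)
        moreover have "\<bar>a\<bar> \<le> \<bar>Cm\<bar> * K" "\<bar>b\<bar> \<le> \<bar>Cm\<bar> * K" "\<bar>s\<bar> \<le> \<bar>Cm\<bar> * K"
          unfolding a_def b_def s_def using close by (auto intro!: scaled)
        ultimately show ?thesis by (simp add: K'_def)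
      qed
      then have "likely \<epsilon> (\<lambda>\<omega>. norm (V n \<omega>) \<le> K')" by (intro likely_mono[OF elim(2)]) auto
      then obtain A where A: "A \<in> events" "prob A \<le> \<epsilon>" "\<forall>\<omega>\<in>space M - A. norm (V n \<omega>) \<le> K'"
        by (auto simp: likely_def)
      have "prob {\<omega> \<in> space M. norm (V n \<omega>) > K'} \<le> prob A"
        using A by (intro finite_measure_mono) (auto simp: not_le[symmetric])
      then show ?case using A(2) by linarith
    qed
    with \<open>K' > 0\<close> show ?thesis by blast
  qed
  with V_m have "bounded_in_prob M V" by (simp add: bounded_in_prob_def)
  then show ?thesis by (simp only: V_def[abs_def])
qed

end
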